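(* Let $q\in\mathbf{C}$, $|q|>1$, $K=\mathbf{C}(\{z\})$. Let $\mu_1<\cdots<\mu_k$ be integers, $r_1,\dots,r_k\in\mathbf{N}^*$, $A_i\in\mathrm{GL}_{r_i}(\mathbf{C})$ and $P_i:=(K^{r_i},\Phi_{z^{\mu_i}A_i})$ for $1\le i\le k$. Then the set $\mathcal{F}(P_1,\dots,P_k)$ of isoformal analytic classes is an affine space (over $\mathbf{C}$) of dimension $$\sum_{1\le i<j\le k}r_ir_j(\mu_j-\mu_i).$$
   Context: $\mathbf{C}(\{z\})$ is the fraction field of the ring of convergent power series, with automorphism $\sigma_qf(z)=f(qz)$. A $q$-difference module over $K$ is a pair $(E,\Phi)$, $E$ a finite dimensional $K$-vector space, $\Phi$ a $\sigma_q$-linear bijection of $E$; morphisms are $K$-linear maps commuting with the $\Phi$'s. For $A\in\mathrm{GL}_n(K)$, $(K^n,\Phi_A)$ is given by $\Phi_A(X)=A^{-1}\sigma_q(X)$. The module $P_i$ is pure isoclinic of integral slope $\mu_i$ and rank $r_i$. $\mathcal{F}(P_1,\dots,P_k)$ is the set of equivalence classes of filtered $q$-difference modules $0=M_0\subset\cdots\subset M_k=M$ endowed with isomorphisms $u_i:M_i/M_{i-1}\simeq P_i$; two such objects are equivalent if there is a morphism $f:M\to M'$ with $f(M_i)\subset M'_i$ and whose induced maps $g_i:M_i/M_{i-1}\to M'_i/M'_{i-1}$ satisfy $u_i=u'_i\circ g_i$. *)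

theory Defs
  imports
    "HOL-Complex_Analysis.Laurent_Convergence"
    "HOL-Library.Function_Algebras"
    "Jordan_Normal_Form.Gauss_Jordan_Elimination"
begin

section \<open>The difference field of convergent Laurent series\<close>

lemma conv_fls_inverse:
  fixes f :: "complex fls"
  assumes "fls_conv_radius f > 0"
  shows "fls_conv_radius (inverse f) > 0"
proof -
  have "eval_fls f has_laurent_expansion f"
    using assms by (simp add: has_laurent_expansion_def)
  from has_laurent_expansion_inverse[OF this] show ?thesis
    by (simp add: has_laurent_expansion_def)
qed

lemma conv_fls_scale:
  fixes f :: "complex fls"
  assumes "fls_conv_radius f > 0"
  shows "fls_conv_radius (fls_compose_fps f (fps_const q * fps_X)) > 0"
proof (cases "q = 0")
  case True
  then show ?thesis by (simp add: fls_compose_fps_0_right)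
next
  case False
  have 1: "eval_fls f has_laurent_expansion f"
    using assms by (simp add: has_laurent_expansion_def)
  have 2: "(\<lambda>z. q * z) has_laurent_expansion fps_to_fls (fps_const q * fps_X)"
    by (intro has_laurent_expansion_fps fps_expansion_intros)
  have "(eval_fls f \<circ> (\<lambda>z. q * z)) has_laurent_expansion
          fls_compose_fps f (fps_const q * fps_X)"
    by (rule has_laurent_expansion_compose[OF 1 2]) (use False in auto)
  then show ?thesis by (simp add: has_laurent_expansion_def)
qed

text \<open>
  The type \<open>germ\<close> is the field \<open>\<^bold>C({z})\<close>, realised inside the formal Laurent series. That it is
  the fraction field of the ring of convergent power series is
  \<open>germ_fraction\<close> and \<open>germ_fraction_closed\<close> below.
\<close>

typedef germ = "{f :: complex fls. fls_conv_radius f > 0}"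
  morphisms fls_of_germ germ_of_fls
  by (rule exI[of _ 0]) simp

setup_lifting type_definition_germ

instantiation germ :: field
begin

lift_definition zero_germ :: germ is 0 by simp
lift_definition one_germ :: germ is 1 by simp
lift_definition plus_germ :: "germ \<Rightarrow> germ \<Rightarrow> germ" is "(+)"
  using fls_conv_radius_add less_le_trans by (metis min_less_iff_conj)
lift_definition minus_germ :: "germ \<Rightarrow> germ \<Rightarrow> germ" is "(-)"
  using fls_conv_radius_diff less_le_trans by (metis min_less_iff_conj)
lift_definition uminus_germ :: "germ \<Rightarrow> germ" is uminus by simp
lift_definition times_germ :: "germ \<Rightarrow> germ \<Rightarrow> germ" is "(*)"
  using fls_conv_radius_mult less_le_trans by (metis min_less_iff_conj)
lift_definition inverse_germ :: "germ \<Rightarrow> germ" is inverse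
  by (rule conv_fls_inverse)
definition divide_germ :: "germ \<Rightarrow> germ \<Rightarrow> germ" where
  "divide_germ f g = f * inverse g"

instance
  by standard (unfold divide_germ_def, (transfer, simp add: algebra_simps)+)

end

lift_definition germ_const :: "complex \<Rightarrow> germ" is fls_const by simp

lift_definition germ_z :: germ is fls_X by simp

lift_definition germ_of_fps :: "complex fps \<Rightarrow> germ" is
  "\<lambda>f. if fps_conv_radius f > 0 then fps_to_fls f else 0" by simp

lemma germ_fraction:
  "\<exists>f g. fps_conv_radius f > 0 \<and> fps_conv_radius g > 0 \<and> g \<noteq> 0 \<and>
         x = germ_of_fps f / germ_of_fps g"
proof -
  define F where "F = fls_of_germ x"
  define f where "f = fls_base_factor_to_fps F"
  define n where "n = fls_subdegree F"
  have f: "fps_conv_radius f > 0"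
    using fls_of_germ[of x] by (simp add: f_def F_def fls_conv_radius_altdef)
  have F: "F = fls_X_intpow n * fps_to_fls f"
    by (cases "F = 0") (simp_all add: f_def n_def fls_shifted_times_simps)
  define a b where "a = nat n" and "b = nat (-n)"
  have fa: "fps_conv_radius (fps_X ^ a * f) > 0"
  proof -
    have "min (fps_conv_radius (fps_X ^ a)) (fps_conv_radius f) > 0"
      using f by simp
    then show ?thesis using fps_conv_radius_mult less_le_trans by blast
  qed
  have gb: "fps_conv_radius (fps_X ^ b :: complex fps) > 0" by simp
  have "x * germ_of_fps (fps_X ^ b) = germ_of_fps (fps_X ^ a * f)"
  proof -
    have "F * fps_to_fls (fps_X ^ b) = fps_to_fls (fps_X ^ a * f)"
      unfolding F a_def b_def
      by (cases "n \<ge> 0")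
         (simp_all add: fls_times_fps_to_fls fps_to_fls_power fls_X_power_conv_shift_1
            fls_shifted_times_simps)
    then show ?thesis
      using fa gb unfolding F_def by transfer simp
  qed
  moreover have "germ_of_fps (fps_X ^ b) \<noteq> 0"
    using gb by transfer (simp add: fps_to_fls_power)
  ultimately have "x = germ_of_fps (fps_X ^ a * f) / germ_of_fps (fps_X ^ b)"
    by (simp add: field_simps)
  moreover have "fps_X ^ b \<noteq> (0 :: complex fps)" by simp
  ultimately show ?thesis using fa gb by blast
qed

lemma germ_fraction_closed:
  assumes "fps_conv_radius f > 0" "fps_conv_radius g > 0"
  shows "germ_of_fps (f + g) = germ_of_fps f + germ_of_fps g"
    and "germ_of_fps (f * g) = germ_of_fps f * germ_of_fps g"
    and "germ_of_fps f = germ_of_fps g \<longleftrightarrow> f = g"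
    and "germ_of_fps 1 = 1"
proof -
  have s: "fps_conv_radius (f + g) > 0" "fps_conv_radius (f * g) > 0"
    using assms fps_conv_radius_add fps_conv_radius_mult less_le_trans
    by (metis min_less_iff_conj)+
  show "germ_of_fps (f + g) = germ_of_fps f + germ_of_fps g"
    using assms s by transfer simp
  show "germ_of_fps (f * g) = germ_of_fps f * germ_of_fps g"
    using assms s by transfer (simp add: fls_times_fps_to_fls)
  show "germ_of_fps f = germ_of_fps g \<longleftrightarrow> f = g"
    using assms by transfer simp
  show "germ_of_fps 1 = 1"
    by transfer simp
qed

text \<open>The automorphism \<open>f(z) \<mapsto> f(qz)\<close>.\<close>

lift_definition germ_sigma :: "complex \<Rightarrow> germ \<Rightarrow> germ" is
  "\<lambda>q f. fls_compose_fps f (fps_const q * fps_X)"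
  by (rule conv_fls_scale)


section \<open>Modules over the difference field\<close>

text \<open>
  A finite dimensional vector space over \<open>germ\<close> is represented as a finite dimensional subspace of
  the fixed space of all sequences of germs. Every finite dimensional space is isomorphic to such a
  subspace, so that this restriction, which turns the collection of all filtered modules
  into a set, loses no isomorphism class.
\<close>

type_synonym gvec = "nat \<Rightarrow> germ"

definition gscale :: "germ \<Rightarrow> gvec \<Rightarrow> gvec" where
  "gscale c x = (\<lambda>i. c * x i)"

global_interpretation gv: vector_space gscale
  by standard (auto simp: gscale_def algebra_simps fun_eq_iff)

definition gspace :: "nat \<Rightarrow> gvec set" where
  "gspace n = {x. \<forall>i\<ge>n. x i = 0}"

type_synonym qmod = "gvec set \<times> (gvec \<Rightarrow> gvec)"

definition qdiff_module :: "complex \<Rightarrow> qmod \<Rightarrow> bool" where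
  "qdiff_module q M \<longleftrightarrow> (case M of (E, \<Phi>) \<Rightarrow>
     gv.subspace E \<and> (\<exists>B. finite B \<and> gv.span B = E) \<and>
     bij_betw \<Phi> E E \<and>
     (\<forall>x\<in>E. \<forall>y\<in>E. \<Phi> (x + y) = \<Phi> x + \<Phi> y) \<and>
     (\<forall>c. \<forall>x\<in>E. \<Phi> (gscale c x) = gscale (germ_sigma q c) (\<Phi> x)))"

definition qdiff_morphism :: "qmod \<Rightarrow> qmod \<Rightarrow> (gvec \<Rightarrow> gvec) \<Rightarrow> bool" where
  "qdiff_morphism M M' f \<longleftrightarrow> (case (M, M') of ((E, \<Phi>), (E', \<Phi>')) \<Rightarrow>
     f ` E \<subseteq> E' \<and>
     (\<forall>x\<in>E. \<forall>y\<in>E. f (x + y) = f x + f y) \<and>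
     (\<forall>c. \<forall>x\<in>E. f (gscale c x) = gscale c (f x)) \<and>
     (\<forall>x\<in>E. f (\<Phi> x) = \<Phi>' (f x)))"

definition gmat_apply :: "germ mat \<Rightarrow> gvec \<Rightarrow> gvec" where
  "gmat_apply B x = (\<lambda>a. if a < dim_row B then \<Sum>b<dim_col B. B $$ (a, b) * x b else 0)"

definition matrix_module :: "complex \<Rightarrow> germ mat \<Rightarrow> qmod" where
  "matrix_module q A =
     (gspace (dim_row A), \<lambda>X. gmat_apply (the (mat_inverse A)) (\<lambda>a. germ_sigma q (X a)))"

definition zpow_mat :: "int \<Rightarrow> complex mat \<Rightarrow> germ mat" where
  "zpow_mat \<mu> A = map_mat (\<lambda>a. germ_z powi \<mu> * germ_const a) A"


section \<open>Filtered modules with prescribed graded pieces\<close>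

definition qcoset :: "gvec set \<Rightarrow> gvec \<Rightarrow> gvec set" where
  "qcoset N x = (\<lambda>y. x + y) ` N"

text \<open>
  \<open>quotient_iso M N P u\<close>: \<open>u\<close> is an isomorphism from the quotient of the module \<open>M\<close> by its submodule
  with underlying space \<open>N\<close> onto the module \<open>P\<close>. The operations of the quotient are those induced on
  cosets from representatives.
\<close>

definition quotient_iso :: "qmod \<Rightarrow> gvec set \<Rightarrow> qmod \<Rightarrow> (gvec set \<Rightarrow> gvec) \<Rightarrow> bool" where
  "quotient_iso M N P u \<longleftrightarrow> (case (M, P) of ((E, \<Phi>), (E', \<Psi>)) \<Rightarrow>
     bij_betw u (qcoset N ` E) E' \<and>
     (\<forall>x\<in>E. \<forall>y\<in>E. u (qcoset N (x + y)) = u (qcoset N x) + u (qcoset N y)) \<and>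
     (\<forall>c. \<forall>x\<in>E. u (qcoset N (gscale c x)) = gscale c (u (qcoset N x))) \<and>
     (\<forall>x\<in>E. u (qcoset N (\<Phi> x)) = \<Psi> (u (qcoset N x))))"

record filtered_qmod =
  fil :: "nat \<Rightarrow> gvec set"
  phi :: "gvec \<Rightarrow> gvec"
  gr_iso :: "nat \<Rightarrow> gvec set \<Rightarrow> gvec"

definition filtered_object :: "complex \<Rightarrow> nat \<Rightarrow> (nat \<Rightarrow> qmod) \<Rightarrow> filtered_qmod \<Rightarrow> bool" where
  "filtered_object q k P M \<longleftrightarrow>
     fil M 0 = {0} \<and>
     (\<forall>i\<le>k. qdiff_module q (fil M i, phi M)) \<and>
     (\<forall>i\<in>{1..k}. fil M (i - 1) \<subseteq> fil M i \<and>
        quotient_iso (fil M i, phi M) (fil M (i - 1)) (P i) (gr_iso M i))"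

definition filtered_equiv ::
    "complex \<Rightarrow> nat \<Rightarrow> (nat \<Rightarrow> qmod) \<Rightarrow> (filtered_qmod \<times> filtered_qmod) set" where
  "filtered_equiv q k P = {(M, M').
     filtered_object q k P M \<and> filtered_object q k P M' \<and>
     (\<exists>f. qdiff_morphism (fil M k, phi M) (fil M' k, phi M') f \<and>
          (\<forall>i\<le>k. f ` fil M i \<subseteq> fil M' i) \<and>
          (\<forall>i\<in>{1..k}. \<forall>x\<in>fil M i.
             gr_iso M i (qcoset (fil M (i - 1)) x) =
             gr_iso M' i (qcoset (fil M' (i - 1)) (f x))))}"

definition isoformal_classes :: "complex \<Rightarrow> nat \<Rightarrow> (nat \<Rightarrow> qmod) \<Rightarrow> filtered_qmod set set" where
  "isoformal_classes q k P = {M. filtered_object q k P M} // filtered_equiv q k P"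

definition isoformal_class ::
    "complex \<Rightarrow> nat \<Rightarrow> (nat \<Rightarrow> qmod) \<Rightarrow> filtered_qmod \<Rightarrow> filtered_qmod set" where
  "isoformal_class q k P M = filtered_equiv q k P `` {M}"

definition pure_piece :: "complex \<Rightarrow> int \<Rightarrow> complex mat \<Rightarrow> qmod" where
  "pure_piece q \<mu> A = matrix_module q (zpow_mat \<mu> A)"


section \<open>Affine spaces and algebraic families\<close>

definition cspace :: "nat \<Rightarrow> (nat \<Rightarrow> complex) set" where
  "cspace d = {v. \<forall>i\<ge>d. v i = 0}"

text \<open>An affine space of dimension \<open>d\<close>: a nonempty set with a simply transitive action of the
  translation group \<open>\<^bold>C\<close>\<open>\<^sup>d\<close>.\<close>

definition affine_space :: "nat \<Rightarrow> 'x set \<Rightarrow> ((nat \<Rightarrow> complex) \<Rightarrow> 'x \<Rightarrow> 'x) \<Rightarrow> bool" where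
  "affine_space d X act \<longleftrightarrow>
     X \<noteq> {} \<and>
     (\<forall>v\<in>cspace d. \<forall>x\<in>X. act v x \<in> X) \<and>
     (\<forall>x\<in>X. act 0 x = x) \<and>
     (\<forall>v\<in>cspace d. \<forall>w\<in>cspace d. \<forall>x\<in>X. act (v + w) x = act v (act w x)) \<and>
     (\<forall>x\<in>X. \<forall>y\<in>X. \<exists>!v. v \<in> cspace d \<and> act v x = y)"

text \<open>
  \<open>f\<close> is a polynomial in the first \<open>m\<close> coordinates, with coefficients in a \<open>\<^bold>C\<close>-vector space whose
  scalar multiplication is \<open>scl\<close>; \<open>S\<close> is a set of multi-exponents.
\<close>

definition polynomial_fun ::
    "nat \<Rightarrow> (complex \<Rightarrow> 'b \<Rightarrow> 'b) \<Rightarrow> ((nat \<Rightarrow> complex) \<Rightarrow> 'b::comm_monoid_add) \<Rightarrow> bool" where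
  "polynomial_fun m scl f \<longleftrightarrow>
     (\<exists>(S :: (nat \<Rightarrow> nat) set) c. finite S \<and>
        (\<forall>t. f t = (\<Sum>\<alpha>\<in>S. scl (\<Prod>i<m. t i ^ \<alpha> i) (c \<alpha>))))"

text \<open>
  The coordinates \<open>0, \<dots>, r\<^sub>1 + \<dots> + r\<^sub>k - 1\<close> are cut into consecutive blocks, numbered from 1, of
  sizes \<open>r\<^sub>1, \<dots>, r\<^sub>k\<close>; \<open>offset r i\<close> is the end of block \<open>i\<close> and \<open>block r a\<close> is the number of the block
  containing \<open>a\<close>.
\<close>

definition offset :: "(nat \<Rightarrow> nat) \<Rightarrow> nat \<Rightarrow> nat" where
  "offset r i = (\<Sum>j=1..i. r j)"

definition block :: "(nat \<Rightarrow> nat) \<Rightarrow> nat \<Rightarrow> nat" where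
  "block r a = (LEAST i. a < offset r i)"

text \<open>The block upper triangular matrix with diagonal blocks \<open>z\<^sup>\<mu>\<^sub>i A\<^sub>i\<close> and blocks \<open>U\<^sub>i\<^sub>j\<close> for \<open>i < j\<close>.\<close>

definition block_matrix ::
    "nat \<Rightarrow> (nat \<Rightarrow> int) \<Rightarrow> (nat \<Rightarrow> nat) \<Rightarrow> (nat \<Rightarrow> complex mat) \<Rightarrow>
     (nat \<Rightarrow> nat \<Rightarrow> germ mat) \<Rightarrow> germ mat" where
  "block_matrix k \<mu> r A U = mat (offset r k) (offset r k) (\<lambda>(a, b).
     let i = block r a; j = block r b; a' = a - offset r (i - 1); b' = b - offset r (j - 1) in
     if i = j then zpow_mat (\<mu> i) (A i) $$ (a', b')
     else if i < j then U i j $$ (a', b')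
     else 0)"

text \<open>
  The module of this matrix, filtered by the spans of the first blocks of coordinates; the graded
  pieces are identified with the modules of the diagonal blocks by reading off the coordinates in the
  corresponding block (of any representative).
\<close>

definition matrix_object ::
    "complex \<Rightarrow> nat \<Rightarrow> (nat \<Rightarrow> int) \<Rightarrow> (nat \<Rightarrow> nat) \<Rightarrow> (nat \<Rightarrow> complex mat) \<Rightarrow>
     (nat \<Rightarrow> nat \<Rightarrow> germ mat) \<Rightarrow> filtered_qmod" where
  "matrix_object q k \<mu> r A U =
     \<lparr> fil = (\<lambda>i. gspace (offset r i)),
       phi = snd (matrix_module q (block_matrix k \<mu> r A U)),
       gr_iso = (\<lambda>i C l. if l < r i then (SOME x. x \<in> C) (offset r (i - 1) + l) else 0) \<rparr>"

text \<open>
  Algebraic families of filtered modules with the given graded pieces, parametrised by \<open>\<^bold>C\<close>\<open>\<^sup>m\<close>: the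
  entries of the blocks \<open>U\<^sub>i\<^sub>j\<close> are in \<open>\<^bold>C[t\<^sub>1,\<dots>,t\<^sub>m] \<otimes> \<^bold>C({z})\<close>. As the graded pieces are
  free, every filtered module over this ring whose graded pieces are the scalar extensions of the given
  ones has, in an adapted basis, a matrix of this form.
\<close>

definition algebraic_family ::
    "nat \<Rightarrow> nat \<Rightarrow> (nat \<Rightarrow> nat) \<Rightarrow> ((nat \<Rightarrow> complex) \<Rightarrow> nat \<Rightarrow> nat \<Rightarrow> germ mat) \<Rightarrow> bool" where
  "algebraic_family m k r U \<longleftrightarrow>
     (\<forall>i\<in>{1..k}. \<forall>j\<in>{i<..k}.
        (\<forall>t. U t i j \<in> carrier_mat (r i) (r j)) \<and>
        (\<forall>a<r i. \<forall>b<r j.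
           polynomial_fun m (\<lambda>c x. germ_const c * x) (\<lambda>t. U t i j $$ (a, b))))"

text \<open>
  Any set with the cardinality of \<open>\<^bold>C\<close> admits some simply transitive action of \<open>\<^bold>C\<close>\<open>\<^sup>d\<close>, so that a bare
  existence statement would say nothing about the classes. The affine space must be the moduli space: the
  points of \<open>\<^bold>C\<close>\<open>\<^sup>d\<close>, transported to \<open>X\<close> from any origin \<open>p\<close>, are the classes of the members of an
  algebraic family over \<open>\<^bold>C\<close>\<open>\<^sup>d\<close>, and every algebraic family over some \<open>\<^bold>C\<close>\<open>\<^sup>m\<close> has a polynomial
  classifying map \<open>\<^bold>C\<close>\<open>\<^sup>m \<rightarrow> \<^bold>C\<close>\<open>\<^sup>d\<close>. This determines the affine coordinates up to
  polynomial automorphisms of \<open>\<^bold>C\<close>\<open>\<^sup>d\<close>, that is, the variety structure on \<open>X\<close>. Here \<open>cl U\<close> is the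
  class of the filtered module with blocks \<open>U\<close>.
\<close>

definition classifies_families ::
    "nat \<Rightarrow> (nat \<Rightarrow> nat) \<Rightarrow> ((nat \<Rightarrow> nat \<Rightarrow> germ mat) \<Rightarrow> 'x) \<Rightarrow>
     nat \<Rightarrow> 'x set \<Rightarrow> ((nat \<Rightarrow> complex) \<Rightarrow> 'x \<Rightarrow> 'x) \<Rightarrow> bool" where
  "classifies_families k r cl d X act \<longleftrightarrow>
     (\<forall>p\<in>X.
        (\<exists>U. algebraic_family d k r U \<and> (\<forall>v\<in>cspace d. act v p = cl (U v))) \<and>
        (\<forall>m U. algebraic_family m k r U \<longrightarrow>
           (\<exists>h. (\<forall>l<d. polynomial_fun m (*) (\<lambda>t. h t l)) \<and>
                (\<forall>t\<in>cspace m. h t \<in> cspace d \<and> act (h t) p = cl (U t)))))"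

end

theory Submission
  imports Defs "Jordan_Normal_Form.Determinant"
begin

text \<open>
  In a basis adapted to the filtration an object is a block triangular matrix with diagonal blocks
  \<open>z\<^sup>\<mu>\<^sub>i A\<^sub>i\<close>, and two such matrices \<open>U\<close>, \<open>V\<close> are equivalent if and only if \<open>V F = \<sigma>\<^sub>q(F) U\<close> for a
  block unipotent \<open>F\<close>. The entry \<open>(i, j)\<close> of this equation reads
  \<open>V\<^sub>i\<^sub>j = z\<^sup>\<mu>\<^sub>j \<sigma>\<^sub>q(F\<^sub>i\<^sub>j) A\<^sub>j - z\<^sup>\<mu>\<^sub>i A\<^sub>i F\<^sub>i\<^sub>j +\<close> terms involving only \<open>U\<^sub>i\<^sub>j\<close> and blocks closer to the
  diagonal. Since \<open>\<bar>q\<bar> > 1\<close>, the linear operator on \<open>F\<^sub>i\<^sub>j\<close> on the right is injective on germs, and the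
  matrices of Laurent polynomials with exponents in \<open>[\<mu>\<^sub>i, \<mu>\<^sub>j)\<close> form a complement of its image: its
  coefficient recursion, solved towards lower exponents, involves division by ever larger powers of
  \<open>q\<close>. By induction on \<open>j - i\<close> every class contains exactly one matrix whose blocks \<open>V\<^sub>i\<^sub>j\<close> are of that
  form, and the coefficients of the \<open>V\<^sub>i\<^sub>j\<close> are the affine coordinates. All the equations solved are
  linear over \<open>\<^bold>C\<close> in the unknown block, with right-hand sides polynomial in the blocks already found, so
  the coordinates of a polynomial family are polynomial.
\<close>

section \<open>Coefficients of germs\<close>

text \<open>Over formal Laurent series the operator on one block is bijective: since \<mu>_i <
  \<mu>_j, its term in z^\<mu>_i has the lower order, and coefficients can be solved for towards
  higher exponents. Each such step multiplies by a growing power of q, so the formal solution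
  usually diverges. Convergence is thus the only obstruction. The opposite recursion divides by
  these powers. Iterated s times it gains about |q|^(-s(s-1)/2), which beats the geometric growth of
  every convergent coefficient sequence. It yields a convergent solution without pole once the
  right-hand side has order at least \<mu>_i; the finitely many lower exponents are cleared
  beforehand. Only the \<mu>_j - \<mu>_i exponents of the window escape, for each of the r_i r_j
  entries, which explains the dimension. The same decay shows that a vector of germs whose image
  lies in the window vanishes, and this contains both injectivity and the trivial intersection with
  the complement. Polynomial dependence does not come from a formula for the solution: corrections
  chosen once for single monomials are combined with constant coefficients, which \<sigma>_q
  fixes.\<close>

lift_definition germ_nth :: "germ \<Rightarrow> int \<Rightarrow> complex" is fls_nth .

lemma germ_eqI: "(\<And>n. germ_nth x n = germ_nth y n) \<Longrightarrow> x = y"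
  by transfer (rule fls_eqI)

lemma germ_nth_simps [simp]:
  "germ_nth 0 n = 0"
  "germ_nth (x + y) n = germ_nth x n + germ_nth y n"
  "germ_nth (x - y) n = germ_nth x n - germ_nth y n"
  "germ_nth (- x) n = - germ_nth x n"
  "germ_nth (germ_const a * x) n = a * germ_nth x n"
  by (transfer, simp)+

lemma germ_nth_sigma [simp]:
  "q \<noteq> 0 \<Longrightarrow> germ_nth (germ_sigma q x) n = q powi n * germ_nth x n"
  by transfer (simp add: fls_nth_fls_compose_fps_linear)

lemma germ_nth_const: "germ_nth (germ_const a) n = (if n = 0 then a else 0)"
  by transfer simp

lemma germ_nth_z_mult [simp]: "germ_nth (germ_z * x) n = germ_nth x (n - 1)"
  by transfer (simp add: fls_X_times_conv_shift)

lemma germ_z_nonzero [simp]: "germ_z \<noteq> 0"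
  by transfer simp

lemma germ_nth_z_pow_mult: "germ_nth (germ_z ^ m * x) n = germ_nth x (n - int m)"
  by (induction m arbitrary: n) (simp_all add: mult.assoc algebra_simps)

lemma germ_nth_z_powi_mult [simp]: "germ_nth (germ_z powi m * x) n = germ_nth x (n - m)"
proof (cases "m \<ge> 0")
  case True
  then show ?thesis using germ_nth_z_pow_mult[of "nat m"] by (simp add: power_int_def)
next
  case False
  define y where "y = germ_z powi m * x"
  \<comment> \<open>A negative power is moved to the other side, so that the rule for natural
    exponents applies to \<open>y\<close>.\<close>
  have "x = germ_z ^ nat (- m) * y"
    using False unfolding y_def power_int_def
    by (simp add: mult.assoc [symmetric] power_inverse [symmetric] flip: power_mult_distrib)
  then have "germ_nth x (n - m) = germ_nth (germ_z ^ nat (- m) * y) (n - m)"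
    by (rule arg_cong)
  also have "\<dots> = germ_nth y n"
    using False by (simp only: germ_nth_z_pow_mult) simp
  finally show ?thesis by (simp only: y_def)
qed

lemma germ_nth_sum [simp]: "germ_nth (sum f I) n = (\<Sum>i\<in>I. germ_nth (f i) n)"
  by (induction I rule: infinite_finite_induct) simp_all

lemma germ_const_simps [simp]: "germ_const 0 = 0" "germ_const 1 = 1"
  "germ_const (a + b) = germ_const a + germ_const b"
  "germ_const (a * b) = germ_const a * germ_const b"
  by (transfer, simp add: fls_plus_const)+

lemma germ_sigma_simps [simp]:
  assumes "q \<noteq> 0"
  shows "germ_sigma q 0 = 0"
    and "germ_sigma q 1 = 1"
    and "germ_sigma q (x + y) = germ_sigma q x + germ_sigma q y"
    and "germ_sigma q (x - y) = germ_sigma q x - germ_sigma q y"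
    and "germ_sigma q (- x) = - germ_sigma q x"
  using assms germ_nth_const[of 1]
  by (auto intro!: germ_eqI simp: algebra_simps simp flip: germ_const_simps(2))

lemma germ_sigma_mult: "q \<noteq> 0 \<Longrightarrow> germ_sigma q (x * y) = germ_sigma q x * germ_sigma q y"
  by transfer (simp add: fls_compose_fps_mult)

lemma germ_sigma_const [simp]: "q \<noteq> 0 \<Longrightarrow> germ_sigma q (germ_const a) = germ_const a"
  by (rule germ_eqI) (simp add: germ_nth_const)

lemma germ_const_sum: "germ_const (sum f I) = (\<Sum>i\<in>I. germ_const (f i))"
  by (induction I rule: infinite_finite_induct) simp_all

lemma germ_sigma_sum: "q \<noteq> 0 \<Longrightarrow> germ_sigma q (sum f I) = (\<Sum>i\<in>I. germ_sigma q (f i))"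
  by (induction I rule: infinite_finite_induct) simp_all

lemma germ_sigma_inverse: "q \<noteq> 0 \<Longrightarrow> germ_sigma q (germ_sigma (inverse q) x) = x"
  by (rule germ_eqI) (simp add: power_int_inverse)

lemma germ_sigma_inj: "q \<noteq> 0 \<Longrightarrow> germ_sigma q x = germ_sigma q y \<longleftrightarrow> x = y"
  using germ_sigma_inverse[of "inverse q"] by (metis inverse_inverse_eq inverse_nonzero_iff_nonzero)

lemma germ_nth_pole: obtains N :: nat where "\<And>n. n < - int N \<Longrightarrow> germ_nth x n = 0"
proof -
  have "\<exists>N::nat. \<forall>n. n < - int N \<longrightarrow> germ_nth x n = 0"
  proof transfer
    fix f :: "complex fls"
    show "\<exists>N. \<forall>n. n < - int N \<longrightarrow> fls_nth f n = 0"
      by (rule exI[of _ "nat (- fls_subdegree f)"]) auto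
  qed
  then show ?thesis using that by blast
qed

text \<open>For s strictly inside the disc of convergence the terms of the series at s tend to 0,
  hence are bounded; \<open>R\<close> is 1/s, raised to at least 1. The finitely many negative
  exponents are excluded and treated by \<open>germ_nth_pole\<close>.\<close>

lemma germ_nth_bound:
  obtains C R where "C \<ge> 0" "R \<ge> (1::real)" "\<And>n. n \<ge> 0 \<Longrightarrow> norm (germ_nth x n) \<le> C * R ^ nat n"
proof -
  have "\<exists>C\<ge>0. \<exists>R\<ge>1. \<forall>n::nat. norm (germ_nth x (int n)) \<le> C * R ^ n"
  proof transfer
    fix f :: "complex fls" assume f: "fls_conv_radius f > 0"
    define g where "g n = fls_nth f (int n)" for n
    have "conv_radius g > 0"
      using f by (simp add: fls_conv_radius_def g_def fps_conv_radius_def)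
    then obtain s :: real where s: "0 < s" "ereal s < conv_radius g"
      using ereal_dense2[of 0 "conv_radius g"] by auto
    then have "summable (\<lambda>n. g n * complex_of_real s ^ n)"
      by (intro summable_in_conv_radius) simp
    then have "Bseq (\<lambda>n. g n * complex_of_real s ^ n)"
      by (intro convergent_imp_Bseq convergentI[of _ 0] summable_LIMSEQ_zero)
    then obtain C where C: "C > 0" "\<And>n. norm (g n * complex_of_real s ^ n) \<le> C"
      unfolding Bseq_def by blast
    define R where "R = max 1 (1 / s)"
    have "norm (g n) \<le> C * R ^ n" for n
    proof -
      have "norm (g n) * s ^ n \<le> C" using C(2)[of n] s by (simp add: norm_mult norm_power)
      then have "norm (g n) \<le> C * (1 / s) ^ n" using s by (simp add: power_divide pos_le_divide_eq)
      also have "\<dots> \<le> C * R ^ n" using C(1) s by (intro mult_left_mono power_mono) (simp_all add: R_def)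
      finally show ?thesis .
    qed
    then show "\<exists>C\<ge>0. \<exists>R\<ge>1. \<forall>n. norm (fls_nth f (int n)) \<le> C * R ^ n"
      using C(1) unfolding g_def by (intro exI[of _ C] conjI exI[of _ R] allI) (simp_all add: R_def)
  qed
  then obtain C R where *: "C \<ge> 0" "R \<ge> 1" "\<And>n. norm (germ_nth x (int n)) \<le> C * R ^ n"
    by blast
  show ?thesis
  proof (rule that[OF *(1,2)])
    fix n :: int assume "n \<ge> 0"
    then show "norm (germ_nth x n) \<le> C * R ^ nat n" using *(3)[of "nat n"] by simp
  qed
qed

lemma germ_nth_of_fps:
  "fps_conv_radius F > 0 \<Longrightarrow>
     germ_nth (germ_of_fps F) n = (if n < 0 then 0 else fps_nth F (nat n))"
  by transfer simp

text \<open>Converse of \<open>germ_nth_bound\<close>: comparison with the geometric series of ratio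
  \<open>R * r\<close> gives radius at least 1/\<open>R\<close>. This is how a recursively
  constructed coefficient sequence becomes a germ.\<close>

lemma germ_exists:
  assumes "\<And>n. norm (f n) \<le> C * R ^ n" "R > (0::real)"
  shows "\<exists>x. \<forall>n. germ_nth x n = (if n < 0 then 0 else f (nat n))"
proof -
  have "conv_radius f \<ge> inverse R"
  proof (rule conv_radius_geI_ex')
    fix r :: real assume r: "0 < r" "ereal r < ereal (inverse R)"
    then have "R * r < 1" using assms(2) by (simp add: field_simps)
    then have "summable (\<lambda>n. C * (R * r) ^ n)"
      using r assms(2) by (intro summable_mult summable_geometric) auto
    then show "summable (\<lambda>n. f n * complex_of_real r ^ n)"
    proof (rule summable_comparison_test'[where N = 0])
      fix n show "norm (f n * complex_of_real r ^ n) \<le> C * (R * r) ^ n"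
        using mult_right_mono[OF assms(1)[of n], of "r ^ n"] r
        by (simp add: norm_mult norm_power power_mult_distrib mult.assoc)
    qed
  qed
  moreover have "0 < ereal (inverse R)" using assms(2) by simp
  ultimately have "0 < conv_radius f" by (rule less_le_trans[rotated])
  then have "fps_conv_radius (Abs_fps f) > 0" by (simp add: fps_conv_radius_def)
  then have "germ_nth (germ_of_fps (Abs_fps f)) n = (if n < 0 then 0 else f (nat n))" for n
    by (simp add: germ_nth_of_fps)
  then show ?thesis by blast
qed


section \<open>The linear q-difference operator on one block\<close>

text \<open>Matrices are functions on an arbitrary index set here, because the operator of one block
  acts on vectors indexed by pairs. Both products are required, which makes the relation
  symmetric.\<close>

definition inverse_on :: "'a set \<Rightarrow> ('a \<Rightarrow> 'a \<Rightarrow> 'b::field) \<Rightarrow> ('a \<Rightarrow> 'a \<Rightarrow> 'b) \<Rightarrow> bool" where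
  "inverse_on I S W \<longleftrightarrow> (\<forall>c\<in>I. \<forall>e\<in>I.
     (\<Sum>d\<in>I. S c d * W d e) = of_bool (c = e) \<and> (\<Sum>d\<in>I. W c d * S d e) = of_bool (c = e))"

lemma inverse_on_sym: "inverse_on I S W \<Longrightarrow> inverse_on I W S"
  by (simp add: inverse_on_def)

lemma inverse_on_apply:
  assumes "inverse_on I S W" "finite I" "c \<in> I"
  shows "(\<Sum>d\<in>I. S c d * (\<Sum>e\<in>I. W d e * y e)) = y c"
proof -
  have "(\<Sum>d\<in>I. S c d * (\<Sum>e\<in>I. W d e * y e)) = (\<Sum>e\<in>I. (\<Sum>d\<in>I. S c d * W d e) * y e)"
    by (simp add: sum_distrib_left sum_distrib_right mult.assoc) (rule sum.swap)
  also have "\<dots> = (\<Sum>e\<in>I. of_bool (c = e) * y e)"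
    using assms by (intro sum.cong) (auto simp: inverse_on_def)
  also have "\<dots> = y c" using assms by simp
  finally show ?thesis .
qed

text \<open>
  Each application of the recursion gains a further power of \<open>q\<close> in the denominator. With \<open>y\<close> constant in
  its first argument the bound forces \<open>y = 0\<close>; for the iterated solution it gives convergence.
\<close>

lemma q_decay:
  fixes y :: "nat \<Rightarrow> nat \<Rightarrow> 'a \<Rightarrow> complex"
  assumes q: "norm q > 1" and \<delta>: "\<delta> \<ge> 1" and R: "R \<ge> 1" and B: "B \<ge> 0" and M: "M \<ge> 0"
    and y0: "\<And>n c. c \<in> I \<Longrightarrow> norm (y 0 n c) \<le> B * R ^ n"
    and ys: "\<And>k n c. c \<in> I \<Longrightarrow>
       norm (q ^ n * y (Suc k) n c) \<le> (\<Sum>d\<in>I. norm (T c d) * norm (y k (n + \<delta>) d))"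
    and T: "\<And>c. c \<in> I \<Longrightarrow> (\<Sum>d\<in>I. norm (T c d)) \<le> M"
    and c: "c \<in> I"
  shows "norm (y k n c) \<le> B * R ^ n * (\<Prod>j<k. M * R ^ \<delta> / norm q ^ j)"
proof -
  \<comment> \<open>The exponent \<open>n + j\<close> in place of \<open>j\<close> is what the
    induction needs: the recursion at \<open>n\<close> divides by the power \<open>q ^ n\<close> and
    then moves on to \<open>n + \<delta>\<close>. The summand \<open>n\<close> is dropped only at
    the end, where this enlarges the bound.\<close>
  have "norm (y k n c) \<le> B * R ^ n * (\<Prod>j<k. M * R ^ \<delta> / norm q ^ (n + j))" if "c \<in> I" for c
    using that
  proof (induction k arbitrary: n c)
    case 0
    then show ?case using y0 by simp
  next
    case (Suc k)
    define D where "D = B * R ^ (n + \<delta>) * (\<Prod>j<k. M * R ^ \<delta> / norm q ^ (n + \<delta> + j))"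
    have Q: "norm q ^ n > 0" using q by (intro zero_less_power) linarith
    have D: "D \<ge> 0" unfolding D_def using B R M by (intro mult_nonneg_nonneg prod_nonneg) auto
    have "norm q ^ n * norm (y (Suc k) n c) \<le> (\<Sum>d\<in>I. norm (T c d) * norm (y k (n + \<delta>) d))"
      using ys[OF Suc.prems, of n k] by (simp add: norm_mult norm_power)
    also have "\<dots> \<le> (\<Sum>d\<in>I. norm (T c d) * D)"
      unfolding D_def by (intro sum_mono mult_left_mono Suc.IH) auto
    also have "\<dots> \<le> M * D"
      using T[OF Suc.prems] D by (simp add: mult_right_mono flip: sum_distrib_right)
    \<comment> \<open>Since \<delta> \<ge> 1, the exponent \<open>n + \<delta> + j\<close> is at
      least \<open>n + Suc j\<close>. The remaining \<open>M\<close>, the surplus power of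
      \<open>R\<close> and the division by \<open>norm q ^ n\<close> form the missing factor for
      \<open>j = 0\<close>.\<close>
    also have "\<dots> \<le> M * (B * R ^ (n + \<delta>) * (\<Prod>j<k. M * R ^ \<delta> / norm q ^ (n + Suc j)))"
      unfolding D_def using B R M q \<delta>
      by (intro mult_left_mono prod_mono conjI divide_left_mono power_increasing mult_nonneg_nonneg)
         (auto intro!: mult_pos_pos zero_less_power)
    finally have "norm (y (Suc k) n c) \<le>
        M * (B * R ^ (n + \<delta>) * (\<Prod>j<k. M * R ^ \<delta> / norm q ^ (n + Suc j))) / norm q ^ n"
      using pos_le_divide_eq[OF Q] by (simp only: mult.commute[of "norm (y (Suc k) n c)"])
    also have "\<dots> = B * R ^ n * (\<Prod>j<Suc k. M * R ^ \<delta> / norm q ^ (n + j))"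
      by (simp add: prod.lessThan_Suc_shift power_add mult_ac del: prod.lessThan_Suc)
    finally show ?case .
  qed
  from this[OF c] have "norm (y k n c) \<le> B * R ^ n * (\<Prod>j<k. M * R ^ \<delta> / norm q ^ (n + j))" .
  also have "\<dots> \<le> B * R ^ n * (\<Prod>j<k. M * R ^ \<delta> / norm q ^ j)"
    using B R M q
    by (intro mult_left_mono prod_mono conjI divide_left_mono power_increasing)
       (auto intro!: mult_pos_pos zero_less_power)
  finally show ?thesis .
qed

text \<open>The term of index k is b^k Q^(-k(k-1)/2), and the quotient of consecutive terms,
  \<open>b / Q ^ k\<close>, tends to 0.\<close>

lemma summable_q_product:
  fixes b Q :: real
  assumes "Q > 1" "b \<ge> 0"
  shows "summable (\<lambda>k. \<Prod>j<k. b / Q ^ j)"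
proof -
  have "norm (inverse Q) < 1" using assms(1) by (simp add: inverse_less_1_iff)
  then have "(\<lambda>k. inverse Q ^ k) \<longlonglongrightarrow> 0" by (rule LIMSEQ_power_zero)
  then have "(\<lambda>k. b * inverse Q ^ k) \<longlonglongrightarrow> 0" by (rule tendsto_mult_right_zero)
  then have "eventually (\<lambda>k. b * inverse Q ^ k < 1/2) sequentially"
    by (rule order_tendstoD(2)) simp
  then obtain N where "\<forall>k\<ge>N. b * inverse Q ^ k < 1/2"
    unfolding eventually_sequentially ..
  then have N: "b / Q ^ k < 1/2" if "k \<ge> N" for k
    using that unfolding divide_inverse power_inverse by blast
  show ?thesis
  proof (rule summable_ratio_test)
    show "(1/2 :: real) < 1" by simp
    fix k assume k: "N \<le> k"
    define p where "p = (\<Prod>j<k. b / Q ^ j)"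
    have p: "p \<ge> 0" unfolding p_def using assms by (intro prod_nonneg) simp
    have nn: "b / Q ^ k \<ge> 0" using assms by simp
    have "p * (b / Q ^ k) \<le> p * (1/2)"
      using N[OF k] p by (intro mult_left_mono) simp_all
    moreover have "0 \<le> p * (b / Q ^ k)" using p nn by (rule mult_nonneg_nonneg)
    ultimately show "norm (\<Prod>j<Suc k. b / Q ^ j) \<le> 1/2 * norm (\<Prod>j<k. b / Q ^ j)"
      using p unfolding prod.lessThan_Suc p_def[symmetric] real_norm_def by linarith
  qed
qed

text \<open>Neumann series: \<open>y 0\<close> solves the equation without its sum over
  \<open>T\<close>, each \<open>y (Suc k)\<close> corrects the error left by \<open>y k\<close>, and
  \<open>q_decay\<close> makes the series converge. The solution keeps the growth rate
  \<open>R\<close> of the right-hand side, only the constant changes, so it defines germs.\<close>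

lemma q_recurrence_solution:
  fixes T :: "'a \<Rightarrow> 'a \<Rightarrow> complex" and g :: "nat \<Rightarrow> 'a \<Rightarrow> complex"
  assumes q: "norm q > 1" and \<delta>: "\<delta> \<ge> 1" and I: "finite I" and R: "R \<ge> 1" and B: "B \<ge> 0"
    and g: "\<And>n c. c \<in> I \<Longrightarrow> norm (g n c) \<le> B * R ^ n"
  shows "\<exists>x B'. \<forall>n. \<forall>c\<in>I. norm (x n c) \<le> B' * R ^ n \<and>
    q ^ n * x n c = g n c + (\<Sum>d\<in>I. T c d * x (n + \<delta>) d)"
proof -
  define M where "M = (\<Sum>c\<in>I. \<Sum>d\<in>I. norm (T c d))"
  have M0: "M \<ge> 0" by (auto simp: M_def intro!: sum_nonneg)
  have M: "(\<Sum>d\<in>I. norm (T c d)) \<le> M" if "c \<in> I" for c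
    unfolding M_def using I that
    by (intro member_le_sum[of c I "\<lambda>c. \<Sum>d\<in>I. norm (T c d)"]) (auto intro!: sum_nonneg)
  define y where "y = rec_nat (\<lambda>n c. g n c / q ^ n) (\<lambda>k Y n c. (\<Sum>d\<in>I. T c d * Y (n + \<delta>) d) / q ^ n)"
  have y: "y 0 n c = g n c / q ^ n" "y (Suc k) n c = (\<Sum>d\<in>I. T c d * y k (n + \<delta>) d) / q ^ n"
    for n c k by (simp_all add: y_def)
  define p where "p k = (\<Prod>j<k. M * R ^ \<delta> / norm q ^ j)" for k
  have q_nonzero: "q \<noteq> 0" using q by auto
  have bound: "norm (y k n c) \<le> B * R ^ n * p k" if "c \<in> I" for k n c
    unfolding p_def
  proof (rule q_decay[OF q \<delta> R B M0, where I = I and T = T])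
    fix n c assume c: "c \<in> I"
    have Q: "1 \<le> norm q ^ n" using q by (intro one_le_power) simp
    then have "norm (g n c) * 1 \<le> norm (g n c) * norm q ^ n" by (intro mult_left_mono) auto
    then have "norm (g n c) / norm q ^ n \<le> norm (g n c)"
      using Q by (subst pos_divide_le_eq) auto
    then show "norm (y 0 n c) \<le> B * R ^ n"
      using g[OF c, of n] by (simp add: y norm_divide norm_power)
  next
    fix k n c
    show "norm (q ^ n * y (Suc k) n c) \<le> (\<Sum>d\<in>I. norm (T c d) * norm (y k (n + \<delta>) d))"
      using q_nonzero by (simp add: y) (rule order.trans[OF norm_sum], simp add: norm_mult)
  qed (use M that in auto)
  have sp: "summable p"
    unfolding p_def using q M0 R by (intro summable_q_product) auto
  have sy: "summable (\<lambda>k. y k n c)" if "c \<in> I" for n c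
    by (rule summable_comparison_test'[where N = 0, OF summable_mult[OF sp]]) (use bound that in auto)
  define x where "x n c = (\<Sum>k. y k n c)" for n c
  show ?thesis
  proof (intro exI[of _ x] exI[of _ "B * suminf p"] allI ballI conjI)
    fix n c assume c: "c \<in> I"
    have "norm (x n c) \<le> (\<Sum>k. B * R ^ n * p k)"
      unfolding x_def by (rule norm_suminf_le[OF bound[OF c] summable_mult[OF sp]])
    also have "\<dots> = B * R ^ n * suminf p"
      by (rule suminf_mult[OF sp])
    finally show "norm (x n c) \<le> B * suminf p * R ^ n"
      by (simp add: mult_ac)
    \<comment> \<open>Applying \<open>T\<close> to the series at \<open>n + \<delta>\<close> shifts
      it by one index, so only its head, the right-hand side \<open>g n c\<close>, is
      missing.\<close>
    have "(\<Sum>d\<in>I. T c d * x (n + \<delta>) d) = (\<Sum>d\<in>I. \<Sum>k. T c d * y k (n + \<delta>) d)"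
      unfolding x_def by (intro sum.cong refl) (simp add: suminf_mult sy)
    also have "\<dots> = (\<Sum>k. \<Sum>d\<in>I. T c d * y k (n + \<delta>) d)"
      by (rule suminf_sum[symmetric]) (simp add: sy summable_mult)
    also have "\<dots> = (\<Sum>k. q ^ n * y (Suc k) n c)"
      using q_nonzero by (simp add: y)
    also have "\<dots> = q ^ n * (\<Sum>k. y (Suc k) n c)"
      using sy[OF c, of n] by (intro suminf_mult) (subst summable_Suc_iff)
    also have "(\<Sum>k. y (Suc k) n c) = x n c - y 0 n c"
      unfolding x_def by (rule suminf_split_head[OF sy[OF c]])
    finally show "q ^ n * x n c = g n c + (\<Sum>d\<in>I. T c d * x (n + \<delta>) d)"
      using q_nonzero by (simp add: y algebra_simps)
  qed
qed

lemma germ_nth_uniform_bound: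
  assumes "finite I"
  obtains C R where "C \<ge> 0" "R \<ge> (1::real)"
    "\<And>c n. c \<in> I \<Longrightarrow> n \<ge> 0 \<Longrightarrow> norm (germ_nth (F c) n) \<le> C * R ^ nat n"
proof -
  have "\<exists>C\<ge>0. \<exists>R\<ge>1. \<forall>c\<in>I. \<forall>n\<ge>0. norm (germ_nth (F c) n) \<le> C * R ^ nat n"
    using assms
  proof (induction I rule: finite_induct)
    case empty
    then show ?case by (intro exI[of _ 0] conjI exI[of _ 1]) auto
  next
    case (insert a I)
    obtain C R where 1: "C \<ge> 0" "R \<ge> 1" "\<And>c n. c \<in> I \<Longrightarrow> n \<ge> 0 \<Longrightarrow> norm (germ_nth (F c) n) \<le> C * R ^ nat n"
      using insert.IH by blast
    obtain C' R' where 2: "C' \<ge> 0" "R' \<ge> 1" "\<And>n. n \<ge> 0 \<Longrightarrow> norm (germ_nth (F a) n) \<le> C' * R' ^ nat n"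
      using germ_nth_bound[of "F a"] by blast
    have "norm (germ_nth (F c) n) \<le> max C C' * max R R' ^ nat n" if "c \<in> insert a I" "n \<ge> 0" for c n
    proof -
      have "C * R ^ nat n \<le> max C C' * max R R' ^ nat n" "C' * R' ^ nat n \<le> max C C' * max R R' ^ nat n"
        using 1(1,2) 2(1,2) by (intro mult_mono power_mono; simp)+
      then show ?thesis using 1(3)[of c n] 2(3)[of n] that by fastforce
    qed
    then show ?case using 1(1,2)
      by (intro exI[of _ "max C C'"] conjI exI[of _ "max R R'"]) auto
  qed
  then show ?thesis using that by blast
qed

lemma germ_nth_uniform_pole:
  assumes "finite I"
  obtains N :: nat where "\<And>c n. c \<in> I \<Longrightarrow> n < - int N \<Longrightarrow> germ_nth (F c) n = 0"
proof -
  have "\<exists>N::nat. \<forall>c\<in>I. \<forall>n. n < - int N \<longrightarrow> germ_nth (F c) n = 0"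
    using assms
  proof (induction I rule: finite_induct)
    case (insert a I)
    obtain N where N: "\<forall>c\<in>I. \<forall>n. n < - int N \<longrightarrow> germ_nth (F c) n = 0"
      using insert.IH by blast
    obtain N' where N': "\<And>n. n < - int N' \<Longrightarrow> germ_nth (F a) n = 0"
      using germ_nth_pole[of "F a"] by blast
    show ?case using N N' by (intro exI[of _ "max N N'"]) auto
  qed simp
  then show ?thesis using that by blast
qed

section \<open>The image of the operator and its complement\<close>

definition germ_window :: "int \<Rightarrow> int \<Rightarrow> germ \<Rightarrow> bool" where
  "germ_window m m' x \<longleftrightarrow> (\<forall>n. n < m \<or> m' \<le> n \<longrightarrow> germ_nth x n = 0)"

text \<open>
  The operator \<open>F \<mapsto> z\<^sup>m\<^sup>' S' \<sigma>\<^sub>q(F) - z\<^sup>m S F\<close> on vectors indexed by \<open>I\<close>; a block of a matrix is such a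
  vector, with pairs as indices.
\<close>

definition qdiff_op :: "complex \<Rightarrow> int \<Rightarrow> int \<Rightarrow> ('a \<Rightarrow> 'a \<Rightarrow> complex) \<Rightarrow> ('a \<Rightarrow> 'a \<Rightarrow> complex) \<Rightarrow>
    'a set \<Rightarrow> ('a \<Rightarrow> germ) \<Rightarrow> 'a \<Rightarrow> germ" where
  "qdiff_op q m m' S S' I F c =
     germ_z powi m' * (\<Sum>d\<in>I. germ_const (S' c d) * germ_sigma q (F d)) -
     germ_z powi m * (\<Sum>d\<in>I. germ_const (S c d) * F d)"

lemma germ_nth_qdiff_op: "q \<noteq> 0 \<Longrightarrow> germ_nth (qdiff_op q m m' S S' I F c) n =
    q powi (n - m') * (\<Sum>d\<in>I. S' c d * germ_nth (F d) (n - m')) -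
    (\<Sum>d\<in>I. S c d * germ_nth (F d) (n - m))"
  by (simp add: qdiff_op_def sum_distrib_left mult.left_commute)

lemma qdiff_op_add: "q \<noteq> 0 \<Longrightarrow>
    qdiff_op q m m' S S' I (\<lambda>d. F d + F' d) c = qdiff_op q m m' S S' I F c + qdiff_op q m m' S S' I F' c"
  by (simp add: qdiff_op_def distrib_left sum.distrib)

context
  fixes q :: complex and m m' :: int and S S' W W' :: "'a \<Rightarrow> 'a \<Rightarrow> complex" and I :: "'a set"
  assumes q: "norm q > 1" and m: "m < m'" and I: "finite I"
    and W: "inverse_on I S W" and W': "inverse_on I S' W'"
begin

private lemma q_nonzero: "q \<noteq> 0"
  using q by auto

text \<open>The matrix S'^(-1) S. Multiplying a coefficient equation by \<open>W'\<close> isolates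
  the coefficient on which \<sigma>_q acts and gives the recursion treated in \<open>q_decay\<close>
  and \<open>q_recurrence_solution\<close>.\<close>

private abbreviation "T \<equiv> \<lambda>c e. \<Sum>d\<in>I. W' c d * S d e"

private lemma T_apply:
  "(\<Sum>d\<in>I. W' c d * (\<Sum>e\<in>I. S d e * x e)) = (\<Sum>e\<in>I. T c e * x e)"
  by (simp add: sum_distrib_left sum_distrib_right mult.assoc) (rule sum.swap)

text \<open>The window hypothesis gives one coefficient equation for each exponent outside [m, m').
  Those below m kill the negative part of F, starting from the pole; those from m' on express each
  coefficient of index n \<ge> 0 through one further up, and iteration forces it to be 0 by
  decay.\<close>

lemma qdiff_op_window_unique:
  assumes V: "\<And>c. c \<in> I \<Longrightarrow> germ_window m m' (qdiff_op q m m' S S' I F c)" and c: "c \<in> I"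
  shows "F c = 0"
proof -
  have eq: "q powi (n - m') * (\<Sum>d\<in>I. S' c d * germ_nth (F d) (n - m')) =
      (\<Sum>d\<in>I. S c d * germ_nth (F d) (n - m))" if "n < m \<or> m' \<le> n" "c \<in> I" for n c
    using V[OF that(2)] that(1) unfolding germ_window_def germ_nth_qdiff_op[OF q_nonzero] by (meson eq_iff_diff_eq_0)
  obtain N :: nat where N: "\<And>d n. d \<in> I \<Longrightarrow> n < - int N \<Longrightarrow> germ_nth (F d) n = 0"
    using germ_nth_uniform_pole[OF I, of F] by blast
  \<comment> \<open>The equation at exponent n + m, for n < 0, expresses \<open>S\<close> applied to
    the coefficient of index n through the coefficient of index n + m - m', which is smaller. The
    shift by \<open>N\<close> makes this an induction over naturals.\<close>
  have neg: "germ_nth (F d) (int k - int N) = 0" if "d \<in> I" "int k < int N" for d k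
    using that
  proof (induction k arbitrary: d rule: less_induct)
    case (less k)
    define n where "n = int k - int N"
    have z: "germ_nth (F e) (n + m - m') = 0" if e: "e \<in> I" for e
    proof (cases "int k + m - m' < 0")
      case True
      then show ?thesis using N[OF e] by (simp add: n_def)
    next
      case False
      then show ?thesis
        using less.IH[of "nat (int k + m - m')" e] less.prems m e by (simp add: n_def algebra_simps)
    qed
    have "(\<Sum>f\<in>I. S e f * germ_nth (F f) n) = 0" if e: "e \<in> I" for e
      using eq[of "n + m" e] less.prems e z by (simp add: n_def)
    then show ?case
      using inverse_on_apply[OF inverse_on_sym[OF W] I less.prems(1), of "\<lambda>f. germ_nth (F f) n"]
      by (simp add: n_def)
  qed
  define x where "x n c = germ_nth (F c) (int n)" for n c
  define \<delta> where "\<delta> = nat (m' - m)"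
  have x: "q ^ n * x n c = (\<Sum>e\<in>I. T c e * x (n + \<delta>) e)" if c: "c \<in> I" for n c
  proof -
    have "q ^ n * (\<Sum>d\<in>I. S' e d * x n d) = (\<Sum>d\<in>I. S e d * x (n + \<delta>) d)" if "e \<in> I" for e
      using eq[of "int n + m'" e] that m by (simp add: x_def \<delta>_def algebra_simps)
    then have "(\<Sum>e\<in>I. W' c e * (q ^ n * (\<Sum>d\<in>I. S' e d * x n d))) = (\<Sum>e\<in>I. T c e * x (n + \<delta>) e)"
      unfolding T_apply[symmetric] by (intro sum.cong) auto
    also have "(\<Sum>e\<in>I. W' c e * (q ^ n * (\<Sum>d\<in>I. S' e d * x n d))) =
        q ^ n * (\<Sum>e\<in>I. W' c e * (\<Sum>d\<in>I. S' e d * x n d))"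
      by (simp add: sum_distrib_left mult_ac)
    also have "(\<Sum>e\<in>I. W' c e * (\<Sum>d\<in>I. S' e d * x n d)) = x n c"
      by (rule inverse_on_apply[OF inverse_on_sym[OF W'] I c])
    finally show ?thesis .
  qed
  obtain B R where B: "B \<ge> 0" "R \<ge> (1::real)"
    "\<And>c n. c \<in> I \<Longrightarrow> n \<ge> 0 \<Longrightarrow> norm (germ_nth (F c) n) \<le> B * R ^ nat n"
    using germ_nth_uniform_bound[OF I, of F] by blast
  define M where "M = (\<Sum>c\<in>I. \<Sum>d\<in>I. norm (T c d))"
  have M0: "M \<ge> 0" by (auto simp: M_def intro!: sum_nonneg)
  have bound: "norm (x n c) \<le> B * R ^ n * (\<Prod>j<k. M * R ^ \<delta> / norm q ^ j)" if "c \<in> I" for n c k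
  proof (rule q_decay[where y = "\<lambda>_. x" and T = T and I = I, OF q _ B(2,1) M0])
    show "\<delta> \<ge> 1" using m by (simp add: \<delta>_def)
    show "norm (q ^ n * x n c) \<le> (\<Sum>d\<in>I. norm (T c d) * norm (x (n + \<delta>) d))" if "c \<in> I" for n c
      unfolding x[OF that] by (rule order.trans[OF norm_sum]) (simp add: norm_mult)
    show "(\<Sum>d\<in>I. norm (T c d)) \<le> M" if "c \<in> I" for c
      unfolding M_def using I that
      by (intro member_le_sum[of c I "\<lambda>c. \<Sum>d\<in>I. norm (T c d)"]) (auto intro!: sum_nonneg)
    show "norm (x n c) \<le> B * R ^ n" if "c \<in> I" for n c
      using B(3)[OF that, of "int n"] by (simp add: x_def)
  qed (rule that)
  have "x n c = 0" for n
  proof -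
    \<comment> \<open>The bound holds for every \<open>k\<close>, and its right-hand side tends to
      0, being a multiple of the terms of a convergent series.\<close>
    have "(\<lambda>k. B * R ^ n * (\<Prod>j<k. M * R ^ \<delta> / norm q ^ j)) \<longlonglongrightarrow> B * R ^ n * 0"
      using q M0 B by (intro tendsto_mult tendsto_const summable_LIMSEQ_zero summable_q_product) auto
    then have "norm (x n c) \<le> B * R ^ n * 0"
      by (rule LIMSEQ_le_const) (use bound[OF c] in auto)
    then show ?thesis by simp
  qed
  then have pos: "germ_nth (F c) n = 0" if "n \<ge> 0" for n
    using that by (metis x_def int_nat_eq)
  show "F c = 0"
  proof (rule germ_eqI)
    fix n
    show "germ_nth (F c) n = germ_nth 0 n"
      using pos[of n] N[OF c, of n] neg[OF c, of "nat (n + int N)"]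
      by (cases "n \<ge> 0"; cases "n < - int N") auto
  qed
qed

text \<open>The two ends of the exponent range need different arguments. Exponents below m are
  finitely many and are removed one at a time by monomials; exponents from m' on are removed all at
  once by a convergent power series that does not disturb those below m.\<close>

lemma qdiff_op_window_exists:
  "\<exists>F. \<forall>c\<in>I. germ_window m m' (G c + qdiff_op q m m' S S' I F c)"
proof -
  define P where "P G \<longleftrightarrow> (\<exists>F. \<forall>c\<in>I. germ_window m m' (G c + qdiff_op q m m' S S' I F c))"
    for G :: "'a \<Rightarrow> germ"
  have base: "P G" if G: "\<And>c n. c \<in> I \<Longrightarrow> n < m \<Longrightarrow> germ_nth (G c) n = 0" for G
  proof -
    \<comment> \<open>This is -S'^(-1) z^(-m') G; the sign occurs because the image of F has to
      cancel G at the exponents from m' on.\<close>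
    define g where "g c = (\<Sum>d\<in>I. germ_const (- W' c d) * (germ_z powi (- m') * G d))" for c
    have g: "germ_nth (g c) n = - (\<Sum>d\<in>I. W' c d * germ_nth (G d) (n + m'))" for c n
      by (simp add: g_def sum_negf)
    obtain B R where B: "B \<ge> 0" "R \<ge> (1::real)"
      "\<And>c n. c \<in> I \<Longrightarrow> n \<ge> 0 \<Longrightarrow> norm (germ_nth (g c) n) \<le> B * R ^ nat n"
      using germ_nth_uniform_bound[OF I, of g] by blast
    define \<delta> where "\<delta> = nat (m' - m)"
    have B3: "norm (germ_nth (g c) (int n)) \<le> B * R ^ n" if "c \<in> I" for c n
      using B(3)[OF that, of "int n"] by simp
    have \<delta>1: "\<delta> \<ge> 1" using m by (simp add: \<delta>_def)
    have "\<exists>x B'. \<forall>n. \<forall>c\<in>I. norm (x n c) \<le> B' * R ^ n \<and>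
        q ^ n * x n c = germ_nth (g c) (int n) + (\<Sum>d\<in>I. T c d * x (n + \<delta>) d)"
      by (rule q_recurrence_solution[OF q \<delta>1 I B(2,1)]) (rule B3)
    then obtain x B' where "\<forall>n. \<forall>c\<in>I. norm (x n c) \<le> B' * R ^ n \<and>
        q ^ n * x n c = germ_nth (g c) (int n) + (\<Sum>d\<in>I. T c d * x (n + \<delta>) d)"
      by (elim exE)
    then have x: "\<And>n c. c \<in> I \<Longrightarrow> norm (x n c) \<le> B' * R ^ n"
      "\<And>n c. c \<in> I \<Longrightarrow> q ^ n * x n c = germ_nth (g c) (int n) + (\<Sum>d\<in>I. T c d * x (n + \<delta>) d)"
      by simp_all
    have R0: "R > 0" using B(2) by simp
    have "\<forall>c\<in>I. \<exists>f. \<forall>n. germ_nth f n = (if n < 0 then 0 else x (nat n) c)"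
      by (intro ballI germ_exists[OF x(1) R0])
    then obtain F where "\<forall>c\<in>I. \<forall>n. germ_nth (F c) n = (if n < 0 then 0 else x (nat n) c)"
      by (rule bchoice[THEN exE])
    then have F: "germ_nth (F c) n = (if n < 0 then 0 else x (nat n) c)" if "c \<in> I" for c n
      using that by simp
    have "germ_window m m' (G c + qdiff_op q m m' S S' I F c)" if c: "c \<in> I" for c
      unfolding germ_window_def
    proof (intro allI impI)
      fix n assume "n < m \<or> m' \<le> n"
      then show "germ_nth (G c + qdiff_op q m m' S S' I F c) n = 0"
      proof
        \<comment> \<open>F has no negative coefficients and m < m', so neither term of the operator
          reaches an exponent below m.\<close>
        assume "n < m"
        then show ?thesis using G[OF c] m by (simp add: germ_nth_qdiff_op[OF q_nonzero] F)
      next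
        assume n: "m' \<le> n"
        define k where "k = nat (n - m')"
        have "(\<Sum>d\<in>I. S' c d * (q ^ k * x k d)) =
            (\<Sum>d\<in>I. S' c d * (\<Sum>e\<in>I. W' d e * ((\<Sum>f\<in>I. S e f * x (k + \<delta>) f) - germ_nth (G e) n)))"
        proof (intro sum.cong refl arg_cong2[of _ _ _ _ "(*)"])
          fix d assume d: "d \<in> I"
          show "q ^ k * x k d = (\<Sum>e\<in>I. W' d e * ((\<Sum>f\<in>I. S e f * x (k + \<delta>) f) - germ_nth (G e) n))"
            unfolding x(2)[OF d] T_apply[symmetric] g using n
            by (simp add: k_def right_diff_distrib sum_subtractf)
        qed
        also have "\<dots> = (\<Sum>f\<in>I. S c f * x (k + \<delta>) f) - germ_nth (G c) n"
          by (rule inverse_on_apply[OF W' I c])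
        finally have "q ^ k * (\<Sum>d\<in>I. S' c d * x k d) = (\<Sum>f\<in>I. S c f * x (k + \<delta>) f) - germ_nth (G c) n"
          by (simp add: sum_distrib_left mult_ac)
        moreover have "n - m' = int k" "n - m = int (k + \<delta>)" using n m by (auto simp: k_def \<delta>_def)
        ultimately show ?thesis
          by (simp add: germ_nth_qdiff_op[OF q_nonzero] F del: of_nat_add)
      qed
    qed
    then show "P G" unfolding P_def by blast
  qed
  have step: "P G" if G: "\<And>c n. c \<in> I \<Longrightarrow> n < m - int N \<Longrightarrow> germ_nth (G c) n = 0" for G N
    using G
  proof (induction N arbitrary: G)
    case 0
    then show ?case using base by simp
  next
    case (Suc N)
    \<comment> \<open>\<open>v\<close> is S^(-1) applied to the coefficient of G at the lowest
      exponent still allowed, m - N - 1. The term -z^m S F of the monomial \<open>F1\<close> cancels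
      that coefficient, and its \<sigma>_q-term starts at m' - N - 1 \<ge> m - N.\<close>
    define v where "v d = (\<Sum>e\<in>I. W d e * germ_nth (G e) (m - int N - 1))" for d
    define F1 where "F1 d = germ_z powi (- int N - 1) * germ_const (v d)" for d
    have F1: "germ_nth (F1 d) n = (if n = - int N - 1 then v d else 0)" for d n
      unfolding F1_def germ_nth_z_powi_mult germ_nth_const by auto
    define G' where "G' c = G c + qdiff_op q m m' S S' I F1 c" for c
    have "germ_nth (G' c) n = 0" if c: "c \<in> I" and n: "n < m - int N" for c n
    proof (cases "n = m - int N - 1")
      case True
      then show ?thesis
        using inverse_on_apply[OF W I c, of "\<lambda>e. germ_nth (G e) (m - int N - 1)"] m
        by (simp add: G'_def germ_nth_qdiff_op[OF q_nonzero] F1 v_def)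
    next
      case False
      then show ?thesis using Suc.prems[OF c, of n] m n
        by (simp add: G'_def germ_nth_qdiff_op[OF q_nonzero] F1)
    qed
    then have "P G'" by (rule Suc.IH)
    then obtain F2 where F2: "\<forall>c\<in>I. germ_window m m' (G' c + qdiff_op q m m' S S' I F2 c)"
      unfolding P_def by blast
    have "\<forall>c\<in>I. germ_window m m' (G c + qdiff_op q m m' S S' I (\<lambda>d. F1 d + F2 d) c)"
      using F2 by (simp add: G'_def qdiff_op_add[OF q_nonzero] add.assoc)
    then show ?case unfolding P_def by blast
  qed
  obtain N :: nat where N: "\<And>c n. c \<in> I \<Longrightarrow> n < - int N \<Longrightarrow> germ_nth (G c) n = 0"
    using germ_nth_uniform_pole[OF I, of G] by blast
  have "P G"
  proof (rule step)
    \<comment> \<open>The pole order \<open>N\<close> is measured from 0, the induction counts from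
      m; adding \<open>nat m\<close> brings the threshold to -N or lower.\<close>
    fix c n assume "c \<in> I" "n < m - int (N + nat m)"
    then show "germ_nth (G c) n = 0" by (cases "m \<ge> 0") (auto intro!: N)
  qed
  then show ?thesis unfolding P_def .
qed

end


section \<open>Matrix modules\<close>

lemma gscale_apply [simp]: "gscale c x i = c * x i"
  by (simp add: gscale_def)

lemma gspace_0 [simp]: "gspace 0 = {0}"
  by (auto simp: gspace_def zero_fun_def)

lemma gspace_mono: "m \<le> n \<Longrightarrow> gspace m \<subseteq> gspace n"
  by (auto simp: gspace_def)

lemma subspace_gspace [simp]: "gv.subspace (gspace n)"
  by (auto simp: gv.subspace_def gspace_def)

definition gunit :: "nat \<Rightarrow> gvec" where
  "gunit b = (\<lambda>a. of_bool (a = b))"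

lemma gunit_in_gspace: "b < n \<Longrightarrow> gunit b \<in> gspace n"
  by (auto simp: gunit_def gspace_def)

lemma sum_fun_apply: "(\<Sum>i\<in>I. f i) a = (\<Sum>i\<in>I. f i a)" for f :: "'i \<Rightarrow> gvec"
  by (induction I rule: infinite_finite_induct) simp_all

lemma gspace_expand:
  assumes "x \<in> gspace n"
  shows "x = (\<Sum>b<n. gscale (x b) (gunit b))"
proof
  fix a
  have "(\<Sum>b<n. x b * of_bool (a = b)) = (\<Sum>b<n. if a = b then x b else 0)"
    by (intro sum.cong) auto
  then show "x a = (\<Sum>b<n. gscale (x b) (gunit b)) a"
    using assms by (simp add: sum_fun_apply gunit_def gspace_def)
qed

lemma gspace_finite_span: "\<exists>B. finite B \<and> gv.span B = gspace n"
proof (intro exI conjI)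
  show "gv.span (gunit ` {..<n}) = gspace n"
  proof (rule gv.span_unique)
    show "gunit ` {..<n} \<subseteq> gspace n" by (auto intro: gunit_in_gspace)
    show "gspace n \<subseteq> T" if "gunit ` {..<n} \<subseteq> T" "gv.subspace T" for T
    proof
      fix x assume "x \<in> gspace n"
      then have "x = (\<Sum>b<n. gscale (x b) (gunit b))" by (rule gspace_expand)
      also have "\<dots> \<in> T" using that by (intro gv.subspace_sum gv.subspace_scale) auto
      finally show "x \<in> T" .
    qed
  qed simp
qed simp

definition gvec_sigma :: "complex \<Rightarrow> gvec \<Rightarrow> gvec" where
  "gvec_sigma q x = (\<lambda>a. germ_sigma q (x a))"

lemma gvec_sigma_gspace: "q \<noteq> 0 \<Longrightarrow> gvec_sigma q x \<in> gspace n \<longleftrightarrow> x \<in> gspace n"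
  using germ_sigma_inj[of q _ 0] by (auto simp: gvec_sigma_def gspace_def)

lemma gvec_sigma_surj: "q \<noteq> 0 \<Longrightarrow> \<exists>y. gvec_sigma q y = x"
  by (rule exI[of _ "gvec_sigma (inverse q) x"]) (simp add: gvec_sigma_def germ_sigma_inverse)

lemma gvec_sigma_inj: "q \<noteq> 0 \<Longrightarrow> gvec_sigma q x = gvec_sigma q y \<longleftrightarrow> x = y"
  by (simp add: gvec_sigma_def fun_eq_iff germ_sigma_inj)

lemma gvec_sigma_add: "q \<noteq> 0 \<Longrightarrow> gvec_sigma q (x + y) = gvec_sigma q x + gvec_sigma q y"
  by (simp add: gvec_sigma_def fun_eq_iff)

lemma gvec_sigma_scale: "q \<noteq> 0 \<Longrightarrow> gvec_sigma q (gscale c x) = gscale (germ_sigma q c) (gvec_sigma q x)"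
  by (simp add: gvec_sigma_def fun_eq_iff germ_sigma_mult)

lemma gmat_apply_add: "gmat_apply B (x + y) = gmat_apply B x + gmat_apply B y"
  by (auto simp: gmat_apply_def fun_eq_iff distrib_left sum.distrib)

lemma gmat_apply_scale: "gmat_apply B (gscale c x) = gscale c (gmat_apply B x)"
  by (auto simp: gmat_apply_def fun_eq_iff sum_distrib_left mult_ac)

lemma gmat_apply_in_gspace: "gmat_apply B x \<in> gspace (dim_row B)"
  by (auto simp: gmat_apply_def gspace_def)

lemma gmat_apply_mult:
  assumes "B \<in> carrier_mat n n" "C \<in> carrier_mat n n"
  shows "gmat_apply B (gmat_apply C x) = gmat_apply (B * C) x"
proof
  fix a
  show "gmat_apply B (gmat_apply C x) a = gmat_apply (B * C) x a"
  proof (cases "a < n")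
    case True
    have "(\<Sum>b<n. B $$ (a, b) * (\<Sum>c<n. C $$ (b, c) * x c)) =
        (\<Sum>c<n. (\<Sum>b<n. B $$ (a, b) * C $$ (b, c)) * x c)"
      by (simp add: sum_distrib_left sum_distrib_right mult.assoc) (rule sum.swap)
    then show ?thesis using assms True
      by (simp add: gmat_apply_def scalar_prod_def atLeast0LessThan)
  qed (use assms in \<open>simp add: gmat_apply_def\<close>)
qed

lemma gmat_apply_one:
  assumes "x \<in> gspace n"
  shows "gmat_apply (1\<^sub>m n) x = x"
proof
  fix a
  have "(\<Sum>b<n. 1\<^sub>m n $$ (a, b) * x b) = (\<Sum>b<n. if a = b then x b else 0)" if "a < n"
    using that by (intro sum.cong) auto
  then show "gmat_apply (1\<^sub>m n) x a = x a"
    using assms by (simp add: gmat_apply_def gspace_def)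
qed

text \<open>\<open>matrix_module\<close> takes the content of the option \<open>mat_inverse\<close>,
  so it has to be known that this is not \<open>None\<close>: an injective square matrix over a
  field has nonzero determinant.\<close>

lemma inverse_matrix_of_injective:
  fixes B :: "germ mat"
  assumes B: "B \<in> carrier_mat n n"
    and inj: "\<And>x. x \<in> gspace n \<Longrightarrow> gmat_apply B x = 0 \<Longrightarrow> x = 0"
  obtains C where "mat_inverse B = Some C" "C \<in> carrier_mat n n" "B * C = 1\<^sub>m n" "C * B = 1\<^sub>m n"
proof -
  have "Determinant.det B \<noteq> 0"
  proof
    assume "Determinant.det B = 0"
    then obtain v where v: "v \<in> carrier_vec n" "v \<noteq> 0\<^sub>v n" "B *\<^sub>v v = 0\<^sub>v n"
      using det_0_iff_vec_prod_zero_field[OF B] by blast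
    define x where "x a = (if a < n then vec_index v a else 0)" for a
    have "gmat_apply B x a = 0" for a
    proof (cases "a < n")
      case True
      have "vec_index (B *\<^sub>v v) a = 0" using v(3) True by simp
      then show ?thesis using B True v(1)
        by (simp add: gmat_apply_def x_def scalar_prod_def atLeast0LessThan mult_mat_vec_def)
    qed (use B in \<open>simp add: gmat_apply_def\<close>)
    then have "gmat_apply B x = 0" unfolding zero_fun_def by (rule ext)
    moreover have "x \<in> gspace n" by (simp add: gspace_def x_def)
    ultimately have "x = 0" using inj by blast
    have "vec_index v a = 0" if "a < n" for a
      using that x_def[of a] by (simp add: \<open>x = 0\<close>)
    then have "v = 0\<^sub>v n" using v(1) by (intro eq_vecI) auto
    with v(2) show False by contradiction
  qed
  from det_non_zero_imp_unit[OF B this, where b = b] have "mat_inverse B \<noteq> None"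
    using mat_inverse(1)[OF B, where b = b] by blast
  then obtain C where C: "mat_inverse B = Some C" by auto
  with mat_inverse(2)[OF B this] show ?thesis by (intro that[OF C]) auto
qed

text \<open>The equation B \<Phi>(X) = \<sigma>_q(X) characterises \<Phi> and replaces the inverse
  matrix in all later arguments.\<close>

lemma matrix_module_phi:
  assumes q: "q \<noteq> 0" and B: "B \<in> carrier_mat n n"
    and inj: "\<And>x. x \<in> gspace n \<Longrightarrow> gmat_apply B x = 0 \<Longrightarrow> x = 0"
    and X: "X \<in> gspace n"
  shows "snd (matrix_module q B) X \<in> gspace n"
    and "gmat_apply B (snd (matrix_module q B) X) = gvec_sigma q X"
proof -
  obtain C where C: "mat_inverse B = Some C" "C \<in> carrier_mat n n" "B * C = 1\<^sub>m n"
    using inverse_matrix_of_injective[OF B inj] by blast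
  have eq: "snd (matrix_module q B) X = gmat_apply C (gvec_sigma q X)"
    using C(1) by (simp add: matrix_module_def gvec_sigma_def)
  show "snd (matrix_module q B) X \<in> gspace n"
    using gmat_apply_in_gspace[of C] C(2) by (simp add: eq)
  show "gmat_apply B (snd (matrix_module q B) X) = gvec_sigma q X"
    using gmat_apply_one[of "gvec_sigma q X" n] X q B C by (simp add: eq gmat_apply_mult gvec_sigma_gspace)
qed

lemmas gvec_apply = plus_fun_apply zero_fun_apply minus_apply uminus_apply gscale_apply

text \<open>
  Resolution and induction leave eta-expanded vectors behind, which these rules would turn into
  lambda terms.
\<close>

declare gvec_apply [simp del]


section \<open>Filtered modules\<close>

lemma qcoset_eq_iff:
  assumes N: "gv.subspace N"
  shows "qcoset N x = qcoset N y \<longleftrightarrow> x - y \<in> N"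
proof
  assume "qcoset N x = qcoset N y"
  moreover have "x + 0 \<in> qcoset N x"
    unfolding qcoset_def using gv.subspace_0[OF N] by (rule imageI)
  ultimately obtain n where "n \<in> N" "x = y + n" by (auto simp: qcoset_def)
  then show "x - y \<in> N" by simp
next
  have sub: "qcoset N x \<subseteq> qcoset N y" if "x - y \<in> N" for x y
  proof
    fix v assume "v \<in> qcoset N x"
    then obtain n where n: "n \<in> N" "v = x + n" by (auto simp: qcoset_def)
    have "(x - y) + n \<in> N" using N that n(1) by (rule gv.subspace_add)
    moreover have "v = y + ((x - y) + n)" using n(2) by simp
    ultimately show "v \<in> qcoset N y" unfolding qcoset_def by (intro image_eqI)
  qed
  assume xy: "x - y \<in> N"
  then have "y - x \<in> N" using gv.subspace_neg[OF N xy] by simp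
  with xy sub show "qcoset N x = qcoset N y" by blast
qed

text \<open>The twist \<tau> is a parameter so that one statement serves linear maps and the
  \<sigma>_q-linear \<Phi>. Additivity is asked on the subspace only, as nothing is known about the
  maps outside it.\<close>

lemma semilinear_sum:
  fixes f :: "gvec \<Rightarrow> gvec"
  assumes E: "gv.subspace E"
    and add: "\<And>x y. x \<in> E \<Longrightarrow> y \<in> E \<Longrightarrow> f (x + y) = f x + f y"
    and scale: "\<And>c x. x \<in> E \<Longrightarrow> f (gscale c x) = gscale (\<tau> c) (f x)"
    and x: "\<And>a. a \<in> I \<Longrightarrow> x a \<in> E"
  shows "f (\<Sum>a\<in>I. gscale (c a) (x a)) = (\<Sum>a\<in>I. gscale (\<tau> (c a)) (f (x a)))"
proof -
  have f0: "f 0 = 0" using add[of 0 0] gv.subspace_0[OF E] by simp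
  show ?thesis
  proof (cases "finite I")
    case True
    then show ?thesis using x
    proof (induction I rule: finite_induct)
      case empty
      show "f (\<Sum>a\<in>{}. gscale (c a) (x a)) = (\<Sum>a\<in>{}. gscale (\<tau> (c a)) (f (x a)))"
        using f0 by simp
    next
      case (insert a I)
      have sub: "gscale (c b) (x b) \<in> E" if "b \<in> insert a I" for b
        using insert.prems that by (intro gv.subspace_scale[OF E])
      have IH: "f (\<Sum>a\<in>I. gscale (c a) (x a)) = (\<Sum>a\<in>I. gscale (\<tau> (c a)) (f (x a)))"
        by (rule insert.IH) (use insert.prems in auto)
      have "f (gscale (c a) (x a) + (\<Sum>a\<in>I. gscale (c a) (x a))) =
          f (gscale (c a) (x a)) + f (\<Sum>a\<in>I. gscale (c a) (x a))"
        using sub by (intro add gv.subspace_sum[OF E]) auto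
      also have "f (gscale (c a) (x a)) = gscale (\<tau> (c a)) (f (x a))"
        by (rule scale) (use insert.prems in auto)
      finally show "f (\<Sum>a\<in>insert a I. gscale (c a) (x a)) =
          (\<Sum>a\<in>insert a I. gscale (\<tau> (c a)) (f (x a)))"
        unfolding IH sum.insert[OF insert.hyps] .
    qed
  qed (use f0 in simp)
qed

text \<open>The isomorphism of the graded piece composed with the projection onto the quotient;
  later arguments then speak of vectors instead of cosets.\<close>

definition graded_map :: "filtered_qmod \<Rightarrow> nat \<Rightarrow> gvec \<Rightarrow> gvec" where
  "graded_map M i x = gr_iso M i (qcoset (fil M (i - 1)) x)"

lemma filtered_equiv_alt:
  "(M, M') \<in> filtered_equiv q k P \<longleftrightarrow> filtered_object q k P M \<and> filtered_object q k P M' \<and>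
     (\<exists>f. qdiff_morphism (fil M k, phi M) (fil M' k, phi M') f \<and>
          (\<forall>i\<le>k. f ` fil M i \<subseteq> fil M' i) \<and>
          (\<forall>i\<in>{1..k}. \<forall>x\<in>fil M i. graded_map M i x = graded_map M' i (f x)))"
  by (simp add: filtered_equiv_def graded_map_def)

lemma filtered_equivI:
  assumes "filtered_object q k P M" "filtered_object q k P M'"
    and "qdiff_morphism (fil M k, phi M) (fil M' k, phi M') f"
    and "\<And>i. i \<le> k \<Longrightarrow> f ` fil M i \<subseteq> fil M' i"
    and "\<And>i x. i \<in> {1..k} \<Longrightarrow> x \<in> fil M i \<Longrightarrow> graded_map M i x = graded_map M' i (f x)"
  shows "(M, M') \<in> filtered_equiv q k P"
  unfolding filtered_equiv_alt by (intro conjI exI[of _ f] allI impI ballI assms)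

lemma filtered_equivE:
  assumes "(M, M') \<in> filtered_equiv q k P"
  obtains f where "filtered_object q k P M" "filtered_object q k P M'"
    and "qdiff_morphism (fil M k, phi M) (fil M' k, phi M') f"
    and "\<forall>i\<le>k. f ` fil M i \<subseteq> fil M' i"
    and "\<forall>i\<in>{1..k}. \<forall>x\<in>fil M i. graded_map M i x = graded_map M' i (f x)"
  using assms unfolding filtered_equiv_alt by (elim conjE exE)

context
  fixes q k P M
  assumes M: "filtered_object q k P M"
begin

lemma fil_0: "fil M 0 = {0}"
  using M by (simp add: filtered_object_def)

lemma fil_module: "i \<le> k \<Longrightarrow> qdiff_module q (fil M i, phi M)"
  using M by (simp add: filtered_object_def)

lemma fil_subspace: "i \<le> k \<Longrightarrow> gv.subspace (fil M i)"
  using fil_module by (simp add: qdiff_module_def)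

lemma fil_phi_bij: "i \<le> k \<Longrightarrow> bij_betw (phi M) (fil M i) (fil M i)"
  using fil_module by (simp add: qdiff_module_def)

lemma fil_phi_add: "i \<le> k \<Longrightarrow> x \<in> fil M i \<Longrightarrow> y \<in> fil M i \<Longrightarrow> phi M (x + y) = phi M x + phi M y"
  using fil_module by (simp add: qdiff_module_def)

lemma fil_phi_scale:
  "i \<le> k \<Longrightarrow> x \<in> fil M i \<Longrightarrow> phi M (gscale c x) = gscale (germ_sigma q c) (phi M x)"
  using fil_module by (simp add: qdiff_module_def)

lemma fil_step: "i \<in> {1..k} \<Longrightarrow> fil M (i - 1) \<subseteq> fil M i"
  using M by (simp add: filtered_object_def)

lemma fil_mono: "i \<le> j \<Longrightarrow> j \<le> k \<Longrightarrow> fil M i \<subseteq> fil M j"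
proof (induction j rule: dec_induct)
  case (step j)
  then show ?case using fil_step[of "Suc j"] by auto
qed simp

lemma graded_map_quotient_iso:
  "i \<in> {1..k} \<Longrightarrow> quotient_iso (fil M i, phi M) (fil M (i - 1)) (P i) (gr_iso M i)"
  using M by (simp add: filtered_object_def)

lemma graded_map_add: "i \<in> {1..k} \<Longrightarrow> x \<in> fil M i \<Longrightarrow> y \<in> fil M i \<Longrightarrow>
    graded_map M i (x + y) = graded_map M i x + graded_map M i y"
  using graded_map_quotient_iso[of i] by (simp add: quotient_iso_def graded_map_def split: prod.splits)

lemma graded_map_scale: "i \<in> {1..k} \<Longrightarrow> x \<in> fil M i \<Longrightarrow>
    graded_map M i (gscale c x) = gscale c (graded_map M i x)"
  using graded_map_quotient_iso[of i] by (simp add: quotient_iso_def graded_map_def split: prod.splits)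

lemma graded_map_phi: "i \<in> {1..k} \<Longrightarrow> x \<in> fil M i \<Longrightarrow>
    graded_map M i (phi M x) = snd (P i) (graded_map M i x)"
  using graded_map_quotient_iso[of i] by (simp add: quotient_iso_def graded_map_def split: prod.splits)

lemma graded_map_image: "i \<in> {1..k} \<Longrightarrow> graded_map M i ` fil M i = fst (P i)"
  using graded_map_quotient_iso[of i]
  by (simp add: quotient_iso_def graded_map_def bij_betw_def image_image split: prod.splits)

lemma graded_map_eq_iff:
  assumes i: "i \<in> {1..k}" and "x \<in> fil M i" "y \<in> fil M i"
  shows "graded_map M i x = graded_map M i y \<longleftrightarrow> x - y \<in> fil M (i - 1)"
proof -
  have "inj_on (gr_iso M i) (qcoset (fil M (i - 1)) ` fil M i)"
    using graded_map_quotient_iso[OF i] by (simp add: quotient_iso_def bij_betw_def split: prod.splits)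
  then have "graded_map M i x = graded_map M i y \<longleftrightarrow>
      qcoset (fil M (i - 1)) x = qcoset (fil M (i - 1)) y"
    unfolding graded_map_def using assms by (intro inj_on_eq_iff) auto
  also have "\<dots> \<longleftrightarrow> x - y \<in> fil M (i - 1)"
    using i by (intro qcoset_eq_iff fil_subspace) auto
  finally show ?thesis .
qed

lemma fil_sum: "i \<le> k \<Longrightarrow> (\<And>a. a \<in> I \<Longrightarrow> x a \<in> fil M i) \<Longrightarrow> (\<Sum>a\<in>I. gscale (c a) (x a)) \<in> fil M i"
  by (intro gv.subspace_sum gv.subspace_scale fil_subspace)

lemma fil_phi_sum:
  "i \<le> k \<Longrightarrow> (\<And>a. a \<in> I \<Longrightarrow> x a \<in> fil M i) \<Longrightarrow>
    phi M (\<Sum>a\<in>I. gscale (c a) (x a)) = (\<Sum>a\<in>I. gscale (germ_sigma q (c a)) (phi M (x a)))"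
  by (rule semilinear_sum[OF fil_subspace]) (auto intro: fil_phi_add fil_phi_scale)

lemma graded_map_sum:
  "i \<in> {1..k} \<Longrightarrow> (\<And>a. a \<in> I \<Longrightarrow> x a \<in> fil M i) \<Longrightarrow>
    graded_map M i (\<Sum>a\<in>I. gscale (c a) (x a)) = (\<Sum>a\<in>I. gscale (c a) (graded_map M i (x a)))"
  by (rule semilinear_sum[OF fil_subspace]) (auto intro: graded_map_add graded_map_scale)

end

text \<open>
  A filtered morphism that is bijective on the graded pieces is bijective; this yields the symmetry of
  \<^const>\<open>filtered_equiv\<close>, whose definition only asks for a morphism.
\<close>

lemma filtered_equiv_bij:
  assumes M: "filtered_object q k P M" and M': "filtered_object q k P M'"
    and f: "qdiff_morphism (fil M k, phi M) (fil M' k, phi M') f"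
    and ff: "\<forall>i\<le>k. f ` fil M i \<subseteq> fil M' i"
    and fg: "\<forall>i\<in>{1..k}. \<forall>x\<in>fil M i. graded_map M i x = graded_map M' i (f x)"
    and i: "i \<le> k"
  shows "bij_betw f (fil M i) (fil M' i)"
proof -
  have add: "f (x + y) = f x + f y" if "x \<in> fil M k" "y \<in> fil M k" for x y
    using f that by (simp add: qdiff_morphism_def)
  have f0: "f 0 = 0"
    using add[of 0 0] gv.subspace_0[OF fil_subspace[OF M order_refl]] by simp
  have diff: "f (x - y) = f x - f y" if "x \<in> fil M k" "y \<in> fil M k" for x y
    using add[of "x - y" y] gv.subspace_diff[OF fil_subspace[OF M order_refl] that] that
    by (simp add: algebra_simps)
  have inj0: "x = 0" if "i \<le> k" "x \<in> fil M i" and fx: "f x = 0" for x i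
    using that(1,2)
  proof (induction i)
    case 0
    then show "x = 0" using fil_0[OF M] by simp
  next
    case (Suc i)
    have i: "Suc i \<in> {1..k}" using Suc.prems by simp
    have z: "0 \<in> fil M (Suc i)" by (rule gv.subspace_0[OF fil_subspace[OF M Suc.prems(1)]])
    have "graded_map M (Suc i) x = graded_map M (Suc i) 0"
      using fg[rule_format, OF i Suc.prems(2)] fg[rule_format, OF i z] fx f0 by simp
    then have "x \<in> fil M i"
      using graded_map_eq_iff[OF M i Suc.prems(2) z] by simp
    then show "x = 0" using Suc.IH Suc.prems(1) by simp
  qed
  have surj: "\<exists>x\<in>fil M i. f x = y" if "i \<le> k" "y \<in> fil M' i" for y i
    using that
  proof (induction i arbitrary: y)
    case 0
    then have "y = 0" using fil_0[OF M'] by (simp only: singleton_iff)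
    with f0 have "f 0 = y" by simp
    moreover have "0 \<in> fil M 0" using fil_0[OF M] by simp
    ultimately show "\<exists>x\<in>fil M 0. f x = y" by (intro bexI[of _ 0])
  next
    case (Suc i)
    have i: "Suc i \<in> {1..k}" and ik: "i \<le> k" using Suc.prems by simp_all
    \<comment> \<open>Both graded maps have the same image, the space of \<open>P (Suc i)\<close>.
      So some \<open>x\<close> has the same graded part as \<open>y\<close>, and the remaining
      difference drops to the previous step.\<close>
    have "graded_map M' (Suc i) y \<in> graded_map M (Suc i) ` fil M (Suc i)"
      unfolding graded_map_image[OF M i] graded_map_image[OF M' i, symmetric]
      by (rule imageI[OF Suc.prems(2)])
    then obtain x where x: "graded_map M' (Suc i) y = graded_map M (Suc i) x" "x \<in> fil M (Suc i)"
      by (rule imageE)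
    have fx: "f x \<in> fil M' (Suc i)" using ff Suc.prems(1) x(2) by (simp add: image_subset_iff)
    have "graded_map M' (Suc i) y = graded_map M' (Suc i) (f x)"
      using x(1) fg[rule_format, OF i x(2)] by simp
    then have "y - f x \<in> fil M' i"
      using graded_map_eq_iff[OF M' i Suc.prems(2) fx] by simp
    from Suc.IH[OF ik this] obtain w where w: "w \<in> fil M i" "f w = y - f x"
      by (rule bexE)
    have w': "w \<in> fil M (Suc i)" using fil_step[OF M i] w(1) by auto
    have "x + w \<in> fil M (Suc i)"
      by (rule gv.subspace_add[OF fil_subspace[OF M Suc.prems(1)] x(2) w'])
    moreover have "f (x + w) = y"
      using add[of x w] x(2) w' w(2) fil_mono[OF M Suc.prems(1) order_refl] by auto
    ultimately show "\<exists>x\<in>fil M (Suc i). f x = y" by (intro bexI[of _ "x + w"])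
  qed
  have ik: "fil M i \<subseteq> fil M k" by (rule fil_mono[OF M i order_refl])
  show ?thesis
  proof (rule bij_betw_imageI)
    show "inj_on f (fil M i)"
    proof (rule inj_onI)
      fix x y assume xy: "x \<in> fil M i" "y \<in> fil M i" "f x = f y"
      have xy': "x - y \<in> fil M i" using xy(1,2) by (rule gv.subspace_diff[OF fil_subspace[OF M i]])
      have "f (x - y) = 0" using diff[of x y] xy ik by (simp add: subset_iff)
      with inj0[OF i xy'] have "x - y = 0" by simp
      then show "x = y" by simp
    qed
    show "f ` fil M i = fil M' i"
    proof
      show "f ` fil M i \<subseteq> fil M' i" using ff i by simp
      show "fil M' i \<subseteq> f ` fil M i"
      proof
        fix y assume "y \<in> fil M' i"
        from surj[OF i this] obtain x where "x \<in> fil M i" "f x = y" by (rule bexE)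
        then show "y \<in> f ` fil M i" by (intro image_eqI[of _ _ x]) simp_all
      qed
    qed
  qed
qed

lemma equiv_filtered_equiv: "equiv {M. filtered_object q k P M} (filtered_equiv q k P)"
proof (rule equivI)
  show "filtered_equiv q k P \<subseteq> {M. filtered_object q k P M} \<times> {M. filtered_object q k P M}"
    by (auto simp: filtered_equiv_def)
  show "refl_on {M. filtered_object q k P M} (filtered_equiv q k P)"
  proof (rule refl_onI)
    fix M assume "M \<in> {M. filtered_object q k P M}"
    then have M: "filtered_object q k P M" by simp
    show "(M, M) \<in> filtered_equiv q k P"
      by (rule filtered_equivI[OF M M, of "\<lambda>x. x"]) (auto simp: qdiff_morphism_def)
  qed
  show "trans (filtered_equiv q k P)"
  proof (rule transI)
    fix M M' M'' assume 1: "(M, M') \<in> filtered_equiv q k P" and 2: "(M', M'') \<in> filtered_equiv q k P"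
    from 1 obtain f where M: "filtered_object q k P M"
      and f: "qdiff_morphism (fil M k, phi M) (fil M' k, phi M') f"
      "\<forall>i\<le>k. f ` fil M i \<subseteq> fil M' i"
      "\<forall>i\<in>{1..k}. \<forall>x\<in>fil M i. graded_map M i x = graded_map M' i (f x)"
      by (rule filtered_equivE)
    from 2 obtain g where M'': "filtered_object q k P M''"
      and g: "qdiff_morphism (fil M' k, phi M') (fil M'' k, phi M'') g"
      "\<forall>i\<le>k. g ` fil M' i \<subseteq> fil M'' i"
      "\<forall>i\<in>{1..k}. \<forall>x\<in>fil M' i. graded_map M' i x = graded_map M'' i (g x)"
      by (rule filtered_equivE)
    have ff: "f x \<in> fil M' i" if "i \<le> k" "x \<in> fil M i" for i x
      using f(2) that by (simp add: image_subset_iff)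
    show "(M, M'') \<in> filtered_equiv q k P"
    proof (rule filtered_equivI[OF M M''])
      show "qdiff_morphism (fil M k, phi M) (fil M'' k, phi M'') (\<lambda>x. g (f x))"
        using f(1) g(1) by (auto simp: qdiff_morphism_def image_subset_iff)
      show "(\<lambda>x. g (f x)) ` fil M i \<subseteq> fil M'' i" if "i \<le> k" for i
        using ff g(2) that by (auto simp: image_subset_iff)
      show "graded_map M i x = graded_map M'' i (g (f x))" if "i \<in> {1..k}" "x \<in> fil M i" for i x
        using ff[of i x] f(3) g(3) that by simp
    qed
  qed
  show "sym (filtered_equiv q k P)"
  proof (rule symI)
    fix M M' assume "(M, M') \<in> filtered_equiv q k P"
    then obtain f where M: "filtered_object q k P M" and M': "filtered_object q k P M'"
      and f: "qdiff_morphism (fil M k, phi M) (fil M' k, phi M') f"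
      "\<forall>i\<le>k. f ` fil M i \<subseteq> fil M' i"
      "\<forall>i\<in>{1..k}. \<forall>x\<in>fil M i. graded_map M i x = graded_map M' i (f x)"
      by (rule filtered_equivE)
    note bij = filtered_equiv_bij[OF M M' f]
    \<comment> \<open>The inverse is taken on the whole module. It respects the filtration because
      \<open>f\<close> is bijective on every step, not only on the last one.\<close>
    define g where "g = inv_into (fil M k) f"
    have gf: "g (f x) = x" if "x \<in> fil M k" for x
      using bij[OF order_refl] that by (simp add: g_def bij_betw_def)
    have img: "\<exists>x\<in>fil M i. y = f x" if "i \<le> k" "y \<in> fil M' i" for i y
      using bij[OF that(1)] that(2) by (auto simp: bij_betw_def)
    have add: "f (x + y) = f x + f y" "f (gscale c x) = gscale c (f x)" "f (phi M x) = phi M' (f x)"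
      if "x \<in> fil M k" "y \<in> fil M k" for x y c
      using f(1) that by (simp_all add: qdiff_morphism_def)
    have sub: "gv.subspace (fil M k)" by (rule fil_subspace[OF M order_refl])
    have phi: "phi M x \<in> fil M k" if "x \<in> fil M k" for x
      using fil_phi_bij[OF M order_refl] that by (auto simp: bij_betw_def)
    have mono: "x \<in> fil M k" if "i \<le> k" "x \<in> fil M i" for x i
      using fil_mono[OF M that(1) order_refl] that(2) by auto
    have g: "g y \<in> fil M i" "f (g y) = y" if i: "i \<le> k" and y: "y \<in> fil M' i" for i y
    proof -
      obtain x where x: "x \<in> fil M i" "y = f x" using img[OF i y] by (rule bexE)
      then show "g y \<in> fil M i" "f (g y) = y" using gf[OF mono[OF i x(1)]] by simp_all
    qed
    note gk = g[OF order_refl]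
    show "(M', M) \<in> filtered_equiv q k P"
    proof (rule filtered_equivI[OF M' M])
      have "g ` fil M' k \<subseteq> fil M k"
        using gk(1) by (simp add: image_subset_iff)
      moreover have "g (y + y') = g y + g y'" if y: "y \<in> fil M' k" "y' \<in> fil M' k" for y y'
      proof -
        have "y + y' = f (g y + g y')" using y by (simp add: add(1) gk)
        then show ?thesis using gv.subspace_add[OF sub gk(1)[OF y(1)] gk(1)[OF y(2)]] gf by simp
      qed
      moreover have "g (gscale c y) = gscale c (g y)" if y: "y \<in> fil M' k" for c y
      proof -
        have "gscale c y = f (gscale c (g y))" using y by (simp add: add(2)[OF gk(1)[OF y] gk(1)[OF y]] gk)
        then show ?thesis using gv.subspace_scale[OF sub gk(1)[OF y]] gf by simp
      qed
      moreover have "g (phi M' y) = phi M (g y)" if y: "y \<in> fil M' k" for y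
      proof -
        have "phi M' y = f (phi M (g y))" using y by (simp add: add(3)[OF gk(1)[OF y] gk(1)[OF y]] gk)
        then show ?thesis using phi[OF gk(1)[OF y]] gf by simp
      qed
      ultimately show "qdiff_morphism (fil M' k, phi M') (fil M k, phi M) g"
        by (simp add: qdiff_morphism_def)
      show "g ` fil M' i \<subseteq> fil M i" if "i \<le> k" for i
        using g(1)[OF that] by (simp add: image_subset_iff)
      show "graded_map M' i y = graded_map M i (g y)" if i: "i \<in> {1..k}" "y \<in> fil M' i" for i y
        using f(3) g[of i y] i by simp
    qed
  qed
qed


section \<open>Block triangular modules and gauge transformations\<close>

lemma offset_0 [simp]: "offset r 0 = 0"
  by (simp add: offset_def)

lemma offset_Suc: "offset r (Suc i) = offset r i + r (Suc i)"
  by (simp add: offset_def)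

lemma offset_mono: "i \<le> j \<Longrightarrow> offset r i \<le> offset r j"
  by (induction j rule: dec_induct) (simp_all add: offset_Suc)

definition block_set :: "(nat \<Rightarrow> nat) \<Rightarrow> nat \<Rightarrow> nat set" where
  "block_set r i = {offset r (i - 1)..<offset r i}"

lemma finite_block_set [simp]: "finite (block_set r i)"
  by (simp add: block_set_def)

lemma offset_pred: "i \<ge> 1 \<Longrightarrow> offset r i = offset r (i - 1) + r i"
  using offset_Suc[of r "i - 1"] by simp

lemma block_eqI:
  assumes "i \<ge> 1" "a \<in> block_set r i"
  shows "block r a = i"
  unfolding block_def
proof (rule Least_equality)
  show "a < offset r i" using assms by (simp add: block_set_def)
  fix j assume "a < offset r j"
  show "i \<le> j"
  proof (rule ccontr)
    assume "\<not> i \<le> j"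
    then have "offset r j \<le> offset r (i - 1)" by (intro offset_mono) simp
    with \<open>a < offset r j\<close> assms show False by (simp add: block_set_def)
  qed
qed

lemma block_in:
  assumes "a < offset r k"
  shows "block r a \<in> {1..k}" "a \<in> block_set r (block r a)"
proof -
  have 1: "a < offset r (block r a)" unfolding block_def using assms by (rule LeastI)
  then have 2: "block r a \<noteq> 0" by (metis offset_0 not_less0)
  have "\<not> a < offset r (block r a - 1)"
    unfolding block_def by (rule not_less_Least) (use 2 in \<open>simp add: block_def\<close>)
  then show "a \<in> block_set r (block r a)" using 1 by (simp add: block_set_def)
  have "block r a \<le> k" unfolding block_def using assms by (rule Least_le)
  then show "block r a \<in> {1..k}" using 2 by simp
qed

lemma block_le_iff: "a < offset r k \<Longrightarrow> block r a \<le> i \<longleftrightarrow> a < offset r i"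
proof
  assume "a < offset r k" "block r a \<le> i"
  then show "a < offset r i"
    using block_in(2)[of a r k] offset_mono[of "block r a" i r] by (simp add: block_set_def)
next
  assume "a < offset r i"
  then show "block r a \<le> i" unfolding block_def by (rule Least_le)
qed

lemma block_set_subset: "i \<le> k \<Longrightarrow> block_set r i \<subseteq> {..<offset r k}"
  using offset_mono[of i k r] by (auto simp: block_set_def)

lemma block_set_reindex:
  "i \<ge> 1 \<Longrightarrow> (\<Sum>a\<in>block_set r i. f a) = (\<Sum>l<r i. f (offset r (i - 1) + l))"
  by (rule sum.reindex_bij_witness[of _ "\<lambda>l. offset r (i - 1) + l" "\<lambda>a. a - offset r (i - 1)"])
    (auto simp: block_set_def offset_pred)

lemma gmat_apply_diff: "gmat_apply B (x - y) = gmat_apply B x - gmat_apply B y"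
  using gmat_apply_add[of B "x - y" y] by simp

section \<open>Global indices and the diagonal blocks\<close>

locale slope_data =
  fixes q :: complex and k :: nat and \<mu> :: "nat \<Rightarrow> int" and r :: "nat \<Rightarrow> nat"
    and A :: "nat \<Rightarrow> complex mat" and P :: "nat \<Rightarrow> qmod"
  assumes q: "norm q > 1"
    and slopes: "strict_mono_on {1..k} \<mu>"
    and A: "\<And>i. i \<in> {1..k} \<Longrightarrow> A i \<in> carrier_mat (r i) (r i) \<and> invertible_mat (A i)"
    and P: "\<And>i. i \<in> {1..k} \<Longrightarrow> P i = pure_piece q (\<mu> i) (A i)"
begin

abbreviation "N \<equiv> offset r k"
abbreviation "\<beta> \<equiv> block r"

text \<open>Position of a global index inside its block. With \<open>\<beta>\<close> and
  \<open>\<rho>\<close> a block matrix is a single function of two global indices.\<close>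

definition \<rho> :: "nat \<Rightarrow> nat" where "\<rho> a = a - offset r (\<beta> a - 1)"

lemma q_nonzero: "q \<noteq> 0"
  using q by auto

lemma \<rho>_less: "a < N \<Longrightarrow> \<rho> a < r (\<beta> a)"
  using block_in[of a r k] by (auto simp: \<rho>_def block_set_def offset_pred)

lemma block_setD:
  assumes "i \<in> {1..k}" "a \<in> block_set r i"
  shows "\<beta> a = i" "a < N" "\<rho> a = a - offset r (i - 1)"
  using assms block_eqI[of i a r] block_set_subset[of i k r] by (auto simp: \<rho>_def)

lemma block_set_eq: "i \<in> {1..k} \<Longrightarrow> block_set r i = {a. a < N \<and> \<beta> a = i}"
  using block_setD block_in(2) by blast

text \<open>Constant part of the block diagonal in global indices, to be read only for
  \<open>a\<close> and \<open>b\<close> in the same block.\<close>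

definition const_diag :: "nat \<Rightarrow> nat \<Rightarrow> complex" where "const_diag a b = A (\<beta> a) $$ (\<rho> a, \<rho> b)"

definition A_inv :: "nat \<Rightarrow> complex mat" where "A_inv i = (SOME B. A i * B = 1\<^sub>m (r i) \<and> B * A i = 1\<^sub>m (r i))"

definition const_diag_inv :: "nat \<Rightarrow> nat \<Rightarrow> complex" where "const_diag_inv a b = A_inv (\<beta> a) $$ (\<rho> a, \<rho> b)"

lemma A_inv:
  assumes i: "i \<in> {1..k}"
  shows "A i * A_inv i = 1\<^sub>m (r i)" "A_inv i * A i = 1\<^sub>m (r i)" "A_inv i \<in> carrier_mat (r i) (r i)"
proof -
  obtain B where B: "inverts_mat (A i) B" "inverts_mat B (A i)"
    using A[OF i] by (auto simp: invertible_mat_def)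
  have "A i * B = 1\<^sub>m (r i)" using B(1) A[OF i] by (auto simp: inverts_mat_def)
  \<comment> \<open>\<open>invertible_mat\<close> does not prescribe the shape of the inverse; its
    dimensions are read off from the two products.\<close>
  moreover from this have "dim_col B = r i" by (metis index_mult_mat(3) index_one_mat(3))
  moreover have "B * A i = 1\<^sub>m (dim_row B)" using B(2) by (simp add: inverts_mat_def)
  moreover from this have "dim_row B = r i"
    using A[OF i] by (metis carrier_matD(2) index_mult_mat(3) index_one_mat(3))
  ultimately have ex: "A i * B = 1\<^sub>m (r i) \<and> B * A i = 1\<^sub>m (r i)" by simp
  show *: "A i * A_inv i = 1\<^sub>m (r i)" "A_inv i * A i = 1\<^sub>m (r i)"
    using someI[of "\<lambda>B. A i * B = 1\<^sub>m (r i) \<and> B * A i = 1\<^sub>m (r i)", OF ex] by (simp_all add: A_inv_def)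
  from * show "A_inv i \<in> carrier_mat (r i) (r i)"
    by (metis carrier_matI index_mult_mat(2,3) index_one_mat(2,3))
qed

lemma inverse_on_A:
  assumes i: "i \<in> {1..k}"
  shows "inverse_on {..<r i} (\<lambda>a b. A i $$ (a, b)) (\<lambda>a b. A_inv i $$ (a, b))"
  unfolding inverse_on_def
proof (intro ballI conjI)
  fix a b assume ab: "a \<in> {..<r i}" "b \<in> {..<r i}"
  have "(\<Sum>d<r i. A i $$ (a, d) * A_inv i $$ (d, b)) = (A i * A_inv i) $$ (a, b)"
    using ab A[OF i, THEN conjunct1] A_inv(3)[OF i] by (simp add: scalar_prod_def atLeast0LessThan)
  then show "(\<Sum>d<r i. A i $$ (a, d) * A_inv i $$ (d, b)) = of_bool (a = b)"
    using ab by (simp add: A_inv[OF i])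
  have "(\<Sum>d<r i. A_inv i $$ (a, d) * A i $$ (d, b)) = (A_inv i * A i) $$ (a, b)"
    using ab A[OF i, THEN conjunct1] A_inv(3)[OF i] by (simp add: scalar_prod_def atLeast0LessThan)
  then show "(\<Sum>d<r i. A_inv i $$ (a, d) * A i $$ (d, b)) = of_bool (a = b)"
    using ab by (simp add: A_inv[OF i])
qed

lemma inverse_on_const_diag:
  assumes i: "i \<in> {1..k}"
  shows "inverse_on (block_set r i) const_diag const_diag_inv"
  unfolding inverse_on_def
proof (intro ballI conjI)
  fix a b assume ab: "a \<in> block_set r i" "b \<in> block_set r i"
  have i1: "i \<ge> 1" using i by simp
  have shift: "\<beta> (offset r (i - 1) + l) = i" "\<rho> (offset r (i - 1) + l) = l" if "l < r i" for l
  proof -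
    have "offset r (i - 1) + l \<in> block_set r i"
      using that by (simp add: block_set_def offset_pred[OF i1])
    then show "\<beta> (offset r (i - 1) + l) = i" "\<rho> (offset r (i - 1) + l) = l"
      using block_setD[OF i] by simp_all
  qed
  have "\<rho> c < r i \<and> offset r (i - 1) + \<rho> c = c" if "c \<in> block_set r i" for c
    using block_setD(3)[OF i that] that by (auto simp: block_set_def offset_pred[OF i1])
  then have \<rho>: "\<rho> a \<in> {..<r i}" "\<rho> b \<in> {..<r i}" "\<rho> a = \<rho> b \<longleftrightarrow> a = b"
    using ab by (simp_all, metis)
  have "(\<Sum>d\<in>block_set r i. const_diag a d * const_diag_inv d b) = (\<Sum>d<r i. A i $$ (\<rho> a, d) * A_inv i $$ (d, \<rho> b))"
    unfolding block_set_reindex[OF i1]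
    by (intro sum.cong) (simp_all add: const_diag_def const_diag_inv_def shift block_setD(1)[OF i ab(1)] del: One_nat_def)
  then show "(\<Sum>d\<in>block_set r i. const_diag a d * const_diag_inv d b) = of_bool (a = b)"
    using inverse_on_A[OF i] \<rho> by (simp add: inverse_on_def)
  have "(\<Sum>d\<in>block_set r i. const_diag_inv a d * const_diag d b) = (\<Sum>d<r i. A_inv i $$ (\<rho> a, d) * A i $$ (d, \<rho> b))"
    unfolding block_set_reindex[OF i1]
    by (intro sum.cong) (simp_all add: const_diag_def const_diag_inv_def shift block_setD(1)[OF i ab(1)] del: One_nat_def)
  then show "(\<Sum>d\<in>block_set r i. const_diag_inv a d * const_diag d b) = of_bool (a = b)"
    using inverse_on_A[OF i] \<rho> by (simp add: inverse_on_def)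
qed

definition diag_entry :: "nat \<Rightarrow> nat \<Rightarrow> germ" where
  "diag_entry a b = germ_z powi \<mu> (\<beta> a) * germ_const (const_diag a b)"

definition diag_entry_inv :: "nat \<Rightarrow> nat \<Rightarrow> germ" where
  "diag_entry_inv a b = germ_z powi (- \<mu> (\<beta> a)) * germ_const (const_diag_inv a b)"

lemma inverse_on_diag_entry:
  assumes i: "i \<in> {1..k}"
  shows "inverse_on (block_set r i) diag_entry diag_entry_inv"
  unfolding inverse_on_def
proof (intro ballI)
  fix a b assume ab: "a \<in> block_set r i" "b \<in> block_set r i"
  have z: "germ_z powi m * x * (germ_z powi (- m) * y) = x * y" for m x y
    by (simp add: power_int_minus)
  have "(\<Sum>d\<in>block_set r i. diag_entry a d * diag_entry_inv d b) = germ_const (\<Sum>d\<in>block_set r i. const_diag a d * const_diag_inv d b)"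
    unfolding germ_const_sum using ab block_setD(1)[OF i]
    by (intro sum.cong) (simp_all add: diag_entry_def diag_entry_inv_def z)
  moreover have "(\<Sum>d\<in>block_set r i. diag_entry_inv a d * diag_entry d b) = germ_const (\<Sum>d\<in>block_set r i. const_diag_inv a d * const_diag d b)"
    unfolding germ_const_sum using ab block_setD(1)[OF i] z[of "- m" for m]
    by (intro sum.cong) (simp_all add: diag_entry_def diag_entry_inv_def)
  moreover have "(\<Sum>d\<in>block_set r i. const_diag a d * const_diag_inv d b) = of_bool (a = b)"
    "(\<Sum>d\<in>block_set r i. const_diag_inv a d * const_diag d b) = of_bool (a = b)"
    using inverse_on_const_diag[OF i] ab by (simp_all add: inverse_on_def)
  ultimately show "(\<Sum>d\<in>block_set r i. diag_entry a d * diag_entry_inv d b) = of_bool (a = b) \<and>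
      (\<Sum>d\<in>block_set r i. diag_entry_inv a d * diag_entry d b) = of_bool (a = b)"
    by (simp only:) simp
qed

text \<open>The statement speaks of families of blocks, the gauge computations of one function on
  global indices. \<open>block_join\<close> and \<open>block_split\<close> pass between the two
  encodings.\<close>

definition block_join :: "(nat \<Rightarrow> nat \<Rightarrow> germ mat) \<Rightarrow> nat \<Rightarrow> nat \<Rightarrow> germ" where
  "block_join U a b = U (\<beta> a) (\<beta> b) $$ (\<rho> a, \<rho> b)"

definition block_split :: "(nat \<Rightarrow> nat \<Rightarrow> germ) \<Rightarrow> nat \<Rightarrow> nat \<Rightarrow> germ mat" where
  "block_split W i j = mat (r i) (r j) (\<lambda>(a, b). W (offset r (i - 1) + a) (offset r (j - 1) + b))"

lemma block_join_split:
  assumes "a < N" "b < N"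
  shows "block_join (block_split W) a b = W a b"
proof -
  have "offset r (\<beta> a - 1) + \<rho> a = a" "offset r (\<beta> b - 1) + \<rho> b = b"
    using assms block_in(2)[of _ r k] by (auto simp: \<rho>_def block_set_def)
  then show ?thesis using \<rho>_less assms by (simp add: block_join_def block_split_def)
qed

text \<open>Only the values of \<open>W\<close> strictly above the block diagonal enter, so
  equalities of such functions need to be proved only there.\<close>

definition block_entry :: "(nat \<Rightarrow> nat \<Rightarrow> germ) \<Rightarrow> nat \<Rightarrow> nat \<Rightarrow> germ" where
  "block_entry W a b = (if \<beta> a = \<beta> b then diag_entry a b else if \<beta> a < \<beta> b then W a b else 0)"

section \<open>The filtered module of a block triangular matrix\<close>

abbreviation "bmat U \<equiv> block_matrix k \<mu> r A U"
abbreviation "obj U \<equiv> matrix_object q k \<mu> r A U"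

lemma bmat_carrier: "bmat U \<in> carrier_mat N N"
  by (simp add: block_matrix_def)

lemma bmat_index:
  assumes "a < N" "b < N"
  shows "bmat U $$ (a, b) = block_entry (block_join U) a b"
proof -
  have d: "dim_row (A (\<beta> a)) = r (\<beta> a)" "dim_col (A (\<beta> a)) = r (\<beta> a)"
    using A[OF block_in(1)[OF assms(1)]] by auto
  have "bmat U $$ (a, b) = (if \<beta> a = \<beta> b then zpow_mat (\<mu> (\<beta> a)) (A (\<beta> a)) $$ (\<rho> a, \<rho> b)
      else if \<beta> a < \<beta> b then block_join U a b else 0)"
    using assms by (simp add: block_matrix_def block_join_def \<rho>_def Let_def)
  moreover have "zpow_mat (\<mu> (\<beta> a)) (A (\<beta> a)) $$ (\<rho> a, \<rho> b) = diag_entry a b" if "\<beta> a = \<beta> b"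
    using \<rho>_less[OF assms(1)] \<rho>_less[OF assms(2)] that d by (simp add: zpow_mat_def diag_entry_def const_diag_def)
  ultimately show ?thesis by (simp add: block_entry_def)
qed

lemma bmat_apply: "gmat_apply (bmat U) x a = (if a < N then \<Sum>b<N. block_entry (block_join U) a b * x b else 0)"
  using bmat_carrier[of U] by (simp add: gmat_apply_def bmat_index)

lemma bmat_apply_diag:
  assumes i: "i \<in> {1..k}" and a: "a \<in> block_set r i" and x: "x \<in> gspace (offset r i)"
  shows "gmat_apply (bmat U) x a = (\<Sum>b\<in>block_set r i. diag_entry a b * x b)"
proof -
  have "(\<Sum>b<N. block_entry (block_join U) a b * x b) = (\<Sum>b\<in>block_set r i. block_entry (block_join U) a b * x b)"
  proof (rule sum.mono_neutral_right)
    show "\<forall>b\<in>{..<N} - block_set r i. block_entry (block_join U) a b * x b = 0"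
    proof
      fix b assume b: "b \<in> {..<N} - block_set r i"
      show "block_entry (block_join U) a b * x b = 0"
      proof (cases "b < offset r i")
        case True
        then have "\<beta> b \<le> i" using b by (simp add: block_le_iff)
        moreover have "\<beta> b \<noteq> i" using b block_set_eq[OF i] by blast
        ultimately have "\<beta> b < i" by simp
        then show ?thesis using block_setD(1)[OF i a] by (simp add: block_entry_def)
      next
        case False
        then show ?thesis using x by (simp add: gspace_def)
      qed
    qed
  qed (use i block_set_subset[of i k r] in auto)
  also have "\<dots> = (\<Sum>b\<in>block_set r i. diag_entry a b * x b)"
    using block_setD(1)[OF i] a by (intro sum.cong) (auto simp: block_entry_def)
  finally show ?thesis using block_setD(2)[OF i a] by (simp add: bmat_apply)
qed

lemma bmat_apply_gspace:
  assumes "i \<le> k" "x \<in> gspace (offset r i)"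
  shows "gmat_apply (bmat U) x \<in> gspace (offset r i)"
  unfolding gspace_def
proof (clarsimp)
  fix a assume a: "offset r i \<le> a"
  have "block_entry (block_join U) a b * x b = 0" if "a < N" "b < N" for b
  proof (cases "b < offset r i")
    case True
    then have "\<beta> b < \<beta> a" using block_le_iff[OF that(1), of i] block_le_iff[OF that(2), of i] a by simp
    then show ?thesis by (simp add: block_entry_def)
  qed (use assms in \<open>simp add: gspace_def\<close>)
  then have "(\<Sum>b<N. block_entry (block_join U) a b * x b) = 0" if "a < N"
    using that by (intro sum.neutral) simp
  then show "gmat_apply (bmat U) x a = 0" by (simp add: bmat_apply)
qed

text \<open>Back substitution from the last block, using that the diagonal blocks are invertible.
  The case i = 0 is injectivity; general i shows that \<Phi> preserves each step of the
  filtration.\<close>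

lemma bmat_lower_injective:
  assumes i: "i \<le> k" and x: "x \<in> gspace N"
    and z: "\<And>a. offset r i \<le> a \<Longrightarrow> a < N \<Longrightarrow> gmat_apply (bmat U) x a = 0"
  shows "x \<in> gspace (offset r i)"
  using i
proof (induction rule: inc_induct)
  case base
  show ?case by (rule x)
next
  case (step m)
  have m: "Suc m \<in> {1..k}" using step.hyps by simp
  have sm: "offset r i \<le> offset r m" using step.hyps by (intro offset_mono)
  have "(\<Sum>b\<in>block_set r (Suc m). diag_entry a b * x b) = 0" if a: "a \<in> block_set r (Suc m)" for a
    using bmat_apply_diag[OF m a step.IH] z[of a] block_setD(2)[OF m a] a sm by (simp add: block_set_def)
  then have "x b = 0" if "b \<in> block_set r (Suc m)" for b
    using inverse_on_apply[OF inverse_on_sym[OF inverse_on_diag_entry[OF m]] finite_block_set that, of x] by simp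
  moreover have "x b = 0" if "offset r (Suc m) \<le> b" for b
    using step.IH that by (simp add: gspace_def)
  ultimately have "x b = 0" if "offset r m \<le> b" for b
    using that by (cases "b < offset r (Suc m)") (simp_all add: block_set_def)
  then show "x \<in> gspace (offset r m)" by (simp add: gspace_def)
qed

lemma bmat_injective: "x \<in> gspace N \<Longrightarrow> gmat_apply (bmat U) x = 0 \<Longrightarrow> x = 0"
  using bmat_lower_injective[of 0 x U] by (simp add: gvec_apply)

lemma phi_obj: "phi (obj U) = snd (matrix_module q (bmat U))"
  by (simp add: matrix_object_def)

lemma fil_obj [simp]: "fil (obj U) i = gspace (offset r i)"
  by (simp add: matrix_object_def)

lemma phi_obj_eq:
  assumes "x \<in> gspace N"
  shows "phi (obj U) x \<in> gspace N" "gmat_apply (bmat U) (phi (obj U) x) = gvec_sigma q x"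
  unfolding phi_obj using matrix_module_phi[OF q_nonzero bmat_carrier bmat_injective assms] by simp_all

lemma phi_obj_unique:
  assumes "x \<in> gspace N" "y \<in> gspace N" "gmat_apply (bmat U) y = gvec_sigma q x"
  shows "phi (obj U) x = y"
proof -
  have "phi (obj U) x - y \<in> gspace N"
    using phi_obj_eq(1)[OF assms(1)] assms(2) by (rule gv.subspace_diff[OF subspace_gspace])
  moreover have "gmat_apply (bmat U) (phi (obj U) x - y) = 0"
    using phi_obj_eq(2)[OF assms(1)] assms(3) by (simp add: gmat_apply_diff)
  ultimately have "phi (obj U) x - y = 0" by (rule bmat_injective)
  then show ?thesis by simp
qed

lemma gspace_offset_subset: "i \<le> k \<Longrightarrow> x \<in> gspace (offset r i) \<Longrightarrow> x \<in> gspace N"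
  using gspace_mono[OF offset_mono] by blast

lemma qdiff_module_obj:
  assumes i: "i \<le> k"
  shows "qdiff_module q (gspace (offset r i), phi (obj U))"
proof -
  have sub: "x \<in> gspace N" if "x \<in> gspace (offset r i)" for x
    using gspace_offset_subset[OF i that] .
  have "bij_betw (phi (obj U)) (gspace (offset r i)) (gspace (offset r i))"
  proof (rule bij_betw_imageI)
    show "inj_on (phi (obj U)) (gspace (offset r i))"
    proof (rule inj_onI)
      fix x y assume "x \<in> gspace (offset r i)" "y \<in> gspace (offset r i)" "phi (obj U) x = phi (obj U) y"
      then have "gvec_sigma q x = gvec_sigma q y" using phi_obj_eq(2)[OF sub] by metis
      then show "x = y" using gvec_sigma_inj[OF q_nonzero] by simp
    qed
    show "phi (obj U) ` gspace (offset r i) = gspace (offset r i)"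
    proof (intro equalityI subsetI)
      fix y assume "y \<in> phi (obj U) ` gspace (offset r i)"
      then obtain x where x: "x \<in> gspace (offset r i)" "y = phi (obj U) x" by auto
      have "gvec_sigma q x \<in> gspace (offset r i)" using x(1) by (simp add: gvec_sigma_gspace[OF q_nonzero])
      then show "y \<in> gspace (offset r i)"
        unfolding x(2) using phi_obj_eq(2)[OF sub[OF x(1)], of U]
        by (intro bmat_lower_injective[OF i phi_obj_eq(1)[OF sub[OF x(1)]], where U = U])
          (simp add: gspace_def)
    next
      fix y assume y: "y \<in> gspace (offset r i)"
      \<comment> \<open>The preimage of \<open>y\<close> is dictated by B y = \<sigma>_q(x);
        triangularity keeps it in the same step.\<close>
      obtain x where x: "gvec_sigma q x = gmat_apply (bmat U) y" using gvec_sigma_surj[OF q_nonzero] by blast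
      have "gvec_sigma q x \<in> gspace (offset r i)" unfolding x by (rule bmat_apply_gspace[OF i y])
      then have xi: "x \<in> gspace (offset r i)" by (simp only: gvec_sigma_gspace[OF q_nonzero])
      moreover have "phi (obj U) x = y"
        by (rule phi_obj_unique[OF sub[OF xi] sub[OF y] x[symmetric]])
      ultimately show "y \<in> phi (obj U) ` gspace (offset r i)" by (intro image_eqI[of _ _ x]) simp_all
    qed
  qed
  moreover have "phi (obj U) (x + y) = phi (obj U) x + phi (obj U) y"
    if x: "x \<in> gspace (offset r i)" and y: "y \<in> gspace (offset r i)" for x y
    using phi_obj_eq[OF sub[OF x], of U] phi_obj_eq[OF sub[OF y], of U] sub[OF x] sub[OF y]
    by (intro phi_obj_unique gv.subspace_add[OF subspace_gspace]) (simp_all add: gmat_apply_add gvec_sigma_add[OF q_nonzero])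
  moreover have "phi (obj U) (gscale c x) = gscale (germ_sigma q c) (phi (obj U) x)"
    if x: "x \<in> gspace (offset r i)" for x c
    using phi_obj_eq[OF sub[OF x], of U] sub[OF x]
    by (intro phi_obj_unique gv.subspace_scale[OF subspace_gspace])
      (simp_all add: gmat_apply_scale gvec_sigma_scale[OF q_nonzero])
  ultimately show ?thesis
    using gspace_finite_span by (simp add: qdiff_module_def)
qed

definition block_part :: "nat \<Rightarrow> gvec \<Rightarrow> gvec" where
  "block_part i x = (\<lambda>l. if l < r i then x (offset r (i - 1) + l) else 0)"

lemma block_part_in_gspace: "block_part i x \<in> gspace (r i)"
  by (simp add: block_part_def gspace_def)

text \<open>The choice of a representative in \<open>matrix_object\<close> is harmless: two
  representatives differ by a vector supported in the earlier blocks, and only coordinates of block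
  \<open>i\<close> are read.\<close>

lemma gr_iso_obj: "gr_iso (obj U) i (qcoset (gspace (offset r (i - 1))) x) = block_part i x"
proof
  fix l
  let ?C = "qcoset (gspace (offset r (i - 1))) x"
  have "x + 0 \<in> ?C" unfolding qcoset_def by (intro imageI gv.subspace_0 subspace_gspace)
  then have "(SOME y. y \<in> ?C) \<in> ?C" by (rule someI[of "\<lambda>y. y \<in> ?C"])
  then obtain n where "n \<in> gspace (offset r (i - 1))" "(SOME y. y \<in> ?C) = x + n"
    by (auto simp: qcoset_def)
  then show "gr_iso (obj U) i ?C l = block_part i x l"
    by (simp add: matrix_object_def block_part_def gspace_def gvec_apply)
qed

lemma graded_map_obj: "graded_map (obj U) i x = block_part i x"
  unfolding graded_map_def fil_obj by (rule gr_iso_obj)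

lemma zpow_apply:
  assumes "i \<in> {1..k}"
  shows "gmat_apply (zpow_mat (\<mu> i) (A i)) x l =
    (if l < r i then \<Sum>m<r i. germ_z powi \<mu> i * germ_const (A i $$ (l, m)) * x m else 0)"
  using A[OF assms] by (auto simp: gmat_apply_def zpow_mat_def intro!: sum.cong)

lemma zpow_injective:
  assumes i: "i \<in> {1..k}" and x: "x \<in> gspace (r i)"
    and z: "gmat_apply (zpow_mat (\<mu> i) (A i)) x = 0"
  shows "x = 0"
proof
  fix l
  have "(\<Sum>m<r i. germ_const (A i $$ (l, m)) * x m) = 0" if "l < r i" for l
  proof -
    have "germ_z powi \<mu> i * (\<Sum>m<r i. germ_const (A i $$ (l, m)) * x m) = 0"
      using fun_cong[OF z, of l] that zpow_apply[OF i, of x l]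
      by (simp add: gvec_apply sum_distrib_left mult.assoc)
    then show ?thesis by simp
  qed
  moreover have "inverse_on {..<r i} (\<lambda>a b. germ_const (A_inv i $$ (a, b))) (\<lambda>a b. germ_const (A i $$ (a, b)))"
    using inverse_on_A[OF i]
    by (auto simp: inverse_on_def simp flip: germ_const_sum germ_const_simps(4))
  ultimately show "x l = 0 l"
    using inverse_on_apply[of "{..<r i}" "\<lambda>a b. germ_const (A_inv i $$ (a, b))"
        "\<lambda>a b. germ_const (A i $$ (a, b))" l x] x
    by (cases "l < r i") (simp_all add: gvec_apply gspace_def)
qed

lemma P_space: "i \<in> {1..k} \<Longrightarrow> fst (P i) = gspace (r i)"
  using A[of i] by (auto simp: P pure_piece_def matrix_module_def zpow_mat_def dest: carrier_matD(1))

lemma P_phi: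
  assumes i: "i \<in> {1..k}" and x: "x \<in> gspace (r i)"
  shows "snd (P i) x \<in> gspace (r i)" "gmat_apply (zpow_mat (\<mu> i) (A i)) (snd (P i) x) = gvec_sigma q x"
proof -
  have "zpow_mat (\<mu> i) (A i) \<in> carrier_mat (r i) (r i)" using A[OF i] by (simp add: zpow_mat_def)
  from matrix_module_phi[OF q_nonzero this zpow_injective[OF i] x]
  show "snd (P i) x \<in> gspace (r i)" "gmat_apply (zpow_mat (\<mu> i) (A i)) (snd (P i) x) = gvec_sigma q x"
    by (simp_all add: P[OF i] pure_piece_def)
qed

lemma P_phi_unique:
  assumes i: "i \<in> {1..k}" and x: "x \<in> gspace (r i)" and y: "y \<in> gspace (r i)"
    and eq: "gmat_apply (zpow_mat (\<mu> i) (A i)) y = gvec_sigma q x"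
  shows "snd (P i) x = y"
proof -
  have "snd (P i) x - y \<in> gspace (r i)"
    using P_phi(1)[OF i x] y by (rule gv.subspace_diff[OF subspace_gspace])
  moreover have "gmat_apply (zpow_mat (\<mu> i) (A i)) (snd (P i) x - y) = 0"
    using P_phi(2)[OF i x] eq by (simp add: gmat_apply_diff)
  ultimately have "snd (P i) x - y = 0" by (rule zpow_injective[OF i])
  then show ?thesis by simp
qed

text \<open>Row block i meets only column blocks from i on, and \<open>x\<close> is supported in the
  first i blocks, so just the diagonal block contributes.\<close>

lemma block_part_bmat_apply:
  assumes i: "i \<in> {1..k}" and x: "x \<in> gspace (offset r i)"
  shows "block_part i (gmat_apply (bmat U) x) = gmat_apply (zpow_mat (\<mu> i) (A i)) (block_part i x)"
proof
  fix l
  have i1: "i \<ge> 1" using i by simp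
  have mem: "offset r (i - 1) + m \<in> block_set r i" if "m < r i" for m
    using that by (simp add: block_set_def offset_pred[OF i1])
  have D: "diag_entry (offset r (i - 1) + l) (offset r (i - 1) + m) = germ_z powi \<mu> i * germ_const (A i $$ (l, m))"
    if "l < r i" "m < r i" for l m
    using block_setD[OF i mem] that by (simp add: diag_entry_def const_diag_def)
  show "block_part i (gmat_apply (bmat U) x) l = gmat_apply (zpow_mat (\<mu> i) (A i)) (block_part i x) l"
    using bmat_apply_diag[OF i mem x, of l U]
    by (simp add: zpow_apply[OF i] block_part_def block_set_reindex[OF i1] D del: One_nat_def)
qed

lemma block_part_add: "block_part i (x + y) = block_part i x + block_part i y"
  by (auto simp: block_part_def gvec_apply)

lemma block_part_scale: "block_part i (gscale c x) = gscale c (block_part i x)"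
  by (auto simp: block_part_def gvec_apply)

lemma block_part_gvec_sigma: "block_part i (gvec_sigma q x) = gvec_sigma q (block_part i x)"
  using q_nonzero by (auto simp: block_part_def gvec_sigma_def)

lemma block_part_phi:
  assumes i: "i \<in> {1..k}" and x: "x \<in> gspace (offset r i)"
  shows "block_part i (phi (obj U) x) = snd (P i) (block_part i x)"
proof -
  have ik: "i \<le> k" using i by simp
  have "phi (obj U) x \<in> gspace (offset r i)"
    using qdiff_module_obj[OF ik, of U] x by (auto simp: qdiff_module_def bij_betw_def)
  then have "gmat_apply (zpow_mat (\<mu> i) (A i)) (block_part i (phi (obj U) x)) = gvec_sigma q (block_part i x)"
    using block_part_bmat_apply[OF i, of "phi (obj U) x" U] phi_obj_eq(2)[OF gspace_offset_subset[OF ik x], of U] block_part_gvec_sigma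
    by simp
  then show ?thesis by (intro P_phi_unique[OF i, symmetric] block_part_in_gspace)
qed

lemma block_part_eq_iff:
  assumes i: "i \<in> {1..k}" and x: "x \<in> gspace (offset r i)" and y: "y \<in> gspace (offset r i)"
  shows "block_part i x = block_part i y \<longleftrightarrow> x - y \<in> gspace (offset r (i - 1))"
proof
  assume eq: "block_part i x = block_part i y"
  have "x a = y a" if a: "offset r (i - 1) \<le> a" for a
  proof (cases "a < offset r i")
    case True
    then have "a - offset r (i - 1) < r i" using offset_pred[of i r] a i by simp
    then show ?thesis using fun_cong[OF eq, of "a - offset r (i - 1)"] a
      by (simp add: block_part_def del: One_nat_def)
  qed (use x y in \<open>simp add: gspace_def\<close>)
  then show "x - y \<in> gspace (offset r (i - 1))"
    by (simp add: gspace_def gvec_apply)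
qed (auto simp: block_part_def gspace_def gvec_apply)

lemma filtered_object_obj: "filtered_object q k P (obj U)"
proof -
  have "quotient_iso (gspace (offset r i), phi (obj U)) (gspace (offset r (i - 1))) (P i) (gr_iso (obj U) i)"
    if i: "i \<in> {1..k}" for i
  proof -
    have ik: "i \<le> k" and i1: "i \<ge> 1" using i by simp_all
    have "bij_betw (gr_iso (obj U) i) (qcoset (gspace (offset r (i - 1))) ` gspace (offset r i)) (gspace (r i))"
    proof (rule bij_betw_imageI)
      show "inj_on (gr_iso (obj U) i) (qcoset (gspace (offset r (i - 1))) ` gspace (offset r i))"
      proof (rule inj_onI, elim imageE, clarify)
        fix x y assume "x \<in> gspace (offset r i)" "y \<in> gspace (offset r i)"
          "gr_iso (obj U) i (qcoset (gspace (offset r (i - 1))) x) =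
           gr_iso (obj U) i (qcoset (gspace (offset r (i - 1))) y)"
        then show "qcoset (gspace (offset r (i - 1))) x = qcoset (gspace (offset r (i - 1))) y"
          by (simp only: gr_iso_obj block_part_eq_iff[OF i] qcoset_eq_iff[OF subspace_gspace])
      qed
      show "gr_iso (obj U) i ` qcoset (gspace (offset r (i - 1))) ` gspace (offset r i) = gspace (r i)"
      proof (intro equalityI subsetI)
        fix y assume "y \<in> gspace (r i)"
        define x where "x a = (if a \<in> block_set r i then y (a - offset r (i - 1)) else 0)" for a
        have "x \<in> gspace (offset r i)" by (simp add: x_def gspace_def block_set_def)
        moreover have "y = block_part i x"
          using \<open>y \<in> gspace (r i)\<close> i1 by (auto simp: block_part_def x_def block_set_def offset_pred gspace_def)
        ultimately show "y \<in> gr_iso (obj U) i ` qcoset (gspace (offset r (i - 1))) ` gspace (offset r i)"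
          by (intro image_eqI[of _ _ "qcoset (gspace (offset r (i - 1))) x"] imageI) (simp_all add: gr_iso_obj del: One_nat_def)
      qed (auto simp: gr_iso_obj block_part_in_gspace simp del: One_nat_def)
    qed
    then show ?thesis
      using P_space[OF i] block_part_phi[OF i]
      by (cases "P i") (simp add: quotient_iso_def gr_iso_obj block_part_add block_part_scale del: One_nat_def)
  qed
  then show ?thesis
    using qdiff_module_obj gspace_mono[OF offset_mono]
    by (simp add: filtered_object_def del: One_nat_def)
qed


section \<open>Filtered morphisms as gauge transformations\<close>

text \<open>The zeros below the block diagonal express that the filtration is respected, the
  identity diagonal blocks express compatibility with the isomorphisms of the graded pieces.\<close>

definition unipotent :: "(nat \<Rightarrow> nat \<Rightarrow> germ) \<Rightarrow> bool" where
  "unipotent F \<longleftrightarrow> (\<forall>a<N. \<forall>b<N. \<beta> b \<le> \<beta> a \<longrightarrow> F a b = of_bool (a = b))"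

text \<open>The matrix equation W F = \<sigma>_q(F) V. It says that multiplication by F intertwines
  the \<Phi> of V with that of W, written without inverse matrices.\<close>

definition gauge :: "(nat \<Rightarrow> nat \<Rightarrow> germ) \<Rightarrow> (nat \<Rightarrow> nat \<Rightarrow> germ) \<Rightarrow> (nat \<Rightarrow> nat \<Rightarrow> germ) \<Rightarrow> bool" where
  "gauge V W F \<longleftrightarrow> (\<forall>a<N. \<forall>b<N.
     (\<Sum>c<N. block_entry W a c * F c b) = (\<Sum>c<N. germ_sigma q (F a c) * block_entry V c b))"

lemma filtered_equiv_obj_of_gauge:
  assumes F: "unipotent F" and G: "gauge (block_join U) (block_join V) F"
  shows "(obj U, obj V) \<in> filtered_equiv q k P"
proof -
  define f :: "gvec \<Rightarrow> gvec" where "f x a = (if a < N then \<Sum>b<N. F a b * x b else 0)" for x a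
  have f_add: "f (x + y) = f x + f y" for x y
    by (rule ext) (simp add: f_def gvec_apply distrib_left sum.distrib)
  have f_scale: "f (gscale c x) = gscale c (f x)" for c x
    by (rule ext) (simp add: f_def gvec_apply sum_distrib_left mult.left_commute)
  have f_N: "f x \<in> gspace N" for x by (simp add: f_def gspace_def)
  \<comment> \<open>In a row of block i or later, a vector supported in the first i blocks meets F
    only where it is the identity. This yields both stability of the filtration and the identity on
    graded pieces.\<close>
  have f_block_part: "f x a = x a" if i: "i \<in> {1..k}" and a: "a < N" "i \<le> \<beta> a" and x: "x \<in> gspace (offset r i)" for i a x
  proof -
    have "F a b * x b = (if a = b then x b else 0)" if b: "b < N" for b
    proof (cases "b < offset r i")
      case True
      then have "\<beta> b \<le> \<beta> a" using block_le_iff[OF b, of i] a by simp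
      then show ?thesis using F a b by (simp add: unipotent_def)
    qed (use x in \<open>simp add: gspace_def\<close>)
    then have "(\<Sum>b<N. F a b * x b) = (\<Sum>b<N. if a = b then x b else 0)"
      by (intro sum.cong) simp_all
    then show ?thesis using a by (simp add: f_def)
  qed
  have f_gspace: "f x \<in> gspace (offset r i)" if i: "i \<le> k" and x: "x \<in> gspace (offset r i)" for i x
  proof (cases "i = 0")
    case True
    then show ?thesis using x by (auto simp: f_def gspace_def gvec_apply)
  next
    case False
    have "f x a = 0" if "offset r i \<le> a" for a
    proof (cases "a < N")
      case True
      then have "\<not> \<beta> a \<le> i" using block_le_iff[OF True, of i] that by simp
      then show ?thesis using f_block_part[of i a x] x False i True that by (simp add: gspace_def)
    qed (simp add: f_def)
    then show ?thesis by (simp add: gspace_def)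
  qed
  show ?thesis
  proof (rule filtered_equivI[OF filtered_object_obj filtered_object_obj])
    have "f (phi (obj U) x) = phi (obj V) (f x)" if x: "x \<in> gspace N" for x
    proof -
      define y where "y = phi (obj U) x"
      have y: "y \<in> gspace N" "gmat_apply (bmat U) y = gvec_sigma q x"
        using phi_obj_eq[OF x] by (simp_all add: y_def)
      have "gmat_apply (bmat V) (f y) = gvec_sigma q (f x)"
      proof
        fix a
        show "gmat_apply (bmat V) (f y) a = gvec_sigma q (f x) a"
        proof (cases "a < N")
          case True
          have "gmat_apply (bmat V) (f y) a = (\<Sum>c<N. block_entry (block_join V) a c * (\<Sum>b<N. F c b * y b))"
            using True by (simp add: bmat_apply f_def)
          also have "\<dots> = (\<Sum>b<N. (\<Sum>c<N. block_entry (block_join V) a c * F c b) * y b)"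
            by (simp add: sum_distrib_left sum_distrib_right mult.assoc) (rule sum.swap)
          also have "\<dots> = (\<Sum>b<N. (\<Sum>c<N. germ_sigma q (F a c) * block_entry (block_join U) c b) * y b)"
            using G True by (intro sum.cong) (simp_all add: gauge_def)
          also have "\<dots> = (\<Sum>c<N. germ_sigma q (F a c) * (\<Sum>b<N. block_entry (block_join U) c b * y b))"
            by (simp add: sum_distrib_left sum_distrib_right mult.assoc) (rule sum.swap)
          also have "\<dots> = (\<Sum>c<N. germ_sigma q (F a c) * gvec_sigma q x c)"
            unfolding y(2)[symmetric] by (intro sum.cong) (simp_all add: bmat_apply)
          also have "\<dots> = gvec_sigma q (f x) a"
            using True q_nonzero by (simp add: f_def gvec_sigma_def germ_sigma_sum germ_sigma_mult)
          finally show ?thesis .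
        next
          case False
          then show ?thesis using q_nonzero by (simp add: bmat_apply f_def gvec_sigma_def)
        qed
      qed
      then show ?thesis unfolding y_def[symmetric] by (rule phi_obj_unique[OF f_N f_N, symmetric])
    qed
    then show "qdiff_morphism (fil (obj U) k, phi (obj U)) (fil (obj V) k, phi (obj V)) f"
      using f_N by (auto simp: qdiff_morphism_def f_add f_scale)
    show "f ` fil (obj U) i \<subseteq> fil (obj V) i" if "i \<le> k" for i
      using f_gspace[OF that] by (simp add: image_subset_iff)
    show "graded_map (obj U) i x = graded_map (obj V) i (f x)" if i: "i \<in> {1..k}" and x: "x \<in> fil (obj U) i" for i x
    proof -
      have "f x (offset r (i - 1) + l) = x (offset r (i - 1) + l)" if "l < r i" for l
      proof -
        have "offset r (i - 1) + l \<in> block_set r i"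
          using i that by (simp add: block_set_def offset_pred del: One_nat_def)
        from block_setD[OF i this] show ?thesis using x by (intro f_block_part[OF i]) simp_all
      qed
      then show ?thesis by (auto simp: graded_map_obj block_part_def)
    qed
  qed
qed

text \<open>The columns of F are the images of the coordinate vectors.\<close>

lemma gauge_of_filtered_equiv_obj:
  assumes "(obj U, obj V) \<in> filtered_equiv q k P"
  obtains F where "unipotent F" "gauge (block_join U) (block_join V) F"
proof -
  from assms obtain f where f: "qdiff_morphism (fil (obj U) k, phi (obj U)) (fil (obj V) k, phi (obj V)) f"
    "\<forall>i\<le>k. f ` fil (obj U) i \<subseteq> fil (obj V) i"
    "\<forall>i\<in>{1..k}. \<forall>x\<in>fil (obj U) i. graded_map (obj U) i x = graded_map (obj V) i (f x)"
    by (rule filtered_equivE)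
  have f_add: "f (x + y) = f x + f y" "f (gscale c x) = gscale c (f x)" "f (phi (obj U) x) = phi (obj V) (f x)"
    if "x \<in> gspace N" "y \<in> gspace N" for x y c
    using f(1) that by (simp_all add: qdiff_morphism_def)
  have f_N: "f x \<in> gspace N" if "x \<in> gspace N" for x
    using f(1) that by (auto simp: qdiff_morphism_def)
  define F where "F a b = f (gunit b) a" for a b
  have f_apply: "f x a = (\<Sum>b<N. F a b * x b)" if x: "x \<in> gspace N" for x a
  proof -
    have "f (\<Sum>b<N. gscale (x b) (gunit b)) = (\<Sum>b<N. gscale (x b) (f (gunit b)))"
      using f_add(1) f_add(2)[OF _ gv.subspace_0[OF subspace_gspace]] gunit_in_gspace
      by (intro semilinear_sum[OF subspace_gspace, of N f "\<lambda>c. c"]) auto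
    then have "f x = (\<Sum>b<N. gscale (x b) (f (gunit b)))" using gspace_expand[OF x] by simp
    then show ?thesis by (simp add: sum_fun_apply gvec_apply F_def mult.commute)
  qed
  have uni: "F a b = of_bool (a = b)" if a: "a < N" and b: "b < N" and ba: "\<beta> b \<le> \<beta> a" for a b
  proof -
    define i where "i = \<beta> b"
    have i: "i \<in> {1..k}" using block_in(1)[OF b] by (simp add: i_def)
    have ub: "gunit b \<in> gspace (offset r i)"
      using block_le_iff[OF b, of i] by (intro gunit_in_gspace) (simp add: i_def)
    show ?thesis
    proof (cases "\<beta> a = i")
      case True
      have o: "offset r (i - 1) + \<rho> a = a" "\<rho> a < r i"
        using block_in(2)[OF a] \<rho>_less[OF a] True by (auto simp: \<rho>_def block_set_def)
      have "block_part i (gunit b) = block_part i (f (gunit b))"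
        using f(3) i ub by (simp add: graded_map_obj)
      from fun_cong[OF this, of "\<rho> a"] show ?thesis
        using o by (simp add: block_part_def F_def gunit_def del: One_nat_def)
    next
      case False
      then have "\<not> \<beta> a \<le> i" using ba by (simp add: i_def)
      then have "offset r i \<le> a" using block_le_iff[OF a, of i] by simp
      moreover have "f (gunit b) \<in> gspace (offset r i)" using f(2) i ub by (auto simp: image_subset_iff)
      moreover have "a \<noteq> b" using False i_def by auto
      ultimately show ?thesis by (simp add: F_def gspace_def)
    qed
  qed
  have "(\<Sum>c<N. block_entry (block_join V) a c * F c b) = (\<Sum>c<N. germ_sigma q (F a c) * block_entry (block_join U) c b)"
    if a: "a < N" and b: "b < N" for a b
  proof -
    have ub: "gunit b \<in> gspace N" by (rule gunit_in_gspace[OF b])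
    have col: "gmat_apply (bmat W) (gunit b) c = block_entry (block_join W) c b" if "c < N" for W c
    proof -
      have "(\<Sum>d<N. block_entry (block_join W) c d * gunit b d) = (\<Sum>d<N. if d = b then block_entry (block_join W) c d else 0)"
        by (intro sum.cong) (simp_all add: gunit_def)
      then show ?thesis using that b by (simp add: bmat_apply)
    qed
    \<comment> \<open>\<open>x\<close> is chosen so that \<Phi>(x) is the coordinate vector
      \<open>gunit b\<close>; compatibility of f with \<Phi> at this \<open>x\<close> is column b of
      the gauge equation.\<close>
    obtain x where x: "gvec_sigma q x = gmat_apply (bmat U) (gunit b)" using gvec_sigma_surj[OF q_nonzero] by blast
    have "gvec_sigma q x \<in> gspace N" unfolding x by (rule bmat_apply_gspace[OF order_refl ub])
    then have xN: "x \<in> gspace N" by (simp only: gvec_sigma_gspace[OF q_nonzero])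
    have "phi (obj U) x = gunit b" by (rule phi_obj_unique[OF xN ub x[symmetric]])
    then have "f (gunit b) = phi (obj V) (f x)" using f_add(3)[OF xN xN] by simp
    then have "gmat_apply (bmat V) (f (gunit b)) = gvec_sigma q (f x)"
      using phi_obj_eq(2)[OF f_N[OF xN], of V] by simp
    from fun_cong[OF this, of a]
    have "(\<Sum>c<N. block_entry (block_join V) a c * F c b) = germ_sigma q (\<Sum>c<N. F a c * x c)"
      using a by (simp add: bmat_apply F_def gvec_sigma_def f_apply[OF xN])
    also have "\<dots> = (\<Sum>c<N. germ_sigma q (F a c) * gvec_sigma q x c)"
      using q_nonzero by (simp add: germ_sigma_sum germ_sigma_mult gvec_sigma_def)
    also have "\<dots> = (\<Sum>c<N. germ_sigma q (F a c) * block_entry (block_join U) c b)"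
      unfolding x by (intro sum.cong) (simp_all add: col)
    finally show ?thesis .
  qed
  then show ?thesis by (intro that[of F]) (simp_all add: unipotent_def gauge_def uni)
qed

text \<open>
  For an adapted basis \<open>e\<close>, the columns of the matrix are the coordinates of the \<open>e\<^sub>b\<close> in the basis
  \<open>\<Phi>(e\<^sub>a)\<close>, because \<open>\<Phi>\<^sub>A(X) = A\<^sup>-\<^sup>1 \<sigma>\<^sub>q(X)\<close> involves the inverse.
\<close>

lemma filtered_object_matrix:
  assumes M: "filtered_object q k P M"
  obtains W where "(obj (block_split W), M) \<in> filtered_equiv q k P"
proof -
  \<comment> \<open>The adapted basis lifts the standard bases of the graded pieces.\<close>
  have "\<exists>e. e \<in> fil M (\<beta> a) \<and> graded_map M (\<beta> a) e = gunit (\<rho> a)" if a: "a < N" for a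
  proof -
    have "gunit (\<rho> a) \<in> graded_map M (\<beta> a) ` fil M (\<beta> a)"
      unfolding graded_map_image[OF M block_in(1)[OF a]] P_space[OF block_in(1)[OF a]]
      by (rule gunit_in_gspace[OF \<rho>_less[OF a]])
    then obtain e where "gunit (\<rho> a) = graded_map M (\<beta> a) e" "e \<in> fil M (\<beta> a)" by (rule imageE)
    then show ?thesis by (intro exI[of _ e]) simp
  qed
  then have "\<forall>a\<in>{..<N}. \<exists>e. e \<in> fil M (\<beta> a) \<and> graded_map M (\<beta> a) e = gunit (\<rho> a)" by simp
  then obtain e where "\<forall>a\<in>{..<N}. e a \<in> fil M (\<beta> a) \<and> graded_map M (\<beta> a) (e a) = gunit (\<rho> a)"
    by (rule bchoice[THEN exE])
  then have e: "e a \<in> fil M (\<beta> a)" "graded_map M (\<beta> a) (e a) = gunit (\<rho> a)" if "a < N" for a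
    using that by simp_all
  have e_fil: "e a \<in> fil M i" if "i \<le> k" "a < offset r i" for a i
  proof -
    have a: "a < N" using that offset_mono[of i k r] by simp
    have "\<beta> a \<le> i" using block_le_iff[OF a, of i] that by simp
    then show ?thesis using fil_mono[OF M _ that(1), of "\<beta> a"] e(1)[OF a] by blast
  qed
  define lin_comb :: "gvec \<Rightarrow> gvec" where "lin_comb y = (\<Sum>a<N. gscale (y a) (e a))" for y
  have lin_comb_restrict: "lin_comb y = (\<Sum>a<offset r i. gscale (y a) (e a))"
    if i: "i \<le> k" and y: "y \<in> gspace (offset r i)" for i y
    unfolding lin_comb_def using offset_mono[OF i, of r] y
    by (intro sum.mono_neutral_right) (auto simp: gspace_def gv.scale_zero_left)
  have lin_comb_fil: "lin_comb y \<in> fil M i" if i: "i \<le> k" and y: "y \<in> gspace (offset r i)" for i y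
    unfolding lin_comb_restrict[OF i y] using e_fil[OF i] by (intro fil_sum[OF M i]) simp
  have lin_comb_graded: "graded_map M i (lin_comb y) = block_part i y" if i: "i \<in> {1..k}" and y: "y \<in> gspace (offset r i)" for i y
  proof -
    have ik: "i \<le> k" and i1: "i \<ge> 1" using i by simp_all
    have g: "graded_map M i (e a) = (if a \<in> block_set r i then gunit (a - offset r (i - 1)) else 0)"
      if a: "a < offset r i" for a
    proof (cases "a \<in> block_set r i")
      case True
      then show ?thesis using e(2)[of a] block_setD[OF i True] by simp
    next
      case False
      have z: "0 \<in> fil M i" by (rule gv.subspace_0[OF fil_subspace[OF M ik]])
      have z': "graded_map M i 0 = 0" using graded_map_add[OF M i z z] by simp
      have "a < offset r (i - 1)" using False a by (simp add: block_set_def)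
      then have "e a - 0 \<in> fil M (i - 1)" using e_fil[of "i - 1" a] ik by simp
      then show ?thesis
        using graded_map_eq_iff[OF M i e_fil[OF ik a] z] z' False by simp
    qed
    have "graded_map M i (lin_comb y) = (\<Sum>a<offset r i. gscale (y a) (graded_map M i (e a)))"
      unfolding lin_comb_restrict[OF ik y] using e_fil[OF ik] by (intro graded_map_sum[OF M i]) simp
    also have "\<dots> = (\<Sum>a\<in>block_set r i. gscale (y a) (gunit (a - offset r (i - 1))))"
      by (rule sum.mono_neutral_cong_right) (auto simp: g block_set_def gv.scale_zero_right simp del: One_nat_def)
    also have "\<dots> = (\<Sum>l<r i. gscale (block_part i y l) (gunit l))"
      unfolding block_set_reindex[OF i1] by (intro sum.cong) (simp_all add: block_part_def)
    also have "\<dots> = block_part i y" by (rule gspace_expand[OF block_part_in_gspace, symmetric])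
    finally show ?thesis .
  qed
  have lin_comb_add: "lin_comb (x + y) = lin_comb x + lin_comb y" for x y
    by (simp add: lin_comb_def gvec_apply gv.scale_left_distrib sum.distrib)
  have lin_comb_scale: "lin_comb (gscale c x) = gscale c (lin_comb x)" for c x
    by (simp add: lin_comb_def gvec_apply gv.scale_sum_right)
  \<comment> \<open>Induction along the filtration: the graded part of \<open>x\<close> prescribes
    the coordinates in the last block, and the difference lies one step lower.\<close>
  have lin_comb_surj: "\<exists>y\<in>gspace (offset r i). x = lin_comb y" if "i \<le> k" "x \<in> fil M i" for i x
    using that
  proof (induction i arbitrary: x)
    case 0
    have "x = lin_comb 0" using fil_0[OF M] 0 by (simp add: lin_comb_def gvec_apply)
    then show "\<exists>y\<in>gspace (offset r 0). x = lin_comb y" by (intro bexI[of _ 0]) simp_all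
  next
    case (Suc i)
    have i: "Suc i \<in> {1..k}" and ik: "i \<le> k" using Suc.prems(1) by simp_all
    define v where "v = graded_map M (Suc i) x"
    have "v \<in> gspace (r (Suc i))"
      unfolding v_def P_space[OF i, symmetric] graded_map_image[OF M i, symmetric]
      by (rule imageI[OF Suc.prems(2)])
    define y where "y a = (if a \<in> block_set r (Suc i) then v (a - offset r i) else 0)" for a
    have y: "y \<in> gspace (offset r (Suc i))" by (simp add: y_def gspace_def block_set_def)
    have "block_part (Suc i) y = v"
      using \<open>v \<in> gspace (r (Suc i))\<close> by (auto simp: block_part_def y_def block_set_def offset_Suc gspace_def)
    then have "graded_map M (Suc i) x = graded_map M (Suc i) (lin_comb y)"
      using lin_comb_graded[OF i y] by (simp add: v_def)
    then have "x - lin_comb y \<in> fil M i"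
      using graded_map_eq_iff[OF M i Suc.prems(2) lin_comb_fil[OF Suc.prems(1) y]] by simp
    from Suc.IH[OF ik this] obtain y' where y': "y' \<in> gspace (offset r i)" "x - lin_comb y = lin_comb y'"
      by (rule bexE)
    have "y' \<in> gspace (offset r (Suc i))" using y'(1) by (simp add: gspace_def offset_Suc)
    then have "y + y' \<in> gspace (offset r (Suc i))"
      by (rule gv.subspace_add[OF subspace_gspace y])
    moreover have "x = lin_comb (y + y')" using y'(2) by (simp add: lin_comb_add algebra_simps)
    ultimately show "\<exists>y\<in>gspace (offset r (Suc i)). x = lin_comb y" by (intro bexI[of _ "y + y'"])
  qed
  have "\<exists>y. y \<in> gspace (offset r (\<beta> b)) \<and> phi M (lin_comb y) = e b" if b: "b < N" for b
  proof -
    have i: "\<beta> b \<le> k" using block_in(1)[OF b] by simp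
    have "e b \<in> phi M ` fil M (\<beta> b)"
      using fil_phi_bij[OF M i] e(1)[OF b] by (simp add: bij_betw_def)
    then obtain w where w: "e b = phi M w" "w \<in> fil M (\<beta> b)" by (rule imageE)
    from lin_comb_surj[OF i w(2)] obtain y where "y \<in> gspace (offset r (\<beta> b))" "w = lin_comb y" by (rule bexE)
    then show ?thesis using w(1) by (intro exI[of _ y]) simp
  qed
  then have "\<forall>b\<in>{..<N}. \<exists>y. y \<in> gspace (offset r (\<beta> b)) \<and> phi M (lin_comb y) = e b" by simp
  then obtain Y where "\<forall>b\<in>{..<N}. Y b \<in> gspace (offset r (\<beta> b)) \<and> phi M (lin_comb (Y b)) = e b"
    by (rule bchoice[THEN exE])
  then have Y: "Y b \<in> gspace (offset r (\<beta> b))" "phi M (lin_comb (Y b)) = e b" if "b < N" for b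
    using that by simp_all
  \<comment> \<open>Expanding e_b = \<Phi>(\<Sum>_a Y_b(a) e_a) by semilinearity gives
    \<sigma>_q(Y_b(a)) as coordinate of e_b along \<Phi>(e_a).\<close>
  define W where "W a b = germ_sigma q (Y b a)" for a b
  have phi_lin_comb: "phi M (lin_comb x) = (\<Sum>a<N. gscale (germ_sigma q (x a)) (phi M (e a)))" for x
    unfolding lin_comb_def using e_fil[OF order_refl] by (intro fil_phi_sum[OF M order_refl]) simp
  have bmW: "block_entry (block_join (block_split W)) a b = W a b" if a: "a < N" and b: "b < N" for a b
  proof -
    have i: "\<beta> b \<in> {1..k}" by (rule block_in(1)[OF b])
    have ik: "\<beta> b \<le> k" using i by simp
    consider "\<beta> a < \<beta> b" | "\<beta> b < \<beta> a" | "\<beta> a = \<beta> b" by linarith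
    then show ?thesis
    proof cases
      case 1
      then show ?thesis by (simp add: block_entry_def block_join_split[OF a b])
    next
      case 2
      then have "\<not> a < offset r (\<beta> b)" using block_le_iff[OF a, of "\<beta> b"] by simp
      then have "Y b a = 0" using Y(1)[OF b] by (simp add: gspace_def)
      then show ?thesis using 2 q_nonzero by (simp add: block_entry_def W_def)
    next
      case 3
      \<comment> \<open>The relation defining \<open>Y b\<close>, read in the graded piece, forces
        the diagonal block to be the matrix of \<open>P (\<beta> b)\<close>.\<close>
      have "gunit (\<rho> b) = snd (P (\<beta> b)) (block_part (\<beta> b) (Y b))"
        using graded_map_phi[OF M i lin_comb_fil[OF ik Y(1)[OF b]]] Y(2)[OF b] e(2)[OF b] lin_comb_graded[OF i Y(1)[OF b]]
        by simp
      then have "gmat_apply (zpow_mat (\<mu> (\<beta> b)) (A (\<beta> b))) (gunit (\<rho> b)) = gvec_sigma q (block_part (\<beta> b) (Y b))"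
        using P_phi(2)[OF i block_part_in_gspace] by simp
      moreover have o: "offset r (\<beta> b - 1) + \<rho> a = a" "\<rho> a < r (\<beta> b)"
        using block_in(2)[OF a] \<rho>_less[OF a] 3 by (auto simp: \<rho>_def block_set_def)
      moreover have "(\<Sum>m<r (\<beta> b). germ_z powi \<mu> (\<beta> b) * germ_const (A (\<beta> b) $$ (\<rho> a, m)) * gunit (\<rho> b) m) =
          (\<Sum>m<r (\<beta> b). if m = \<rho> b then germ_z powi \<mu> (\<beta> b) * germ_const (A (\<beta> b) $$ (\<rho> a, m)) else 0)"
        by (intro sum.cong) (simp_all add: gunit_def)
      then have "gmat_apply (zpow_mat (\<mu> (\<beta> b)) (A (\<beta> b))) (gunit (\<rho> b)) (\<rho> a) = diag_entry a b"
        using o(2) \<rho>_less[OF b] 3 by (simp add: zpow_apply[OF i] diag_entry_def const_diag_def)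
      ultimately have "diag_entry a b = gvec_sigma q (block_part (\<beta> b) (Y b)) (\<rho> a)" by simp
      also have "\<dots> = W a b" using o by (simp add: gvec_sigma_def block_part_def W_def del: One_nat_def)
      finally show ?thesis using 3 by (simp add: block_entry_def)
    qed
  qed
  show ?thesis
  proof (rule that[of W], rule filtered_equivI[OF filtered_object_obj M])
    have "lin_comb (phi (obj (block_split W)) x) = phi M (lin_comb x)" if x: "x \<in> gspace N" for x
    proof -
      define y where "y = phi (obj (block_split W)) x"
      have y: "gmat_apply (bmat (block_split W)) y = gvec_sigma q x"
        using phi_obj_eq(2)[OF x] by (simp add: y_def)
      have sx: "germ_sigma q (x a) = (\<Sum>b<N. W a b * y b)" if a: "a < N" for a
      proof -
        have "gvec_sigma q x a = (\<Sum>b<N. W a b * y b)"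
          unfolding y[symmetric] using a by (simp add: bmat_apply bmW)
        then show ?thesis by (simp add: gvec_sigma_def)
      qed
      have eb: "e b = (\<Sum>a<N. gscale (W a b) (phi M (e a)))" if "b < N" for b
        using Y(2)[OF that] by (simp add: phi_lin_comb W_def)
      have "phi M (lin_comb x) = (\<Sum>a<N. gscale (\<Sum>b<N. W a b * y b) (phi M (e a)))"
        unfolding phi_lin_comb by (intro sum.cong) (simp_all add: sx)
      also have "\<dots> = (\<Sum>a<N. \<Sum>b<N. gscale (y b) (gscale (W a b) (phi M (e a))))"
        by (simp add: gv.scale_sum_left gv.scale_scale mult.commute)
      also have "\<dots> = (\<Sum>b<N. gscale (y b) (\<Sum>a<N. gscale (W a b) (phi M (e a))))"
        unfolding gv.scale_sum_right by (rule sum.swap)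
      also have "\<dots> = lin_comb y" unfolding lin_comb_def by (intro sum.cong) (simp_all add: eb[symmetric])
      finally show ?thesis by (simp add: y_def)
    qed
    then show "qdiff_morphism (fil (obj (block_split W)) k, phi (obj (block_split W))) (fil M k, phi M) lin_comb"
      using lin_comb_fil[OF order_refl] by (auto simp: qdiff_morphism_def lin_comb_add lin_comb_scale)
    show "lin_comb ` fil (obj (block_split W)) i \<subseteq> fil M i" if "i \<le> k" for i
      using lin_comb_fil[OF that] by (simp add: image_subset_iff)
    show "graded_map (obj (block_split W)) i x = graded_map M i (lin_comb x)"
      if "i \<in> {1..k}" "x \<in> fil (obj (block_split W)) i" for i x
      using lin_comb_graded[OF that(1)] that(2) by (simp add: graded_map_obj)
  qed
qed

end


section \<open>Polynomial families\<close>

text \<open>\<open>polynomial_fun\<close> allows each exponent once, whereas sums and products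
  produce repeated ones; coefficients are collected along the fibres of \<open>e\<close>.\<close>

lemma polynomial_fun_monomials:
  assumes add: "\<And>a x y. scl a (x + y) = scl a x + scl a (y :: 'b :: comm_monoid_add)"
    and zero: "\<And>a. scl a 0 = 0"
    and I: "finite I" and f: "\<And>t. f t = (\<Sum>i\<in>I. scl (\<Prod>j<m. t j ^ e i j) (c i))"
  shows "polynomial_fun m scl f"
proof -
  have scl_sum: "scl a (sum g J) = (\<Sum>i\<in>J. scl a (g i))" for a g and J :: "'c set"
    by (induction J rule: infinite_finite_induct) (simp_all add: add zero)
  define c' where "c' \<alpha> = (\<Sum>i\<in>{i \<in> I. e i = \<alpha>}. c i)" for \<alpha>
  have "f t = (\<Sum>\<alpha>\<in>e ` I. scl (\<Prod>j<m. t j ^ \<alpha> j) (c' \<alpha>))" for t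
  proof -
    have "f t = (\<Sum>\<alpha>\<in>e ` I. \<Sum>i\<in>{i \<in> I. e i = \<alpha>}. scl (\<Prod>j<m. t j ^ e i j) (c i))"
      unfolding f by (rule sum.image_gen[OF I])
    also have "\<dots> = (\<Sum>\<alpha>\<in>e ` I. scl (\<Prod>j<m. t j ^ \<alpha> j) (c' \<alpha>))"
      unfolding c'_def scl_sum by (intro sum.cong) simp_all
    finally show ?thesis .
  qed
  then show ?thesis
    unfolding polynomial_fun_def using I by (intro exI[of _ "e ` I"] exI[of _ c']) simp
qed

abbreviation gpoly :: "nat \<Rightarrow> ((nat \<Rightarrow> complex) \<Rightarrow> germ) \<Rightarrow> bool" where
  "gpoly m \<equiv> polynomial_fun m (\<lambda>c x. germ_const c * x)"

lemmas gpoly_monomials = polynomial_fun_monomials[where scl = "\<lambda>c x. germ_const c * x",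
  OF distrib_left mult_zero_right]

lemma gpolyE:
  assumes "gpoly m f"
  obtains S c where "finite S" "\<forall>t. f t = (\<Sum>\<alpha>\<in>S. germ_const (\<Prod>i<m. t i ^ \<alpha> i) * c \<alpha>)"
  using assms unfolding polynomial_fun_def by (elim exE conjE)

lemma gpoly_familyE:
  assumes "\<And>p. p \<in> I \<Longrightarrow> gpoly m (f p)"
  obtains S c where "\<forall>p\<in>I. finite (S p)"
    "\<forall>p\<in>I. \<forall>t. f p t = (\<Sum>\<alpha>\<in>S p. germ_const (\<Prod>i<m. t i ^ \<alpha> i) * c p \<alpha>)"
proof -
  have "\<forall>p\<in>I. \<exists>S c. finite S \<and> (\<forall>t. f p t = (\<Sum>\<alpha>\<in>S. germ_const (\<Prod>i<m. t i ^ \<alpha> i) * c \<alpha>))"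
    using assms unfolding polynomial_fun_def by (intro ballI)
  then obtain S where
    "\<forall>p\<in>I. \<exists>c. finite (S p) \<and> (\<forall>t. f p t = (\<Sum>\<alpha>\<in>S p. germ_const (\<Prod>i<m. t i ^ \<alpha> i) * c \<alpha>))"
    by (rule bchoice[THEN exE])
  then obtain c where
    "\<forall>p\<in>I. finite (S p) \<and> (\<forall>t. f p t = (\<Sum>\<alpha>\<in>S p. germ_const (\<Prod>i<m. t i ^ \<alpha> i) * c p \<alpha>))"
    by (rule bchoice[THEN exE])
  then show ?thesis by (intro that[of S c]) simp_all
qed

lemma gpoly_const [intro, simp]: "gpoly m (\<lambda>t. x)"
  by (rule gpoly_monomials[where I = "{0 :: nat}" and e = "\<lambda>_ _. 0" and c = "\<lambda>_. x"]) simp_all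

lemma gpoly_var: "l < m \<Longrightarrow> gpoly m (\<lambda>t. germ_const (t l))"
proof (rule gpoly_monomials[where I = "{0 :: nat}" and e = "\<lambda>_ i. of_bool (i = l)" and c = "\<lambda>_. 1"])
  fix t :: "nat \<Rightarrow> complex" assume l: "l < m"
  have "(\<Prod>i<m. t i ^ of_bool (i = l)) = (\<Prod>i<m. if i = l then t i else 1)"
    by (intro prod.cong) simp_all
  then show "germ_const (t l) = (\<Sum>i\<in>{0::nat}. germ_const (\<Prod>i<m. t i ^ of_bool (i = l)) * 1)"
    using l by simp
qed simp

lemma gpoly_sum:
  assumes "\<And>i. i \<in> I \<Longrightarrow> gpoly m (f i)"
  shows "gpoly m (\<lambda>t. \<Sum>i\<in>I. f i t)"
proof (cases "finite I")
  case True
  obtain S c where "\<forall>i\<in>I. finite (S i)"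
    "\<forall>i\<in>I. \<forall>t. f i t = (\<Sum>\<alpha>\<in>S i. germ_const (\<Prod>j<m. t j ^ \<alpha> j) * c i \<alpha>)"
    by (rule gpoly_familyE[OF assms])
  then have Sc: "\<And>i. i \<in> I \<Longrightarrow> finite (S i)"
    "\<And>i t. i \<in> I \<Longrightarrow> f i t = (\<Sum>\<alpha>\<in>S i. germ_const (\<Prod>j<m. t j ^ \<alpha> j) * c i \<alpha>)"
    by simp_all
  show ?thesis
  proof (rule gpoly_monomials[where I = "Sigma I S" and e = "snd" and c = "\<lambda>(i, \<alpha>). c i \<alpha>"])
    show "finite (Sigma I S)" using True Sc(1) by auto
    fix t
    have "(\<Sum>i\<in>I. f i t) = (\<Sum>i\<in>I. \<Sum>\<alpha>\<in>S i. germ_const (\<Prod>j<m. t j ^ \<alpha> j) * c i \<alpha>)"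
      by (intro sum.cong Sc(2)) simp_all
    also have "\<dots> = (\<Sum>(i, \<alpha>)\<in>Sigma I S. germ_const (\<Prod>j<m. t j ^ \<alpha> j) * c i \<alpha>)"
      using True Sc(1) by (intro sum.Sigma) auto
    finally show "(\<Sum>i\<in>I. f i t) = (\<Sum>p\<in>Sigma I S.
        germ_const (\<Prod>j<m. t j ^ snd p j) * (case p of (i, \<alpha>) \<Rightarrow> c i \<alpha>))"
      by (simp add: case_prod_beta)
  qed
qed simp

lemma gpoly_mult:
  assumes "gpoly m f" "gpoly m g"
  shows "gpoly m (\<lambda>t. f t * g t)"
proof -
  obtain S c where 1: "finite S" "\<forall>t. f t = (\<Sum>\<alpha>\<in>S. germ_const (\<Prod>i<m. t i ^ \<alpha> i) * c \<alpha>)"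
    by (rule gpolyE[OF assms(1)])
  obtain S' c' where 2: "finite S'" "\<forall>t. g t = (\<Sum>\<alpha>\<in>S'. germ_const (\<Prod>i<m. t i ^ \<alpha> i) * c' \<alpha>)"
    by (rule gpolyE[OF assms(2)])
  show ?thesis
  proof (rule gpoly_monomials[where I = "S \<times> S'" and e = "\<lambda>p i. fst p i + snd p i"
        and c = "\<lambda>p. c (fst p) * c' (snd p)"])
    fix t
    show "f t * g t = (\<Sum>p\<in>S \<times> S'. germ_const (\<Prod>j<m. t j ^ (fst p j + snd p j)) * (c (fst p) * c' (snd p)))"
      unfolding 1(2)[rule_format] 2(2)[rule_format] sum_product sum.cartesian_product
      by (intro sum.cong) (auto simp: power_add prod.distrib mult_ac)
  qed (use 1 2 in simp)
qed

lemma polynomial_fun_linear: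
  fixes T :: "germ \<Rightarrow> 'b :: comm_monoid_add"
  assumes f: "gpoly m f"
    and scl: "\<And>a x y. scl a (x + y) = scl a x + scl a y" "\<And>a. scl a 0 = 0"
    and T: "\<And>x y. T (x + y) = T x + T y" "T 0 = 0" "\<And>a x. T (germ_const a * x) = scl a (T x)"
  shows "polynomial_fun m scl (\<lambda>t. T (f t))"
proof -
  obtain S c where 1: "finite S" "\<forall>t. f t = (\<Sum>\<alpha>\<in>S. germ_const (\<Prod>i<m. t i ^ \<alpha> i) * c \<alpha>)"
    by (rule gpolyE[OF f])
  have "T (sum g J) = (\<Sum>i\<in>J. T (g i))" for g and J :: "(nat \<Rightarrow> nat) set"
    by (induction J rule: infinite_finite_induct) (simp_all add: T)
  then have "T (f t) = (\<Sum>\<alpha>\<in>S. scl (\<Prod>i<m. t i ^ \<alpha> i) (T (c \<alpha>)))" for t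
    by (simp add: 1 T)
  then show ?thesis
    unfolding polynomial_fun_def using 1(1) by (intro exI[of _ S] exI[of _ "\<lambda>\<alpha>. T (c \<alpha>)"]) simp
qed

lemma gpoly_linear:
  "gpoly m f \<Longrightarrow> (\<And>x y. T (x + y) = T x + T y) \<Longrightarrow> T 0 = 0 \<Longrightarrow>
    (\<And>a x. T (germ_const a * x) = germ_const a * T x) \<Longrightarrow> gpoly m (\<lambda>t. T (f t))"
  by (rule polynomial_fun_linear) (simp_all add: distrib_left)

lemma gpoly_sigma: "q \<noteq> 0 \<Longrightarrow> gpoly m f \<Longrightarrow> gpoly m (\<lambda>t. germ_sigma q (f t))"
  by (rule gpoly_linear) (simp_all add: germ_sigma_mult)

lemma gpoly_add: "gpoly m f \<Longrightarrow> gpoly m g \<Longrightarrow> gpoly m (\<lambda>t. f t + g t)"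
  using gpoly_sum[of "{True, False}" m "\<lambda>b. if b then f else g"] by simp

lemma gpoly_diff: "gpoly m f \<Longrightarrow> gpoly m g \<Longrightarrow> gpoly m (\<lambda>t. f t - g t)"
  using gpoly_add[OF _ gpoly_linear[of m g uminus]] by simp

lemma germ_window_sum:
  "(\<And>i. i \<in> I \<Longrightarrow> germ_window m m' (f i)) \<Longrightarrow> germ_window m m' (\<Sum>i\<in>I. f i)"
  by (simp add: germ_window_def)

lemma germ_window_scale: "germ_window m m' x \<Longrightarrow> germ_window m m' (germ_const a * x)"
  by (simp add: germ_window_def)

lemma germ_window_diff: "germ_window m m' x \<Longrightarrow> germ_window m m' y \<Longrightarrow> germ_window m m' (x - y)"
  by (simp add: germ_window_def)

context slope_data
begin

section \<open>The equation of one block, in families\<close>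

definition block_op :: "nat \<Rightarrow> nat \<Rightarrow> (nat \<Rightarrow> nat \<Rightarrow> germ) \<Rightarrow> nat \<Rightarrow> nat \<Rightarrow> germ" where
  "block_op i j F a b = (\<Sum>c\<in>block_set r j. germ_sigma q (F a c) * diag_entry c b) -
     (\<Sum>c\<in>block_set r i. diag_entry a c * F c b)"

text \<open>With blocks viewed as vectors indexed by pairs, F \<mapsto> A_i F has the Kronecker
  product of A_i with the identity as matrix, and F \<mapsto> F A_j that of the identity with the
  transpose of A_j; hence the swapped arguments in \<open>right_mult\<close>.\<close>

definition left_mult :: "nat \<times> nat \<Rightarrow> nat \<times> nat \<Rightarrow> complex" where
  "left_mult x y = of_bool (snd x = snd y) * const_diag (fst x) (fst y)"

definition right_mult :: "nat \<times> nat \<Rightarrow> nat \<times> nat \<Rightarrow> complex" where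
  "right_mult x y = of_bool (fst x = fst y) * const_diag (snd y) (snd x)"

lemma sum_of_bool_fst:
  fixes f :: "nat \<times> nat \<Rightarrow> 'z :: comm_ring_1"
  assumes "finite I" "a \<in> I"
  shows "(\<Sum>y\<in>I \<times> J. of_bool (a = fst y) * f y) = (\<Sum>b\<in>J. f (a, b))"
proof -
  have "(\<Sum>y\<in>I \<times> J. of_bool (a = fst y) * f y) = (\<Sum>x\<in>I. if a = x then \<Sum>b\<in>J. f (x, b) else 0)"
    unfolding sum.cartesian_product' by (intro sum.cong) auto
  then show ?thesis using assms by simp
qed

lemma sum_of_bool_snd:
  fixes f :: "nat \<times> nat \<Rightarrow> 'z :: comm_ring_1"
  assumes "finite J" "b \<in> J"
  shows "(\<Sum>y\<in>I \<times> J. of_bool (b = snd y) * f y) = (\<Sum>a\<in>I. f (a, b))"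
proof -
  have "(\<Sum>x\<in>J. of_bool (b = x) * f (a, x)) = (\<Sum>x\<in>J. if b = x then f (a, x) else 0)" for a
    by (intro sum.cong) auto
  then show ?thesis unfolding sum.cartesian_product' using assms by simp
qed

lemma inverse_on_left_mult:
  assumes i: "i \<in> {1..k}" and J: "finite J"
  shows "inverse_on (block_set r i \<times> J) left_mult (\<lambda>x y. of_bool (snd x = snd y) * const_diag_inv (fst x) (fst y))"
  unfolding inverse_on_def
proof (intro ballI)
  fix x z assume x: "x \<in> block_set r i \<times> J" and z: "z \<in> block_set r i \<times> J"
  have e: "(\<Sum>y\<in>block_set r i \<times> J. of_bool (snd x = snd y) * g (fst x) (fst y) * (of_bool (snd y = snd z) * h (fst y) (fst z)))
      = of_bool (snd x = snd z) * (\<Sum>a\<in>block_set r i. g (fst x) a * h a (fst z))" for g h :: "nat \<Rightarrow> nat \<Rightarrow> complex"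
    unfolding mult.assoc using x J
    by (subst sum_of_bool_snd) (auto simp: sum_distrib_left mult.left_commute)
  have "x = z \<longleftrightarrow> snd x = snd z \<and> fst x = fst z" by (auto simp: prod_eq_iff)
  then show "(\<Sum>y\<in>block_set r i \<times> J. left_mult x y * (of_bool (snd y = snd z) * const_diag_inv (fst y) (fst z))) = of_bool (x = z) \<and>
     (\<Sum>y\<in>block_set r i \<times> J. of_bool (snd x = snd y) * const_diag_inv (fst x) (fst y) * left_mult y z) = of_bool (x = z)"
    unfolding left_mult_def e using inverse_on_const_diag[OF i] x z by (auto simp: inverse_on_def)
qed

lemma inverse_on_right_mult:
  assumes j: "j \<in> {1..k}" and I: "finite I"
  shows "inverse_on (I \<times> block_set r j) right_mult (\<lambda>x y. of_bool (fst x = fst y) * const_diag_inv (snd y) (snd x))"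
  unfolding inverse_on_def
proof (intro ballI)
  fix x z assume x: "x \<in> I \<times> block_set r j" and z: "z \<in> I \<times> block_set r j"
  have e: "(\<Sum>y\<in>I \<times> block_set r j. of_bool (fst x = fst y) * g (snd y) (snd x) * (of_bool (fst y = fst z) * h (snd z) (snd y)))
      = of_bool (fst x = fst z) * (\<Sum>a\<in>block_set r j. h (snd z) a * g a (snd x))" for g h :: "nat \<Rightarrow> nat \<Rightarrow> complex"
    unfolding mult.assoc using x I
    by (subst sum_of_bool_fst) (auto simp: sum_distrib_left mult.left_commute mult.commute)
  have "x = z \<longleftrightarrow> fst x = fst z \<and> snd z = snd x" by (auto simp: prod_eq_iff)
  then show "(\<Sum>y\<in>I \<times> block_set r j. right_mult x y * (of_bool (fst y = fst z) * const_diag_inv (snd z) (snd y))) = of_bool (x = z) \<and>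
     (\<Sum>y\<in>I \<times> block_set r j. of_bool (fst x = fst y) * const_diag_inv (snd y) (snd x) * right_mult y z) = of_bool (x = z)"
    unfolding right_mult_def e using inverse_on_const_diag[OF j] x z by (auto simp: inverse_on_def)
qed

lemma block_op_qdiff_op:
  assumes i: "i \<in> {1..k}" and j: "j \<in> {1..k}" and a: "a \<in> block_set r i" and b: "b \<in> block_set r j"
  shows "block_op i j F a b = qdiff_op q (\<mu> i) (\<mu> j) left_mult right_mult (block_set r i \<times> block_set r j) (\<lambda>y. F (fst y) (snd y)) (a, b)"
proof -
  have "(\<Sum>y\<in>block_set r i \<times> block_set r j. germ_const (right_mult (a, b) y) * germ_sigma q (F (fst y) (snd y)))
      = (\<Sum>y\<in>block_set r i \<times> block_set r j. of_bool (a = fst y) * (germ_const (const_diag (snd y) b) * germ_sigma q (F (fst y) (snd y))))"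
    by (intro sum.cong) (auto simp: right_mult_def)
  also have "\<dots> = (\<Sum>c\<in>block_set r j. germ_const (const_diag c b) * germ_sigma q (F a c))"
    using a by (subst sum_of_bool_fst) simp_all
  also have "germ_z powi \<mu> j * \<dots> = (\<Sum>c\<in>block_set r j. germ_sigma q (F a c) * diag_entry c b)"
    unfolding sum_distrib_left using block_setD(1)[OF j] by (intro sum.cong) (simp_all add: diag_entry_def mult_ac)
  finally have 1: "germ_z powi \<mu> j * (\<Sum>y\<in>block_set r i \<times> block_set r j. germ_const (right_mult (a, b) y) * germ_sigma q (F (fst y) (snd y)))
      = (\<Sum>c\<in>block_set r j. germ_sigma q (F a c) * diag_entry c b)" .
  have "(\<Sum>y\<in>block_set r i \<times> block_set r j. germ_const (left_mult (a, b) y) * F (fst y) (snd y))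
      = (\<Sum>y\<in>block_set r i \<times> block_set r j. of_bool (b = snd y) * (germ_const (const_diag a (fst y)) * F (fst y) (snd y)))"
    by (intro sum.cong) (auto simp: left_mult_def)
  also have "\<dots> = (\<Sum>c\<in>block_set r i. germ_const (const_diag a c) * F c b)"
    using b by (subst sum_of_bool_snd) simp_all
  also have "germ_z powi \<mu> i * \<dots> = (\<Sum>c\<in>block_set r i. diag_entry a c * F c b)"
    unfolding sum_distrib_left using block_setD(1)[OF i a] by (intro sum.cong) (simp_all add: diag_entry_def mult_ac)
  finally show ?thesis using 1 by (simp add: block_op_def qdiff_op_def)
qed

lemma slope_less: "i \<in> {1..k} \<Longrightarrow> j \<in> {1..k} \<Longrightarrow> i < j \<Longrightarrow> \<mu> i < \<mu> j"
  using slopes by (simp add: strict_mono_on_def)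

lemma block_op_window_unique:
  assumes i: "i \<in> {1..k}" and j: "j \<in> {1..k}" and ij: "i < j"
    and w: "\<And>a b. a \<in> block_set r i \<Longrightarrow> b \<in> block_set r j \<Longrightarrow> germ_window (\<mu> i) (\<mu> j) (block_op i j F a b)"
    and a: "a \<in> block_set r i" and b: "b \<in> block_set r j"
  shows "F a b = 0"
proof -
  have "(\<lambda>y. F (fst y) (snd y)) (a, b) = 0"
  proof (rule qdiff_op_window_unique[OF q slope_less[OF i j ij] _ inverse_on_left_mult[OF i] inverse_on_right_mult[OF j]])
    fix x assume "x \<in> block_set r i \<times> block_set r j"
    then show "germ_window (\<mu> i) (\<mu> j) (qdiff_op q (\<mu> i) (\<mu> j) left_mult right_mult (block_set r i \<times> block_set r j) (\<lambda>y. F (fst y) (snd y)) x)"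
      using w[of "fst x" "snd x"] block_op_qdiff_op[OF i j, of "fst x" "snd x" F] by auto
  qed (use a b in simp_all)
  then show ?thesis by simp
qed

lemma block_op_window_exists:
  assumes i: "i \<in> {1..k}" and j: "j \<in> {1..k}" and ij: "i < j"
  shows "\<exists>F. \<forall>a\<in>block_set r i. \<forall>b\<in>block_set r j. germ_window (\<mu> i) (\<mu> j) (G a b + block_op i j F a b)"
proof -
  have "\<exists>F. \<forall>x\<in>block_set r i \<times> block_set r j. germ_window (\<mu> i) (\<mu> j) (G (fst x) (snd x) +
      qdiff_op q (\<mu> i) (\<mu> j) left_mult right_mult (block_set r i \<times> block_set r j) F x)"
    by (rule qdiff_op_window_exists[OF q slope_less[OF i j ij] _ inverse_on_left_mult[OF i] inverse_on_right_mult[OF j]]) simp_all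
  then obtain F where F: "\<forall>x\<in>block_set r i \<times> block_set r j. germ_window (\<mu> i) (\<mu> j) (G (fst x) (snd x) +
      qdiff_op q (\<mu> i) (\<mu> j) left_mult right_mult (block_set r i \<times> block_set r j) F x)" by (elim exE)
  show ?thesis
  proof (intro exI[of _ "\<lambda>a b. F (a, b)"] ballI)
    fix a b assume "a \<in> block_set r i" "b \<in> block_set r j"
    then show "germ_window (\<mu> i) (\<mu> j) (G a b + block_op i j (\<lambda>a b. F (a, b)) a b)"
      using F[rule_format, of "(a, b)"] block_op_qdiff_op[OF i j, of a b "\<lambda>a b. F (a, b)"] by simp
  qed
qed

text \<open>Linearity over the constants: \<sigma>_q fixes them, while a general germ could not be
  pulled out of both terms.\<close>

lemma block_op_sum:
  "block_op i j (\<lambda>a b. \<Sum>s\<in>S. germ_const (w s) * F s a b) a b = (\<Sum>s\<in>S. germ_const (w s) * block_op i j (F s) a b)"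
proof -
  have "(\<Sum>c\<in>block_set r j. germ_sigma q (\<Sum>s\<in>S. germ_const (w s) * F s a c) * diag_entry c b) =
      (\<Sum>s\<in>S. germ_const (w s) * (\<Sum>c\<in>block_set r j. germ_sigma q (F s a c) * diag_entry c b))"
    using q_nonzero by (simp add: germ_sigma_sum germ_sigma_mult sum_distrib_left sum_distrib_right mult.assoc)
      (rule sum.swap)
  moreover have "(\<Sum>c\<in>block_set r i. diag_entry a c * (\<Sum>s\<in>S. germ_const (w s) * F s c b)) =
      (\<Sum>s\<in>S. germ_const (w s) * (\<Sum>c\<in>block_set r i. diag_entry a c * F s c b))"
    by (simp add: sum_distrib_left mult.left_commute) (rule sum.swap)
  ultimately show ?thesis by (simp add: block_op_def right_diff_distrib sum_subtractf)
qed

lemma gpoly_block_op: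
  "(\<And>a b. gpoly m (\<lambda>t. F t a b)) \<Longrightarrow> gpoly m (\<lambda>t. block_op i j (F t) a b)"
  unfolding block_op_def using q_nonzero
  by (intro gpoly_diff gpoly_sum gpoly_mult gpoly_sigma gpoly_const) simp_all

text \<open>A correction chosen separately for each t would carry no information about its
  dependence on t. So it is chosen once for every entry and monomial of G, and recombined with the
  monomials as constant coefficients.\<close>

lemma block_op_window_family:
  assumes i: "i \<in> {1..k}" and j: "j \<in> {1..k}" and ij: "i < j"
    and G: "\<And>a b. a \<in> block_set r i \<Longrightarrow> b \<in> block_set r j \<Longrightarrow> gpoly m (\<lambda>t. G t a b)"
  shows "\<exists>F. (\<forall>a b. gpoly m (\<lambda>t. F t a b)) \<and> (\<forall>t. \<forall>a\<in>block_set r i. \<forall>b\<in>block_set r j.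
    germ_window (\<mu> i) (\<mu> j) (G t a b + block_op i j (F t) a b))"
proof -
  let ?I = "block_set r i \<times> block_set r j"
  have "gpoly m (\<lambda>t. G t (fst p) (snd p))" if "p \<in> ?I" for p
    using G that by auto
  then obtain S c where "\<forall>p\<in>?I. finite (S p)"
    "\<forall>p\<in>?I. \<forall>t. G t (fst p) (snd p) = (\<Sum>\<alpha>\<in>S p. germ_const (\<Prod>l<m. t l ^ \<alpha> l) * c p \<alpha>)"
    by (rule gpoly_familyE)
  note Sc = this(1)[THEN bspec] this(2)[THEN bspec, THEN spec]
  define J where "J = Sigma ?I S"
  \<comment> \<open>The block with a single nonzero entry at most: the coefficient of one monomial,
    at the position where it occurs in G.\<close>
  define E :: "(nat \<times> nat) \<times> (nat \<Rightarrow> nat) \<Rightarrow> nat \<Rightarrow> nat \<Rightarrow> germ"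
    where "E s a b = of_bool (fst s = (a, b)) * c (fst s) (snd s)" for s a b
  have J: "finite J" unfolding J_def using Sc(1) by (intro finite_SigmaI) simp_all
  define mon :: "(nat \<Rightarrow> complex) \<Rightarrow> (nat \<times> nat) \<times> (nat \<Rightarrow> nat) \<Rightarrow> complex"
    where "mon t s = (\<Prod>l<m. t l ^ snd s l)" for t s
  have GE: "G t a b = (\<Sum>s\<in>J. germ_const (mon t s) * E s a b)"
    if a: "a \<in> block_set r i" and b: "b \<in> block_set r j" for t a b
  proof -
    have "(\<Sum>s\<in>J. germ_const (mon t s) * E s a b) =
        (\<Sum>p\<in>?I. \<Sum>\<alpha>\<in>S p. germ_const (mon t (p, \<alpha>)) * E (p, \<alpha>) a b)"
      unfolding J_def using Sc(1) by (subst sum.Sigma) (auto simp: case_prod_beta)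
    also have "\<dots> = (\<Sum>p\<in>?I. if p = (a, b) then G t a b else 0)"
    proof (intro sum.cong refl)
      fix p assume "p \<in> ?I"
      then show "(\<Sum>\<alpha>\<in>S p. germ_const (mon t (p, \<alpha>)) * E (p, \<alpha>) a b) = (if p = (a, b) then G t a b else 0)"
        using Sc(2)[of p t] by (cases "p = (a, b)") (simp_all add: E_def mon_def)
    qed
    also have "\<dots> = G t a b" using a b by simp
    finally show ?thesis by simp
  qed
  have "\<forall>s\<in>J. \<exists>F. \<forall>a\<in>block_set r i. \<forall>b\<in>block_set r j. germ_window (\<mu> i) (\<mu> j) (E s a b + block_op i j F a b)"
    by (intro ballI block_op_window_exists[OF i j ij])
  then obtain F where F: "\<forall>s\<in>J. \<forall>a\<in>block_set r i. \<forall>b\<in>block_set r j.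
      germ_window (\<mu> i) (\<mu> j) (E s a b + block_op i j (F s) a b)"
    by (rule bchoice[THEN exE])
  show ?thesis
  proof (intro exI[of _ "\<lambda>t a b. \<Sum>s\<in>J. germ_const (mon t s) * F s a b"] conjI allI ballI)
    fix a b
    show "gpoly m (\<lambda>t. \<Sum>s\<in>J. germ_const (mon t s) * F s a b)"
      by (rule gpoly_monomials[OF J, where e = snd and c = "\<lambda>s. F s a b"]) (simp add: mon_def)
  next
    fix t a b assume a: "a \<in> block_set r i" and b: "b \<in> block_set r j"
    have "G t a b + block_op i j (\<lambda>a b. \<Sum>s\<in>J. germ_const (mon t s) * F s a b) a b =
        (\<Sum>s\<in>J. germ_const (mon t s) * (E s a b + block_op i j (F s) a b))"
      by (simp add: GE[OF a b] block_op_sum distrib_left sum.distrib)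
    also have "germ_window (\<mu> i) (\<mu> j) \<dots>"
      using F a b by (intro germ_window_sum germ_window_scale) simp
    finally show "germ_window (\<mu> i) (\<mu> j)
        (G t a b + block_op i j (\<lambda>a b. \<Sum>s\<in>J. germ_const (mon t s) * F s a b) a b)" .
  qed
qed

end


section \<open>Normal forms\<close>

context slope_data
begin

definition between :: "nat \<Rightarrow> nat \<Rightarrow> nat set" where
  "between a b = {c. c < N \<and> \<beta> a < \<beta> c \<and> \<beta> c < \<beta> b}"

text \<open>Apart from \<open>U a b\<close> itself, only entries at smaller block distance than (a,
  b) occur. This makes the gauge equation solvable by induction on the distance.\<close>

definition lower_terms :: "(nat \<Rightarrow> nat \<Rightarrow> germ) \<Rightarrow> (nat \<Rightarrow> nat \<Rightarrow> germ) \<Rightarrow> (nat \<Rightarrow> nat \<Rightarrow> germ) \<Rightarrow>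
    nat \<Rightarrow> nat \<Rightarrow> germ" where
  "lower_terms U V F a b = U a b +
     ((\<Sum>c\<in>between a b. germ_sigma q (F a c) * U c b) - (\<Sum>c\<in>between a b. V a c * F c b))"

text \<open>The summand at \<open>c\<close> depends on its block: in the block of \<open>a\<close> a
  diagonal entry appears, in the block of \<open>b\<close> only \<open>c = b\<close> survives
  because F is the identity there, beyond these blocks one factor vanishes.\<close>

lemma block_entry_sum:
  assumes F: "unipotent F" and a: "a < N" and b: "b < N" and ab: "\<beta> a < \<beta> b"
  shows "(\<Sum>c<N. block_entry V a c * F c b) =
    (\<Sum>c\<in>block_set r (\<beta> a). diag_entry a c * F c b) + V a b + (\<Sum>c\<in>between a b. V a c * F c b)"
proof -
  have "(\<Sum>c<N. block_entry V a c * F c b) = (\<Sum>c<N. (if \<beta> c = \<beta> a then diag_entry a c * F c b else 0) +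
      (if c = b then V a b else 0) + (if \<beta> a < \<beta> c \<and> \<beta> c < \<beta> b then V a c * F c b else 0))"
  proof (intro sum.cong refl)
    fix c assume "c \<in> {..<N}"
    then have "F c b = of_bool (c = b)" if "\<beta> b \<le> \<beta> c"
      using F b that by (simp add: unipotent_def)
    then show "block_entry V a c * F c b = (if \<beta> c = \<beta> a then diag_entry a c * F c b else 0) +
      (if c = b then V a b else 0) + (if \<beta> a < \<beta> c \<and> \<beta> c < \<beta> b then V a c * F c b else 0)"
      using ab by (cases "\<beta> c < \<beta> b") (auto simp: block_entry_def)
  qed
  also have "\<dots> = (\<Sum>c\<in>{c \<in> {..<N}. \<beta> c = \<beta> a}. diag_entry a c * F c b) + V a b +
      (\<Sum>c\<in>{c \<in> {..<N}. \<beta> a < \<beta> c \<and> \<beta> c < \<beta> b}. V a c * F c b)"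
    using b by (simp only: sum.distrib sum.inter_filter finite_lessThan) simp
  also have "{c \<in> {..<N}. \<beta> c = \<beta> a} = block_set r (\<beta> a)"
    using block_set_eq[OF block_in(1)[OF a]] by auto
  finally show ?thesis by (simp add: between_def)
qed

lemma sigma_block_entry_sum:
  assumes F: "unipotent F" and a: "a < N" and b: "b < N" and ab: "\<beta> a < \<beta> b"
  shows "(\<Sum>c<N. germ_sigma q (F a c) * block_entry U c b) = (\<Sum>c\<in>block_set r (\<beta> b). germ_sigma q (F a c) * diag_entry c b) +
    U a b + (\<Sum>c\<in>between a b. germ_sigma q (F a c) * U c b)"
proof -
  have "(\<Sum>c<N. germ_sigma q (F a c) * block_entry U c b) =
      (\<Sum>c<N. (if \<beta> c = \<beta> b then germ_sigma q (F a c) * diag_entry c b else 0) +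
      (if c = a then U a b else 0) + (if \<beta> a < \<beta> c \<and> \<beta> c < \<beta> b then germ_sigma q (F a c) * U c b else 0))"
  proof (intro sum.cong refl)
    fix c assume "c \<in> {..<N}"
    then have "germ_sigma q (F a c) = of_bool (a = c)" if "\<beta> c \<le> \<beta> a"
      using F a that q_nonzero by (simp add: unipotent_def)
    then show "germ_sigma q (F a c) * block_entry U c b = (if \<beta> c = \<beta> b then germ_sigma q (F a c) * diag_entry c b else 0) +
      (if c = a then U a b else 0) + (if \<beta> a < \<beta> c \<and> \<beta> c < \<beta> b then germ_sigma q (F a c) * U c b else 0)"
      using ab by (cases "\<beta> a < \<beta> c") (auto simp: block_entry_def)
  qed
  also have "\<dots> = (\<Sum>c\<in>{c \<in> {..<N}. \<beta> c = \<beta> b}. germ_sigma q (F a c) * diag_entry c b) + U a b +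
      (\<Sum>c\<in>{c \<in> {..<N}. \<beta> a < \<beta> c \<and> \<beta> c < \<beta> b}. germ_sigma q (F a c) * U c b)"
    using a by (simp only: sum.distrib sum.inter_filter finite_lessThan) simp
  also have "{c \<in> {..<N}. \<beta> c = \<beta> b} = block_set r (\<beta> b)"
    using block_set_eq[OF block_in(1)[OF b]] by auto
  finally show ?thesis by (simp add: between_def)
qed

text \<open>Unipotency collapses each side to one entry on or below the block diagonal, and these
  entries do not depend on U or V.\<close>

lemma gauge_lower:
  assumes F: "unipotent F" and a: "a < N" and b: "b < N" and ab: "\<beta> b \<le> \<beta> a"
  shows "(\<Sum>c<N. block_entry V a c * F c b) = (\<Sum>c<N. germ_sigma q (F a c) * block_entry U c b)"
proof -
  have "block_entry V a c * F c b = (if c = b then block_entry V a b else 0)" if "c < N" for c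
    using F b ab that by (cases "\<beta> b \<le> \<beta> c") (auto simp: unipotent_def block_entry_def)
  then have "(\<Sum>c<N. block_entry V a c * F c b) = block_entry V a b" using b by simp
  moreover have "germ_sigma q (F a c) * block_entry U c b = (if c = a then block_entry U a b else 0)" if "c < N" for c
    using F a ab that q_nonzero by (cases "\<beta> c \<le> \<beta> a") (auto simp: unipotent_def block_entry_def)
  then have "(\<Sum>c<N. germ_sigma q (F a c) * block_entry U c b) = block_entry U a b" using a by simp
  moreover have "block_entry V a b = block_entry U a b" using ab by (simp add: block_entry_def)
  ultimately show ?thesis by simp
qed

lemma gauge_iff:
  assumes F: "unipotent F"
  shows "gauge U V F \<longleftrightarrow> (\<forall>a<N. \<forall>b<N. \<beta> a < \<beta> b \<longrightarrow>
    V a b = lower_terms U V F a b + block_op (\<beta> a) (\<beta> b) F a b)"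
proof -
  have "(\<Sum>c<N. block_entry V a c * F c b) = (\<Sum>c<N. germ_sigma q (F a c) * block_entry U c b) \<longleftrightarrow>
      (\<beta> a < \<beta> b \<longrightarrow> V a b = lower_terms U V F a b + block_op (\<beta> a) (\<beta> b) F a b)"
    if a: "a < N" and b: "b < N" for a b
  proof (cases "\<beta> a < \<beta> b")
    case True
    have "x + v + y = x' + u + y' \<longleftrightarrow> v = u + (y' - y) + (x' - x)" for x y v x' y' u :: germ
      by (auto simp: algebra_simps)
    then show ?thesis
      unfolding block_entry_sum[OF F a b True] sigma_block_entry_sum[OF F a b True] lower_terms_def block_op_def
      using True by simp
  next
    case False
    then show ?thesis using gauge_lower[OF F a b] by simp
  qed
  then show ?thesis unfolding gauge_def by simp
qed

definition normal_form :: "(nat \<Rightarrow> nat \<Rightarrow> germ) \<Rightarrow> bool" where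
  "normal_form V \<longleftrightarrow> (\<forall>a<N. \<forall>b<N. \<beta> a < \<beta> b \<longrightarrow> germ_window (\<mu> (\<beta> a)) (\<mu> (\<beta> b)) (V a b))"

lemma normal_formD:
  "normal_form V \<Longrightarrow> a < N \<Longrightarrow> b < N \<Longrightarrow> \<beta> a < \<beta> b \<Longrightarrow> germ_window (\<mu> (\<beta> a)) (\<mu> (\<beta> b)) (V a b)"
  by (simp add: normal_form_def)

lemma block_op_cong:
  assumes "\<And>c. c \<in> block_set r j \<Longrightarrow> F a c = F' a c" "\<And>c. c \<in> block_set r i \<Longrightarrow> F c b = F' c b"
  shows "block_op i j F a b = block_op i j F' a b"
  using assms by (simp add: block_op_def)

text \<open>The vanishing of F has to be carried along in the induction: once F is 0 at smaller
  distances, W - V equals \<open>block_op\<close> of F at the next distance. Being also in the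
  window, it forces F, and with it W - V, to vanish there.\<close>

lemma normal_form_unique:
  assumes V: "normal_form V" and W: "normal_form W" and F: "unipotent F" and G: "gauge V W F"
    and "a < N" "b < N" "\<beta> a < \<beta> b"
  shows "V a b = W a b"
proof -
  have "\<forall>a<N. \<forall>b<N. \<beta> a < \<beta> b \<and> \<beta> b \<le> \<beta> a + s \<longrightarrow> F a b = 0 \<and> V a b = W a b" for s
  proof (induction s)
    case 0
    then show ?case by auto
  next
    case (Suc s)
    have eq: "W a b = V a b + block_op (\<beta> a) (\<beta> b) F a b"
      if ab: "a < N" "b < N" "\<beta> a < \<beta> b" "\<beta> b \<le> \<beta> a + Suc s" for a b
    proof -
      have "F a c = 0" "F c b = 0" if "c \<in> between a b" for c
        using Suc.IH ab that by (auto simp: between_def)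
      then have "lower_terms V W F a b = V a b" using q_nonzero by (simp add: lower_terms_def)
      then show ?thesis using G ab unfolding gauge_iff[OF F] by simp
    qed
    have F0: "F a b = 0" if ab: "a < N" "b < N" "\<beta> a < \<beta> b" "\<beta> b \<le> \<beta> a + Suc s" for a b
    proof (rule block_op_window_unique[OF block_in(1)[OF ab(1)] block_in(1)[OF ab(2)] ab(3)])
      fix a' b' assume a': "a' \<in> block_set r (\<beta> a)" and b': "b' \<in> block_set r (\<beta> b)"
      note a'' = block_setD(1,2)[OF block_in(1)[OF ab(1)] a'] and b'' = block_setD(1,2)[OF block_in(1)[OF ab(2)] b']
      have "block_op (\<beta> a) (\<beta> b) F a' b' = W a' b' - V a' b'"
        using eq[of a' b'] a'' b'' ab by simp
      moreover have "germ_window (\<mu> (\<beta> a)) (\<mu> (\<beta> b)) (W a' b' - V a' b')"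
        using normal_formD[OF V, of a' b'] normal_formD[OF W, of a' b'] a'' b'' ab
        by (intro germ_window_diff) simp_all
      ultimately show "germ_window (\<mu> (\<beta> a)) (\<mu> (\<beta> b)) (block_op (\<beta> a) (\<beta> b) F a' b')" by simp
    qed (use block_in(2)[OF ab(1)] block_in(2)[OF ab(2)] in simp_all)
    show ?case
    proof (intro allI impI, elim conjE, intro conjI)
      fix a b assume ab: "a < N" "b < N" "\<beta> a < \<beta> b" "\<beta> b \<le> \<beta> a + Suc s"
      show "F a b = 0" by (rule F0[OF ab])
      have "F a c = 0" if "c \<in> block_set r (\<beta> b)" for c
        using block_setD(1,2)[OF block_in(1)[OF ab(2)] that] ab by (intro F0) simp_all
      moreover have "F c b = 0" if "c \<in> block_set r (\<beta> a)" for c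
        using block_setD(1,2)[OF block_in(1)[OF ab(1)] that] ab by (intro F0) simp_all
      ultimately have "block_op (\<beta> a) (\<beta> b) F a b = 0"
        using q_nonzero by (simp add: block_op_def)
      then show "V a b = W a b" using eq[OF ab] by simp
    qed
  qed
  from this[of k] show ?thesis using assms(5-7) block_in(1)[OF assms(6)] by simp
qed

text \<open>Polynomial dependence is maintained for F as well as for V, since both enter the
  right-hand sides at the next block distance.\<close>

lemma normal_form_family:
  assumes U: "\<And>a b. a < N \<Longrightarrow> b < N \<Longrightarrow> \<beta> a < \<beta> b \<Longrightarrow> gpoly m (\<lambda>t. U t a b)"
  obtains V F where "\<And>a b. gpoly m (\<lambda>t. V t a b)"
    and "\<And>t. unipotent (F t)" and "\<And>t. gauge (U t) (V t) (F t)" and "\<And>t. normal_form (V t)"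
proof -
  have "\<exists>V F. (\<forall>a b. gpoly m (\<lambda>t. V t a b) \<and> gpoly m (\<lambda>t. F t a b)) \<and>
      (\<forall>t. unipotent (F t) \<and> normal_form (V t) \<and>
        (\<forall>a<N. \<forall>b<N. \<beta> a < \<beta> b \<and> \<beta> b \<le> \<beta> a + s \<longrightarrow>
          V t a b = lower_terms (U t) (V t) (F t) a b + block_op (\<beta> a) (\<beta> b) (F t) a b))" for s
  proof (induction s)
    case 0
    show ?case
      \<comment> \<open>At distance 0 no equation is imposed; the zero normal form and the identity
        gauge start the induction.\<close>
      by (intro exI[of _ "\<lambda>_ _ _. 0"] exI[of _ "\<lambda>_ a b. of_bool (a = b)"])
        (auto simp: unipotent_def normal_form_def germ_window_def)
  next
    case (Suc s)
    then obtain V F where "\<forall>a b. gpoly m (\<lambda>t. V t a b) \<and> gpoly m (\<lambda>t. F t a b)"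
      "\<forall>t. unipotent (F t) \<and> normal_form (V t) \<and>
        (\<forall>a<N. \<forall>b<N. \<beta> a < \<beta> b \<and> \<beta> b \<le> \<beta> a + s \<longrightarrow>
          V t a b = lower_terms (U t) (V t) (F t) a b + block_op (\<beta> a) (\<beta> b) (F t) a b)"
      by (elim exE conjE)
    then have VF: "\<And>a b. gpoly m (\<lambda>t. V t a b)" "\<And>a b. gpoly m (\<lambda>t. F t a b)"
      "\<And>t. unipotent (F t)" "\<And>t. normal_form (V t)"
      "\<And>t a b. a < N \<Longrightarrow> b < N \<Longrightarrow> \<beta> a < \<beta> b \<Longrightarrow> \<beta> b \<le> \<beta> a + s \<Longrightarrow>
        V t a b = lower_terms (U t) (V t) (F t) a b + block_op (\<beta> a) (\<beta> b) (F t) a b"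
      by simp_all
    define G where "G t a b = lower_terms (U t) (V t) (F t) a b" for t a b
    have G: "gpoly m (\<lambda>t. G t a b)" if "a < N" "b < N" "\<beta> a < \<beta> b" for a b
      unfolding G_def lower_terms_def
      by (intro gpoly_add gpoly_diff gpoly_sum gpoly_mult gpoly_sigma[OF q_nonzero] VF(1,2) U)
        (use that in \<open>simp_all add: between_def\<close>)
    have "\<exists>H. (\<forall>a b. gpoly m (\<lambda>t. H t a b)) \<and> (\<forall>t. \<forall>a\<in>block_set r i. \<forall>b\<in>block_set r (i + Suc s).
        germ_window (\<mu> i) (\<mu> (i + Suc s)) (G t a b + block_op i (i + Suc s) (H t) a b))"
      if i: "i \<in> {1..k}" and j: "i + Suc s \<in> {1..k}" for i
    proof (rule block_op_window_family[OF i j])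
      fix a b assume a: "a \<in> block_set r i" and b: "b \<in> block_set r (i + Suc s)"
      show "gpoly m (\<lambda>t. G t a b)"
        using block_setD(1,2)[OF i a] block_setD(1,2)[OF j b] by (intro G) simp_all
    qed simp
    then have "\<forall>i\<in>{i \<in> {1..k}. i + Suc s \<in> {1..k}}. \<exists>H. (\<forall>a b. gpoly m (\<lambda>t. H t a b)) \<and>
        (\<forall>t. \<forall>a\<in>block_set r i. \<forall>b\<in>block_set r (i + Suc s).
          germ_window (\<mu> i) (\<mu> (i + Suc s)) (G t a b + block_op i (i + Suc s) (H t) a b))"
      by simp
    then obtain H where "\<forall>i\<in>{i \<in> {1..k}. i + Suc s \<in> {1..k}}. (\<forall>a b. gpoly m (\<lambda>t. H i t a b)) \<and>
        (\<forall>t. \<forall>a\<in>block_set r i. \<forall>b\<in>block_set r (i + Suc s).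
          germ_window (\<mu> i) (\<mu> (i + Suc s)) (G t a b + block_op i (i + Suc s) (H i t) a b))"
      by (rule bchoice[THEN exE])
    then have H: "\<And>i a b. i \<in> {1..k} \<Longrightarrow> i + Suc s \<in> {1..k} \<Longrightarrow> gpoly m (\<lambda>t. H i t a b)"
      "\<And>i t a b. i \<in> {1..k} \<Longrightarrow> i + Suc s \<in> {1..k} \<Longrightarrow> a \<in> block_set r i \<Longrightarrow> b \<in> block_set r (i + Suc s) \<Longrightarrow>
        germ_window (\<mu> i) (\<mu> (i + Suc s)) (G t a b + block_op i (i + Suc s) (H i t) a b)"
      by simp_all
    define new_level where "new_level a b \<longleftrightarrow> a < N \<and> b < N \<and> \<beta> b = \<beta> a + Suc s" for a b
    have new_level: "\<beta> a \<in> {1..k}" "\<beta> a + Suc s \<in> {1..k}" if "new_level a b" for a b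
      using that block_in(1)[of a r k] block_in(1)[of b r k] by (simp_all add: new_level_def)
    define F' where "F' t a b = (if new_level a b then H (\<beta> a) t a b else F t a b)" for t a b
    \<comment> \<open>V' is defined by the equation to be satisfied; the choice of H makes this
      value lie in the window.\<close>
    define V' where "V' t a b = (if new_level a b then G t a b + block_op (\<beta> a) (\<beta> b) (F' t) a b else V t a b)" for t a b
    have F'poly: "gpoly m (\<lambda>t. F' t a b)" for a b
      by (cases "new_level a b") (simp_all add: F'_def VF(2) H(1)[OF new_level])
    have V'poly: "gpoly m (\<lambda>t. V' t a b)" for a b
    proof (cases "new_level a b")
      case True
      then have "gpoly m (\<lambda>t. G t a b + block_op (\<beta> a) (\<beta> b) (F' t) a b)"
        by (intro gpoly_add G gpoly_block_op F'poly) (simp_all add: new_level_def)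
      then show ?thesis using True by (simp add: V'_def)
    qed (simp add: V'_def VF(1))
    have uni: "unipotent (F' t)" for t
      using VF(3)[of t] by (auto simp: unipotent_def F'_def new_level_def)
    \<comment> \<open>The entries just replaced are too far from the diagonal to occur in these
      terms, so the equations already solved persist.\<close>
    have lower: "lower_terms (U t) (V' t) (F' t) a b = G t a b" if "\<beta> b \<le> \<beta> a + Suc s" for t a b
    proof -
      have "\<not> new_level a c" "\<not> new_level c b" if "c \<in> between a b" for c
        using that \<open>\<beta> b \<le> \<beta> a + Suc s\<close> by (auto simp: new_level_def between_def)
      then show ?thesis by (simp add: lower_terms_def G_def V'_def F'_def)
    qed
    have norm: "normal_form (V' t)" for t
      unfolding normal_form_def
    proof (intro allI impI)
      fix a b assume ab: "a < N" "b < N" "\<beta> a < \<beta> b"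
      show "germ_window (\<mu> (\<beta> a)) (\<mu> (\<beta> b)) (V' t a b)"
      proof (cases "new_level a b")
        case True
        then have b: "\<beta> b = \<beta> a + Suc s" by (simp add: new_level_def)
        have "block_op (\<beta> a) (\<beta> b) (F' t) a b = block_op (\<beta> a) (\<beta> b) (H (\<beta> a) t) a b"
        proof (rule block_op_cong)
          fix c assume "c \<in> block_set r (\<beta> b)"
          then show "F' t a c = H (\<beta> a) t a c"
            using block_setD(1,2)[OF block_in(1)[OF ab(2)]] b ab by (simp add: F'_def new_level_def)
        next
          fix c assume "c \<in> block_set r (\<beta> a)"
          then show "F' t c b = H (\<beta> a) t c b"
            using block_setD(1,2)[OF block_in(1)[OF ab(1)]] b ab by (simp add: F'_def new_level_def)
        qed
        then show ?thesis
          using H(2)[OF new_level[OF True] block_in(2)[OF ab(1)], of b t] block_in(2)[OF ab(2)] True b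
          by (simp add: V'_def)
      next
        case False
        then show ?thesis using VF(4)[of t] ab by (simp add: V'_def normal_form_def)
      qed
    qed
    have "V' t a b = lower_terms (U t) (V' t) (F' t) a b + block_op (\<beta> a) (\<beta> b) (F' t) a b"
      if ab: "a < N" "b < N" "\<beta> a < \<beta> b" "\<beta> b \<le> \<beta> a + Suc s" for t a b
    proof (cases "new_level a b")
      case True
      then show ?thesis using lower[OF ab(4)] by (simp add: V'_def)
    next
      case False
      then have "\<beta> b \<le> \<beta> a + s" using ab by (simp add: new_level_def)
      moreover have "block_op (\<beta> a) (\<beta> b) (F' t) a b = block_op (\<beta> a) (\<beta> b) (F t) a b"
      proof (rule block_op_cong)
        fix c assume "c \<in> block_set r (\<beta> b)"
        then show "F' t a c = F t a c"
          using block_setD(1,2)[OF block_in(1)[OF ab(2)]] False ab by (simp add: F'_def new_level_def)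
      next
        fix c assume "c \<in> block_set r (\<beta> a)"
        then show "F' t c b = F t c b"
          using block_setD(1,2)[OF block_in(1)[OF ab(1)]] False ab by (simp add: F'_def new_level_def)
      qed
      ultimately show ?thesis
        using VF(5)[OF ab(1-3)] lower[OF ab(4)] False by (simp add: V'_def G_def)
    qed
    then show ?case
      using F'poly V'poly uni norm by (intro exI[of _ V'] exI[of _ F']) simp
  qed
  from this[of k] obtain V F where VF: "\<forall>a b. gpoly m (\<lambda>t. V t a b) \<and> gpoly m (\<lambda>t. F t a b)"
    "\<forall>t. unipotent (F t) \<and> normal_form (V t) \<and> (\<forall>a<N. \<forall>b<N. \<beta> a < \<beta> b \<and> \<beta> b \<le> \<beta> a + k \<longrightarrow>
      V t a b = lower_terms (U t) (V t) (F t) a b + block_op (\<beta> a) (\<beta> b) (F t) a b)"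
    by (elim exE conjE)
  have "\<beta> b \<le> \<beta> a + k" if "b < N" for a b using block_in(1)[OF that] by simp
  then have "gauge (U t) (V t) (F t)" for t
    using VF(2) by (simp add: gauge_iff)
  then show ?thesis using VF by (intro that[of V F]) simp_all
qed

end


section \<open>The space of classes\<close>

lemma affine_space_of_bij:
  assumes \<psi>: "bij_betw \<psi> (cspace d) X"
  shows "affine_space d X (\<lambda>v x. \<psi> (inv_into (cspace d) \<psi> x + v))"
proof -
  let ?c = "inv_into (cspace d) \<psi>"
  have 0: "0 \<in> cspace d" by (simp add: cspace_def zero_fun_def)
  have add: "v + w \<in> cspace d" if "v \<in> cspace d" "w \<in> cspace d" for v w
    using that by (simp add: cspace_def plus_fun_def)
  have diff: "v - w \<in> cspace d" if "v \<in> cspace d" "w \<in> cspace d" for v w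
    using that by (simp add: cspace_def fun_diff_def)
  have c: "?c x \<in> cspace d" "\<psi> (?c x) = x" if "x \<in> X" for x
    using \<psi> that by (auto simp: bij_betw_def inv_into_into f_inv_into_f)
  have c\<psi>: "?c (\<psi> v) = v" if "v \<in> cspace d" for v
    using \<psi> that by (simp add: bij_betw_def)
  have \<psi>X: "\<psi> v \<in> X" if "v \<in> cspace d" for v
    using \<psi> that by (auto simp: bij_betw_def)
  have "\<exists>!v. v \<in> cspace d \<and> \<psi> (?c x + v) = y" if "x \<in> X" "y \<in> X" for x y
  proof (rule ex1I[of _ "?c y - ?c x"])
    show "?c y - ?c x \<in> cspace d \<and> \<psi> (?c x + (?c y - ?c x)) = y"
      using c that diff by simp
    fix v assume v: "v \<in> cspace d \<and> \<psi> (?c x + v) = y"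
    then have "?c (\<psi> (?c x + v)) = ?c x + v" using c that add by (intro c\<psi>) simp
    then show "v = ?c y - ?c x" using v by (simp add: algebra_simps)
  qed
  moreover have "\<psi> (?c x + (v + w)) = \<psi> (?c (\<psi> (?c x + w)) + v)"
    if "v \<in> cspace d" "w \<in> cspace d" "x \<in> X" for v w x
    using c that add by (simp add: c\<psi> algebra_simps)
  moreover have "X \<noteq> {}" using \<psi>X[OF 0] by blast
  ultimately show ?thesis
    unfolding affine_space_def using \<psi>X add c by simp
qed

context slope_data
begin

text \<open>The triple (a, b, n) stands for the coefficient of z^n in the entry (a, b) of a normal
  form, so these triples index the coordinates.\<close>

definition exponents :: "(nat \<times> nat \<times> int) set" where
  "exponents = (SIGMA a:{..<N}. SIGMA b:{..<N}. if \<beta> a < \<beta> b then {\<mu> (\<beta> a)..<\<mu> (\<beta> b)} else {})"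

lemma sum_over_blocks: "(\<Sum>a<N. g (\<beta> a)) = (\<Sum>i=1..k. r i * g i :: nat)"
proof -
  have "(\<Sum>a<N. g (\<beta> a)) = (\<Sum>i=1..k. \<Sum>a\<in>{a \<in> {..<N}. \<beta> a = i}. g (\<beta> a))"
    using block_in(1) by (intro sum.group[symmetric]) auto
  also have "\<dots> = (\<Sum>i=1..k. r i * g i)"
  proof (intro sum.cong refl)
    fix i assume i: "i \<in> {1..k}"
    have "{a \<in> {..<N}. \<beta> a = i} = block_set r i" using block_set_eq[OF i] by auto
    moreover have "card (block_set r i) = r i" using i by (simp add: block_set_def offset_pred)
    moreover have "(\<Sum>a\<in>block_set r i. g (\<beta> a)) = (\<Sum>a\<in>block_set r i. g i)"
      using block_setD(1)[OF i] by (intro sum.cong) simp_all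
    ultimately show "(\<Sum>a\<in>{a \<in> {..<N}. \<beta> a = i}. g (\<beta> a)) = r i * g i"
      by (simp only: sum_constant) simp
  qed
  finally show ?thesis .
qed

lemma card_exponents:
  "card exponents = (\<Sum>j=1..k. \<Sum>i=1..<j. r i * r j * nat (\<mu> j - \<mu> i))"
proof -
  \<comment> \<open>Extending the window length by 0 to i \<ge> j lets both block numbers run over
    all of 1..k, so that \<open>sum_over_blocks\<close> applies twice.\<close>
  define w where "w i j = (if i < j then nat (\<mu> j - \<mu> i) else 0)" for i j
  have c: "card (if \<beta> a < \<beta> b then {\<mu> (\<beta> a)..<\<mu> (\<beta> b)} else {}) = w (\<beta> a) (\<beta> b)" for a b
    by (simp add: w_def)
  have "card exponents = (\<Sum>a<N. \<Sum>b<N. w (\<beta> a) (\<beta> b))"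
    unfolding exponents_def by (simp add: card_SigmaI c)
  also have "\<dots> = (\<Sum>a<N. \<Sum>j=1..k. r j * w (\<beta> a) j)"
    by (simp only: sum_over_blocks)
  also have "\<dots> = (\<Sum>i=1..k. r i * (\<Sum>j=1..k. r j * w i j))"
    by (rule sum_over_blocks)
  also have "\<dots> = (\<Sum>j=1..k. \<Sum>i=1..k. r i * r j * w i j)"
    unfolding sum_distrib_left mult.assoc[symmetric] by (rule sum.swap)
  also have "\<dots> = (\<Sum>j=1..k. \<Sum>i=1..<j. r i * r j * nat (\<mu> j - \<mu> i))"
    by (intro sum.cong refl sum.mono_neutral_cong_right) (auto simp: w_def)
  finally show ?thesis .
qed

lemma finite_exponents: "finite exponents"
  by (auto simp: exponents_def)

lemma gauge_cong:
  assumes "\<And>a b. a < N \<Longrightarrow> b < N \<Longrightarrow> V a b = V' a b" "\<And>a b. a < N \<Longrightarrow> b < N \<Longrightarrow> \<beta> a < \<beta> b \<Longrightarrow> W a b = W' a b"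
  shows "gauge V W F \<longleftrightarrow> gauge V' W' F"
proof -
  have "block_entry V a b = block_entry V' a b" "block_entry W a b = block_entry W' a b" if "a < N" "b < N" for a b
    using assms that by (auto simp: block_entry_def)
  then show ?thesis by (simp add: gauge_def)
qed

abbreviation "iso_class U \<equiv> isoformal_class q k P (obj U)"

lemma class_eq_iff: "iso_class U = iso_class V \<longleftrightarrow> (obj U, obj V) \<in> filtered_equiv q k P"
  unfolding isoformal_class_def
  by (rule eq_equiv_class_iff[OF equiv_filtered_equiv]) (simp_all add: filtered_object_obj)

lemma iso_class_in_classes: "iso_class U \<in> isoformal_classes q k P"
  unfolding isoformal_classes_def isoformal_class_def by (rule quotientI) (simp add: filtered_object_obj)

lemma classes_iso_class:
  assumes "x \<in> isoformal_classes q k P"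
  obtains W where "x = iso_class (block_split W)"
proof -
  obtain M where M: "filtered_object q k P M" "x = filtered_equiv q k P `` {M}"
    using assms unfolding isoformal_classes_def by (auto elim: quotientE)
  obtain W where "(obj (block_split W), M) \<in> filtered_equiv q k P"
    by (rule filtered_object_matrix[OF M(1)])
  then have "x = iso_class (block_split W)"
    unfolding M(2) isoformal_class_def by (rule equiv_class_eq[OF equiv_filtered_equiv, symmetric])
  then show ?thesis by (rule that)
qed

section \<open>Coordinates on the set of classes\<close>

context
  fixes d :: nat and e :: "nat \<Rightarrow> nat \<times> nat \<times> int"
  assumes e: "bij_betw e {..<d} exponents"
begin

text \<open>The normal form with prescribed coefficients: the coordinate of number l is the
  coefficient at the triple \<open>e l\<close>.\<close>

definition normal_matrix :: "(nat \<Rightarrow> complex) \<Rightarrow> nat \<Rightarrow> nat \<Rightarrow> germ" where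
  "normal_matrix w a b = (\<Sum>n\<in>{\<mu> (\<beta> a)..<\<mu> (\<beta> b)}.
     germ_z powi n * germ_const (w (inv_into {..<d} e (a, b, n))))"

definition coords :: "(nat \<Rightarrow> nat \<Rightarrow> germ) \<Rightarrow> nat \<Rightarrow> complex" where
  "coords V l = (if l < d then germ_nth (V (fst (e l)) (fst (snd (e l)))) (snd (snd (e l))) else 0)"

lemma germ_nth_normal_matrix: "germ_nth (normal_matrix w a b) n =
    (if \<mu> (\<beta> a) \<le> n \<and> n < \<mu> (\<beta> b) then w (inv_into {..<d} e (a, b, n)) else 0)"
proof -
  have "germ_nth (normal_matrix w a b) n =
      (\<Sum>l\<in>{\<mu> (\<beta> a)..<\<mu> (\<beta> b)}. if n = l then w (inv_into {..<d} e (a, b, l)) else 0)"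
    unfolding normal_matrix_def germ_nth_sum by (intro sum.cong) (simp_all add: germ_nth_const)
  then show ?thesis by simp
qed

lemma normal_form_normal_matrix: "normal_form (normal_matrix w)"
  by (simp add: normal_form_def germ_window_def germ_nth_normal_matrix)

lemma exponents_nth:
  assumes "l < d"
  shows "fst (e l) < N" "fst (snd (e l)) < N" "\<beta> (fst (e l)) < \<beta> (fst (snd (e l)))"
    "\<mu> (\<beta> (fst (e l))) \<le> snd (snd (e l))" "snd (snd (e l)) < \<mu> (\<beta> (fst (snd (e l))))"
proof -
  have "e l \<in> exponents" using e assms by (auto simp: bij_betw_def)
  then show "fst (e l) < N" "fst (snd (e l)) < N" "\<beta> (fst (e l)) < \<beta> (fst (snd (e l)))"
    "\<mu> (\<beta> (fst (e l))) \<le> snd (snd (e l))" "snd (snd (e l)) < \<mu> (\<beta> (fst (snd (e l))))"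
    by (auto simp: exponents_def split: if_splits)
qed

lemma exponents_index:
  assumes "a < N" "b < N" "\<beta> a < \<beta> b" "\<mu> (\<beta> a) \<le> n" "n < \<mu> (\<beta> b)"
  shows "e (inv_into {..<d} e (a, b, n)) = (a, b, n)" "inv_into {..<d} e (a, b, n) < d"
proof -
  have "(a, b, n) \<in> e ` {..<d}" using assms e by (simp add: bij_betw_def exponents_def)
  then show "e (inv_into {..<d} e (a, b, n)) = (a, b, n)" "inv_into {..<d} e (a, b, n) < d"
    using f_inv_into_f inv_into_into by (metis, metis lessThan_iff)
qed

lemma coords_in_cspace: "coords V \<in> cspace d"
  by (simp add: cspace_def coords_def)

lemma coords_normal_matrix: "w \<in> cspace d \<Longrightarrow> coords (normal_matrix w) = w"
proof
  fix l assume w: "w \<in> cspace d"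
  have "inv_into {..<d} e (e l) = l" if "l < d"
    using e that by (simp add: bij_betw_def)
  then show "coords (normal_matrix w) l = w l"
    using exponents_nth[of l] w by (auto simp: coords_def germ_nth_normal_matrix cspace_def)
qed

lemma normal_matrix_coords:
  assumes V: "normal_form V" and ab: "a < N" "b < N" "\<beta> a < \<beta> b"
  shows "normal_matrix (coords V) a b = V a b"
proof (rule germ_eqI)
  fix n
  show "germ_nth (normal_matrix (coords V) a b) n = germ_nth (V a b) n"
    using exponents_index[OF ab, of n] normal_formD[OF V ab]
    by (cases "n < \<mu> (\<beta> a) \<or> \<mu> (\<beta> b) \<le> n")
      (auto simp: germ_nth_normal_matrix coords_def germ_window_def)
qed

definition moduli_point :: "(nat \<Rightarrow> complex) \<Rightarrow> filtered_qmod set" where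
  "moduli_point w = iso_class (block_split (normal_matrix w))"

lemma iso_class_eq_moduli_point:
  assumes "unipotent F" "gauge (block_join U) V F" "normal_form V"
  shows "iso_class U = moduli_point (coords V)"
proof -
  have "gauge (block_join U) (block_join (block_split (normal_matrix (coords V)))) F"
    using assms(2) by (subst gauge_cong[where V' = "block_join U" and W' = V])
      (simp_all add: block_join_split normal_matrix_coords[OF assms(3)])
  then show ?thesis
    unfolding moduli_point_def class_eq_iff by (rule filtered_equiv_obj_of_gauge[OF assms(1)])
qed

lemma moduli_point_bij: "bij_betw moduli_point (cspace d) (isoformal_classes q k P)"
proof (rule bij_betw_imageI)
  show "inj_on moduli_point (cspace d)"
  proof (rule inj_onI)
    fix v w assume vw: "v \<in> cspace d" "w \<in> cspace d" "moduli_point v = moduli_point w"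
    then have "(obj (block_split (normal_matrix v)), obj (block_split (normal_matrix w))) \<in> filtered_equiv q k P"
      by (simp add: moduli_point_def class_eq_iff)
    then obtain F where F: "unipotent F"
      "gauge (block_join (block_split (normal_matrix v))) (block_join (block_split (normal_matrix w))) F"
      by (rule gauge_of_filtered_equiv_obj)
    then have "gauge (normal_matrix v) (normal_matrix w) F"
      by (subst (asm) gauge_cong[where V' = "normal_matrix v" and W' = "normal_matrix w"])
        (simp_all add: block_join_split)
    note eq = normal_form_unique[OF normal_form_normal_matrix normal_form_normal_matrix F(1) this]
    have "coords (normal_matrix v) = coords (normal_matrix w)"
      by (rule ext) (simp add: coords_def eq exponents_nth)
    then show "v = w" using vw by (simp add: coords_normal_matrix)
  qed
  show "moduli_point ` cspace d = isoformal_classes q k P"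
  proof (intro equalityI subsetI)
    fix x assume "x \<in> moduli_point ` cspace d"
    then show "x \<in> isoformal_classes q k P" by (auto simp: moduli_point_def iso_class_in_classes)
  next
    fix x assume "x \<in> isoformal_classes q k P"
    then obtain W where x: "x = iso_class (block_split W)" by (rule classes_iso_class)
    \<comment> \<open>A single matrix is treated as a constant family, and the parameter is then set
      to 0.\<close>
    obtain V F where VF: "\<And>t :: nat \<Rightarrow> complex. unipotent (F t)"
      "\<And>t. gauge (block_join (block_split W)) (V t) (F t)" "\<And>t. normal_form (V t)"
      using normal_form_family[of 0 "\<lambda>_. block_join (block_split W)"] gpoly_const by metis
    then have "x = moduli_point (coords (V 0))" unfolding x by (rule iso_class_eq_moduli_point)
    then show "x \<in> moduli_point ` cspace d" using coords_in_cspace by blast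
  qed
qed

text \<open>Every coefficient of a normal form is one coordinate, so the entries are affine in the
  parameter. The shift by \<open>w\<close> places the origin at a given class.\<close>

lemma algebraic_family_normal_matrix:
  "algebraic_family d k r (\<lambda>v. block_split (normal_matrix (w + v)))"
  unfolding algebraic_family_def
proof (intro ballI conjI allI impI)
  fix i j t assume "i \<in> {1..k}" "j \<in> {i<..k}"
  show "block_split (normal_matrix (w + t)) i j \<in> carrier_mat (r i) (r j)"
    by (simp add: block_split_def)
next
  fix i j a b assume i: "i \<in> {1..k}" and j: "j \<in> {i<..k}" and a: "a < r i" and b: "b < r j"
  define a' b' where "a' = offset r (i - 1) + a" and "b' = offset r (j - 1) + b"
  have jk: "j \<in> {1..k}" using j by auto
  have "a' \<in> block_set r i" "b' \<in> block_set r j"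
    using a b i jk by (simp_all add: a'_def b'_def block_set_def offset_pred del: One_nat_def)
  then have ab: "\<beta> a' = i" "a' < N" "\<beta> b' = j" "b' < N"
    using block_setD[OF i] block_setD[OF jk] by simp_all
  have "gpoly d (\<lambda>t. germ_const (w l + t l))" if "l < d" for l
    using that by (simp add: gpoly_add gpoly_var)
  then have "gpoly d (\<lambda>t. normal_matrix (w + t) a' b')"
    unfolding normal_matrix_def plus_fun_def using ab j exponents_index(2)[of a' b']
    by (intro gpoly_sum gpoly_mult gpoly_const) auto
  then show "gpoly d (\<lambda>t. block_split (normal_matrix (w + t)) i j $$ (a, b))"
    using a b by (simp add: block_split_def a'_def b'_def)
qed

lemma algebraic_family_classified:
  assumes U: "algebraic_family m k r U"
  shows "\<exists>V. (\<forall>a b. gpoly m (\<lambda>t. V t a b)) \<and> (\<forall>t. iso_class (U t) = moduli_point (coords (V t)))"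
proof -
  have "gpoly m (\<lambda>t. block_join (U t) a b)" if ab: "a < N" "b < N" "\<beta> a < \<beta> b" for a b
  proof -
    have "\<beta> a \<in> {1..k}" "\<beta> b \<in> {\<beta> a<..k}"
      using block_in(1)[OF ab(1)] block_in(1)[OF ab(2)] ab(3) by auto
    then show ?thesis
      using U \<rho>_less[OF ab(1)] \<rho>_less[OF ab(2)] unfolding algebraic_family_def block_join_def by blast
  qed
  then obtain V F where VF: "\<And>a b. gpoly m (\<lambda>t. V t a b)" "\<And>t. unipotent (F t)"
    "\<And>t. gauge (block_join (U t)) (V t) (F t)" "\<And>t. normal_form (V t)"
    using normal_form_family[of m "\<lambda>t. block_join (U t)"] by metis
  show ?thesis
    using VF(1) iso_class_eq_moduli_point[OF VF(2-4)] by (intro exI[of _ V] conjI allI)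
qed

lemma polynomial_coords:
  assumes "\<And>a b. gpoly m (\<lambda>t. V t a b)" "l < d"
  shows "polynomial_fun m (*) (\<lambda>t. coords (V t) l - w)"
proof -
  let ?T = "\<lambda>x. germ_nth x (snd (snd (e l)))"
  let ?n = "snd (snd (e l))"
  \<comment> \<open>The constant \<open>w\<close> is written as the coefficient of z^n in a constant
    family, so that the difference is one linear functional applied to a polynomial family.\<close>
  have "polynomial_fun m (*) (\<lambda>t. ?T (V t (fst (e l)) (fst (snd (e l))) - germ_z powi ?n * germ_const w))"
    by (rule polynomial_fun_linear[where T = ?T])
      (simp_all add: gpoly_diff assms(1) distrib_left)
  then show ?thesis using assms(2) by (simp add: coords_def germ_nth_const)
qed

lemma classifies_families_moduli_point:
  "classifies_families k r iso_class d (isoformal_classes q k P)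
    (\<lambda>v x. moduli_point (inv_into (cspace d) moduli_point x + v))"
  unfolding classifies_families_def
proof (intro ballI conjI allI impI)
  fix p assume p: "p \<in> isoformal_classes q k P"
  define w where "w = inv_into (cspace d) moduli_point p"
  have w: "w \<in> cspace d"
    unfolding w_def using moduli_point_bij p by (intro inv_into_into) (simp add: bij_betw_def)
  show "\<exists>U. algebraic_family d k r U \<and>
      (\<forall>v\<in>cspace d. moduli_point (inv_into (cspace d) moduli_point p + v) = iso_class (U v))"
    unfolding w_def[symmetric]
    by (intro exI[of _ "\<lambda>v. block_split (normal_matrix (w + v))"] conjI algebraic_family_normal_matrix)
      (simp add: moduli_point_def)
  fix m U assume U: "algebraic_family m k r U"
  obtain V where "\<forall>a b. gpoly m (\<lambda>t. V t a b)" "\<forall>t. iso_class (U t) = moduli_point (coords (V t))"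
    using algebraic_family_classified[OF U] by (elim exE conjE)
  note V = this(1)[rule_format] this(2)[rule_format]
  show "\<exists>h. (\<forall>l<d. polynomial_fun m (*) (\<lambda>t. h t l)) \<and>
      (\<forall>t\<in>cspace m. h t \<in> cspace d \<and> moduli_point (inv_into (cspace d) moduli_point p + h t) = iso_class (U t))"
    unfolding w_def[symmetric]
  \<comment> \<open>The classifying map is the coordinate vector of the normal form relative to that
    of the origin \<open>p\<close>.\<close>
  proof (intro exI[of _ "\<lambda>t l. coords (V t) l - w l"] conjI allI impI ballI)
    fix l assume "l < d"
    then show "polynomial_fun m (*) (\<lambda>t. coords (V t) l - w l)"
      by (intro polynomial_coords V(1))
  next
    fix t
    show "(\<lambda>l. coords (V t) l - w l) \<in> cspace d"
      using coords_in_cspace[of "V t"] w by (simp add: cspace_def)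
    have "w + (\<lambda>l. coords (V t) l - w l) = coords (V t)"
      by (simp add: plus_fun_def)
    then show "moduli_point (w + (\<lambda>l. coords (V t) l - w l)) = iso_class (U t)"
      by (simp only: V(2))
  qed
qed

end

end

theorem theorem3p3p5:
  fixes q :: complex and k :: nat and \<mu> :: "nat \<Rightarrow> int" and r :: "nat \<Rightarrow> nat"
    and A :: "nat \<Rightarrow> complex mat" and P :: "nat \<Rightarrow> qmod"
  assumes q: "norm q > 1"
    and k: "k \<ge> 1"
    and slopes: "strict_mono_on {1..k} \<mu>"
    and ranks: "\<And>i. i \<in> {1..k} \<Longrightarrow> r i \<ge> 1"
    and A: "\<And>i. i \<in> {1..k} \<Longrightarrow> A i \<in> carrier_mat (r i) (r i) \<and> invertible_mat (A i)"
    and P: "\<And>i. i \<in> {1..k} \<Longrightarrow> P i = pure_piece q (\<mu> i) (A i)"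
  defines "d \<equiv> (\<Sum>j=1..k. \<Sum>i=1..<j. r i * r j * nat (\<mu> j - \<mu> i))"
  shows "\<exists>act. affine_space d (isoformal_classes q k P) act \<and>
               classifies_families k r
                 (\<lambda>U. isoformal_class q k P (matrix_object q k \<mu> r A U))
                 d (isoformal_classes q k P) act"
proof -
  interpret slope_data q k \<mu> r A P
    by unfold_locales (fact q slopes A P)+
  have "card {..<d} = card exponents" by (simp add: d_def card_exponents)
  \<comment> \<open>Any numbering of the coefficient positions serves as a system of
    coordinates.\<close>
  then obtain e where "bij_betw e {..<d} exponents"
    using finite_same_card_bij[OF finite_lessThan finite_exponents] by blast
  then show ?thesis
    using affine_space_of_bij[OF moduli_point_bij] classifies_families_moduli_point by blast
qed

end
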